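(* Let $T>0$ be arbitrary. For every $u_0\in L^\infty(\mathbb{T})$ there exists a unique weak entropy solution of the periodic Fornberg–Whitham problem $u_t+uu_x+(1-\partial_x^2)^{-1}u_x=0$ ($x\in\mathbb{T}$, $t>0$), $u(x,0)=u_0(x)$, on the time interval $[0,T]$.
   Context: $\mathbb{T}=\mathbb{R}/\mathbb{Z}$, functions on $\mathbb{T}$ identified with $1$-periodic functions on $\mathbb{R}$. Let $K:\mathbb{T}\to\mathbb{R}$ be given on $[0,1]$ by $K(x)=\frac{\sqrt e}{e-1}\cosh(x-\tfrac12)$, extended periodically; then $(1-\partial_x^2)^{-1}w_x=K'\ast w$ (convolution in $x$ over $\mathbb{T}$), with $K'$ bounded. Given $u_0\in L^\infty(\mathbb{T})$ and $T>0$, a function $u\in L^\infty(\mathbb{T}\times[0,T])$ is a weak entropy solution if for every $\lambda\in\mathbb{R}$ and every nonnegative $C^1$ function $\phi$ with compact support in $\mathbb{T}\times\mathbb{R}$, $$0\le\int_0^T\!\!\int_{\mathbb{T}}\Big(|u-\lambda|\,\partial_t\phi+\operatorname{sgn}(u-\lambda)\tfrac{u^2-\lambda^2}{2}\partial_x\phi-\operatorname{sgn}(u-\lambda)\,\big(K'\ast(u(\cdot,t)-\lambda)\big)(x)\,\phi\Big)dx\,dt+\int_{\mathbb{T}}|u_0(x)-\lambda|\phi(x,0)\,dx,$$ where $u=u(x,t)$, $\phi=\phi(x,t)$. *)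

theory Defs
  imports "HOL-Analysis.Analysis"
begin

text \<open>Periodic Fornberg--Whitham problem on the torus T = R/Z.
  Functions on T are represented by their values on the fundamental domain [0,1]
  (test functions are represented as 1-periodic functions on R).\<close>

definition FW_K :: "real \<Rightarrow> real" where
  "FW_K x = sqrt (exp 1) / (exp 1 - 1) * cosh (frac x - 1/2)"

text \<open>Its (a.e.) derivative K', a bounded 1-periodic function
  (equal to the derivative of FW_K at every non-integer point).\<close>
definition FW_Kp :: "real \<Rightarrow> real" where
  "FW_Kp x = sqrt (exp 1) / (exp 1 - 1) * sinh (frac x - 1/2)"

definition FW_conv :: "(real \<Rightarrow> real) \<Rightarrow> real \<Rightarrow> real" where
  "FW_conv w x = (LINT y:{0..1}|lborel. FW_Kp (x - y) * w y)"

definition Linf_torus :: "(real \<Rightarrow> real) \<Rightarrow> bool" where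
  "Linf_torus u0 \<longleftrightarrow> set_borel_measurable lborel {0..1} u0 \<and>
     (\<exists>M. AE x in lborel. x \<in> {0..1} \<longrightarrow> \<bar>u0 x\<bar> \<le> M)"

definition Linf_torus_time :: "real \<Rightarrow> (real \<Rightarrow> real \<Rightarrow> real) \<Rightarrow> bool" where
  "Linf_torus_time T u \<longleftrightarrow>
     set_borel_measurable (lborel :: (real \<times> real) measure) ({0..1} \<times> {0..T}) (\<lambda>p. u (fst p) (snd p)) \<and>
     (\<exists>M. AE p in (lborel :: (real \<times> real) measure).
         p \<in> {0..1} \<times> {0..T} \<longrightarrow> \<bar>u (fst p) (snd p)\<bar> \<le> M)"

text \<open>Nonnegative C^1 functions with compact support in T x R, phi = phi x t,
  represented as functions on R^2 that are 1-periodic in x.\<close>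
definition FW_test_fn :: "(real \<Rightarrow> real \<Rightarrow> real) \<Rightarrow> bool" where
  "FW_test_fn \<phi> \<longleftrightarrow>
     (\<forall>x t. \<phi> x t \<ge> 0) \<and>
     (\<forall>x t. \<phi> (x + 1) t = \<phi> x t) \<and>
     (\<exists>R. \<forall>x t. \<bar>t\<bar> > R \<longrightarrow> \<phi> x t = 0) \<and>
     (\<exists>\<phi>x \<phi>t.
        (\<forall>x t. ((\<lambda>p. \<phi> (fst p) (snd p)) has_derivative
                   (\<lambda>h. \<phi>x x t * fst h + \<phi>t x t * snd h)) (at (x, t))) \<and>
        continuous_on UNIV (\<lambda>p. \<phi>x (fst p) (snd p)) \<and>
        continuous_on UNIV (\<lambda>p. \<phi>t (fst p) (snd p)))"

definition FW_entropy_solution ::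
    "real \<Rightarrow> (real \<Rightarrow> real) \<Rightarrow> (real \<Rightarrow> real \<Rightarrow> real) \<Rightarrow> bool" where
  "FW_entropy_solution T u0 u \<longleftrightarrow>
     Linf_torus_time T u \<and>
     (\<forall>(c::real) \<phi>. FW_test_fn \<phi> \<longrightarrow>
        0 \<le> (LINT p:({0..1} \<times> {0..T})|(lborel :: (real \<times> real) measure).
               (let x = fst p; t = snd p in
                  \<bar>u x t - c\<bar> * deriv (\<lambda>s. \<phi> x s) t
                  + sgn (u x t - c) * ((u x t)\<^sup>2 - c\<^sup>2) / 2 * deriv (\<lambda>y. \<phi> y t) x
                  - sgn (u x t - c) * FW_conv (\<lambda>y. u y t - c) x * \<phi> x t))
            + (LINT x:{0..1}|lborel. \<bar>u0 x - c\<bar> * \<phi> x 0))"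

end

(* Approximate solutions come from Brenier's transport-collapse scheme: transport the kinetic density
   1_{xi < u(x)} freely for a time h, integrate it back in xi, and subtract h K' * u. The collapse step
   is monotone, hence an L1 contraction commuting with translations, and comparing the densities of u
   and of a constant c gives Kruzhkov's entropy inequality with an error o(h). For Lipschitz data all
   moduli of continuity are explicit in L1, uniformly in h.

   Doubling the variables compares an arbitrary (approximate) entropy solution u with such an
   approximation v. The mollifier in time is one-sided, so only v, whose initial trace is strong, has to
   be evaluated near t = 0, and a decaying weight in time absorbs the Lipschitz source. Applied to two
   approximations the estimate shows that they form a Cauchy sequence in L1, so no compactness theorem
   is needed for existence; applied to an arbitrary entropy solution it shows that the limit is
   the only one. *)

theory Submission
  imports Defs
begin

section \<open>Integration over intervals and periodic functions\<close>

text \<open>An arbitrary entropy solution is merely bounded: the inequality hands over neither a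
  modulus of continuity nor a strong initial trace. This is why regularity is asked of one side of
  every comparison only. For the approximations the pointwise Lipschitz constant does not survive
  shocks; the L1 distance to a translate does, since one step expands L1 by at most 1 + h B, where B
  bounds |K'|. Two obstacles shape the statements. The source is nonlocal, so the difference of two
  sources is controlled not pointwise but by the L1 distance in x; the order of integration in the
  doubled integral is arranged around this. And sgn is discontinuous, so an inequality at level c
  passes to the limit only when the limit takes the value c on a null set; the countably many other
  levels are recovered by averaging over levels on both sides. The estimates for an approximation
  hold for a range of bounds, levels and test functions that grows with its index, so that each
  given solution or test function is eventually covered.\<close>

definition ivm :: "real \<Rightarrow> real \<Rightarrow> real measure" where
  "ivm a b = density lborel (indicator {a..b})"

lemma sets_ivm[simp, measurable_cong]: "sets (ivm a b) = sets borel"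
  by (simp add: ivm_def)

lemma space_ivm[simp]: "space (ivm a b) = UNIV"
  by (simp add: ivm_def)

lemma emeasure_ivm: "A \<in> sets borel \<Longrightarrow> emeasure (ivm a b) A = emeasure lborel (A \<inter> {a..b})"
  unfolding ivm_def by (subst emeasure_density) (auto simp: nn_integral_indicator[symmetric] indicator_inter_arith mult.commute intro!: nn_integral_cong)

text \<open>Restricting Lebesgue measure by a density rather than to a subspace keeps the
  sigma-algebra Borel on the whole line. Measurability then does not depend on the interval, and
  finiteness makes every bounded Borel function integrable, which settles most integrability goals
  below.\<close>

interpretation ivm: finite_measure "ivm a b" for a b
  by (rule finite_measureI) (simp add: emeasure_ivm emeasure_lborel_Icc_eq)

interpretation ivm2: pair_sigma_finite "ivm a b" "ivm c d" for a b c d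
  by unfold_locales

lemma finite_measure_pair_ivm: "finite_measure (ivm a b \<Otimes>\<^sub>M ivm c d)"
  by (rule finite_measureI) (auto simp: space_pair_measure ivm.emeasure_pair_measure_Times emeasure_ivm emeasure_lborel_Icc_eq ennreal_mult_eq_top_iff simp flip: UNIV_Times_UNIV)

interpretation ivmp: finite_measure "ivm a b \<Otimes>\<^sub>M ivm c d" for a b c d
  by (rule finite_measure_pair_ivm)

interpretation ivm4: pair_sigma_finite "ivm a b \<Otimes>\<^sub>M ivm c d" "ivm a' b' \<Otimes>\<^sub>M ivm c' d'" for a b c d a' b' c' d'
  by unfold_locales

lemma sets_pair_ivm[measurable_cong]: "sets (ivm a b \<Otimes>\<^sub>M ivm c d) = sets (borel \<Otimes>\<^sub>M borel)"
  by (simp cong: sets_pair_measure_cong)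

lemma AE_ivm_iff: "(AE x in ivm a b. P x) \<longleftrightarrow> (AE x in lborel. x \<in> {a..b} \<longrightarrow> P x)"
  unfolding ivm_def by (subst AE_density) (auto simp: indicator_def)

lemma AE_ivmI: "(\<And>x. a \<le> x \<Longrightarrow> x \<le> b \<Longrightarrow> P x) \<Longrightarrow> AE x in ivm a b. P x"
  by (simp add: AE_ivm_iff)

lemma integral_ivm:
  fixes f :: "real \<Rightarrow> real"
  assumes [measurable]: "f \<in> borel_measurable borel"
  shows "integral\<^sup>L (ivm a b) f = (LINT x:{a..b}|lborel. f x)"
proof -
  have "ivm a b = density lborel (\<lambda>x. ennreal (indicator {a..b} x))"
    unfolding ivm_def by (auto simp: indicator_def intro!: density_cong)
  then show ?thesis unfolding set_lebesgue_integral_def by (simp add: integral_density)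
qed

lemma box_borel[measurable]: "{a..b} \<times> {c..d} \<in> sets (borel :: (real \<times> real) measure)"
  by (intro borel_closed closed_Times) auto

lemma pair_ivm_eq: "ivm a b \<Otimes>\<^sub>M ivm c d = density lborel (\<lambda>p. ennreal (indicator ({a..b} \<times> {c..d}) p))"
proof -
  have "(\<lambda>(x, y). indicator {a..b} x * indicator {c..d} y) = (\<lambda>p. ennreal (indicator ({a..b} \<times> {c..d}) p))"
    by (auto simp: indicator_def)
  then show ?thesis unfolding ivm_def
    by (subst pair_measure_density)
      (auto simp: lborel_prod sigma_finite_lborel intro!: ivm.sigma_finite_measure_axioms[unfolded ivm_def])
qed

lemma AE_pair_ivm_iff: "(AE p in ivm a b \<Otimes>\<^sub>M ivm c d. P p) \<longleftrightarrow> (AE p in (lborel::(real\<times>real) measure). p \<in> {a..b} \<times> {c..d} \<longrightarrow> P p)"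
proof -
  have "(\<lambda>p. ennreal (indicator ({a..b} \<times> {c..d}) p)) \<in> borel_measurable (lborel::(real\<times>real) measure)"
    using box_borel by (intro measurable_compose[OF _ measurable_ennreal] borel_measurable_indicator) simp
  then show ?thesis unfolding pair_ivm_eq by (subst AE_density) (auto simp: indicator_def)
qed

lemma integral_pair_ivm:
  fixes f :: "real \<times> real \<Rightarrow> real"
  assumes "f \<in> borel_measurable (borel \<Otimes>\<^sub>M borel)"
  shows "integral\<^sup>L (ivm a b \<Otimes>\<^sub>M ivm c d) f = (LINT x:{a..b} \<times> {c..d}|lborel. f x)"
proof -
  have "indicator ({a..b} \<times> {c..d}) \<in> borel_measurable (lborel::(real\<times>real) measure)"
    using box_borel by (intro borel_measurable_indicator) simp
  then show ?thesis
    using assms unfolding set_lebesgue_integral_def pair_ivm_eq by (subst integral_density) (auto simp: borel_prod)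
qed

lemma integral_ivm_const: "a \<le> b \<Longrightarrow> integral\<^sup>L (ivm a b) (\<lambda>_. c::real) = (b - a) * c"
  by (simp add: measure_def emeasure_ivm)

lemma integrable_ivm:
  fixes f :: "real \<Rightarrow> real"
  assumes "f \<in> borel_measurable borel" "\<And>x. a \<le> x \<Longrightarrow> x \<le> b \<Longrightarrow> \<bar>f x\<bar> \<le> C"
  shows "integrable (ivm a b) f"
  by (rule ivm.integrable_const_bound[where B=C]) (use assms in \<open>auto intro: AE_ivmI\<close>)

lemma AE_pair_ivmI: "(\<And>x y. a \<le> x \<Longrightarrow> x \<le> b \<Longrightarrow> c \<le> y \<Longrightarrow> y \<le> d \<Longrightarrow> P (x, y)) \<Longrightarrow> AE p in ivm a b \<Otimes>\<^sub>M ivm c d. P p"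
  by (auto simp: AE_pair_ivm_iff)

lemma integrable_pair_ivm:
  fixes f :: "real \<times> real \<Rightarrow> real"
  assumes [measurable]: "f \<in> borel_measurable (borel \<Otimes>\<^sub>M borel)" and "\<And>x y. a \<le> x \<Longrightarrow> x \<le> b \<Longrightarrow> c \<le> y \<Longrightarrow> y \<le> d \<Longrightarrow> \<bar>f (x, y)\<bar> \<le> C"
  shows "integrable (ivm a b \<Otimes>\<^sub>M ivm c d) f"
  by (rule ivmp.integrable_const_bound[where B=C])
     (use assms in \<open>auto intro: AE_pair_ivmI\<close>)

lemma integral_ivm_bound:
  fixes f :: "real \<Rightarrow> real"
  assumes "f \<in> borel_measurable borel" "\<And>x. a \<le> x \<Longrightarrow> x \<le> b \<Longrightarrow> \<bar>f x\<bar> \<le> C" "a \<le> b"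
  shows "\<bar>integral\<^sup>L (ivm a b) f\<bar> \<le> (b - a) * C"
proof -
  have "\<bar>integral\<^sup>L (ivm a b) f\<bar> \<le> integral\<^sup>L (ivm a b) (\<lambda>x. \<bar>f x\<bar>)" by (rule integral_abs_bound)
  also have "\<dots> \<le> integral\<^sup>L (ivm a b) (\<lambda>x. C)"
    by (rule integral_mono_AE) (use assms in \<open>auto intro!: AE_ivmI integrable_ivm[where C=C]\<close>)
  finally show ?thesis unfolding integral_ivm_const[OF assms(3)] .
qed

lemma integral_ivm_mono:
  fixes f g :: "real \<Rightarrow> real"
  assumes "f \<in> borel_measurable borel" "g \<in> borel_measurable borel"
    "\<And>x. a \<le> x \<Longrightarrow> x \<le> b \<Longrightarrow> \<bar>f x\<bar> \<le> C" "\<And>x. a \<le> x \<Longrightarrow> x \<le> b \<Longrightarrow> \<bar>g x\<bar> \<le> D"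
    "\<And>x. a \<le> x \<Longrightarrow> x \<le> b \<Longrightarrow> f x \<le> g x"
  shows "integral\<^sup>L (ivm a b) f \<le> integral\<^sup>L (ivm a b) g"
  by (rule integral_mono_AE) (use assms in \<open>auto intro!: AE_ivmI integrable_ivm[where C=C] integrable_ivm[where C=D and f=g]\<close>)

lemma Fubini_ivm:
  fixes f :: "real \<Rightarrow> real \<Rightarrow> real"
  assumes "(\<lambda>p. f (fst p) (snd p)) \<in> borel_measurable (borel \<Otimes>\<^sub>M borel)"
    "\<And>x y. a \<le> x \<Longrightarrow> x \<le> b \<Longrightarrow> c \<le> y \<Longrightarrow> y \<le> d \<Longrightarrow> \<bar>f x y\<bar> \<le> C"
  shows "(\<integral>x. (\<integral>y. f x y \<partial>ivm c d) \<partial>ivm a b) = (\<integral>y. (\<integral>x. f x y \<partial>ivm a b) \<partial>ivm c d)"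
  by (rule ivm2.Fubini_integral[symmetric])
     (use integrable_pair_ivm[of "\<lambda>p. f (fst p) (snd p)" a b c d C] assms in \<open>auto simp: case_prod_beta'\<close>)

lemma integral_pair_ivm_iterated:
  fixes f :: "real \<times> real \<Rightarrow> real"
  assumes "f \<in> borel_measurable (borel \<Otimes>\<^sub>M borel)"
    "\<And>x y. a \<le> x \<Longrightarrow> x \<le> b \<Longrightarrow> c \<le> y \<Longrightarrow> y \<le> d \<Longrightarrow> \<bar>f (x, y)\<bar> \<le> C"
  shows "integral\<^sup>L (ivm a b \<Otimes>\<^sub>M ivm c d) f = (\<integral>x. (\<integral>y. f (x, y) \<partial>ivm c d) \<partial>ivm a b)"
    and "integral\<^sup>L (ivm a b \<Otimes>\<^sub>M ivm c d) f = (\<integral>y. (\<integral>x. f (x, y) \<partial>ivm a b) \<partial>ivm c d)"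
proof -
  have i: "integrable (ivm a b \<Otimes>\<^sub>M ivm c d) f" by (rule integrable_pair_ivm[OF assms])
  show "integral\<^sup>L (ivm a b \<Otimes>\<^sub>M ivm c d) f = (\<integral>x. (\<integral>y. f (x, y) \<partial>ivm c d) \<partial>ivm a b)"
    using ivm2.integral_fst'[OF i] by simp
  show "integral\<^sup>L (ivm a b \<Otimes>\<^sub>M ivm c d) f = (\<integral>y. (\<integral>x. f (x, y) \<partial>ivm a b) \<partial>ivm c d)"
    using ivm2.integral_snd[of a b c d "\<lambda>x y. f (x, y)"] i by (simp add: case_prod_unfold)
qed

lemma periodic_int:
  fixes f :: "real \<Rightarrow> 'a"
  assumes "\<And>x. f (x + 1) = f x"
  shows "f (x + of_int k) = f x"
proof -
  have *: "f (x + of_nat n) = f x" for x n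
    by (induction n) (auto simp: assms add.assoc[symmetric] add.commute[of 1])
  show ?thesis
  proof (cases "k \<ge> 0")
    case True then show ?thesis using *[of x "nat k"] by simp
  next
    case False then show ?thesis using *[of "x + of_int k" "nat (-k)"] by simp
  qed
qed

lemma set_integrable_bounded:
  fixes f :: "real \<Rightarrow> real"
  assumes "f \<in> borel_measurable borel" "A \<in> sets borel" "emeasure lborel A < \<infinity>" "\<And>x. \<bar>f x\<bar> \<le> C"
  shows "set_integrable lborel A f"
  unfolding set_integrable_def
proof (rule integrableI_bounded_set[where A=A and B=C])
  show "(\<lambda>x. indicat_real A x *\<^sub>R f x) \<in> borel_measurable lborel"
    using assms(1,2) by measurable
  show "AE x in lborel. x \<in> A \<longrightarrow> norm (indicat_real A x *\<^sub>R f x) \<le> C" using assms(4) by simp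
qed (use assms in auto)

text \<open>For 0 <= a < 1 the unit interval is cut at 1 - a and periodicity exchanges the two
  pieces; a general a is reduced to \<open>frac a\<close>. The changes of variables on the torus, in
  the scheme as well as in the doubling, rest on this.\<close>

lemma integral_ivm_shift:
  fixes f :: "real \<Rightarrow> real"
  assumes f[measurable]: "f \<in> borel_measurable borel" and per: "\<And>x. f (x + 1) = f x" and bd: "\<And>x. \<bar>f x\<bar> \<le> C"
  shows "(\<integral>x. f (x + a) \<partial>ivm 0 1) = (\<integral>x. f x \<partial>ivm 0 1)"
proof -
  \<comment> \<open>Without the right endpoint, a null set, the two pieces are disjoint and
    additivity applies.\<close>
  have half: "(LINT x:{0..1}|lborel. g x) = (LINT x:{0..<1}|lborel. g x)" if g[measurable]: "g \<in> borel_measurable borel" for g :: "real \<Rightarrow> real"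
  proof -
    have "AE x in lborel. x \<noteq> (1::real)" by (rule AE_lborel_singleton)
    then have "AE x in lborel. indicat_real {0..1} x *\<^sub>R g x = indicat_real {0..<1} x *\<^sub>R g x"
      by eventually_elim (auto split: split_indicator)
    then show ?thesis
      unfolding set_lebesgue_integral_def by (intro integral_cong_AE) auto
  qed
  have fa: "(\<lambda>x. f (x + b)) \<in> borel_measurable borel" for b by measurable
  have main: "(\<integral>x. f (x + a) \<partial>ivm 0 1) = (\<integral>x. f x \<partial>ivm 0 1)" if a: "0 \<le> a" "a < 1" for a
  proof -
    have e1: "{0..<1} = {0..<1-a} \<union> {1-a..<1}" and e2: "{0..<1} = {0..<a} \<union> {a..<1}" using a by auto
    have s: "(LINT x:{b..<c}|lborel. f (x + d)) = (LINT x:{b+d..<c+d}|lborel. f x)" for b c d :: real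
      unfolding set_lebesgue_integral_def
      by (subst lborel_integral_real_affine[of 1 _ d])
         (auto intro!: Bochner_Integration.integral_cong simp: add.commute split: split_indicator)
    have "(LINT x:{0..<1}|lborel. f (x + a)) = (LINT x:{0..<1-a}|lborel. f (x + a)) + (LINT x:{1-a..<1}|lborel. f (x + a))"
      using a unfolding e1 by (intro set_integral_Un) (auto intro!: set_integrable_bounded[where C=C] bd fa)
    also have "(LINT x:{0..<1-a}|lborel. f (x + a)) = (LINT x:{a..<1}|lborel. f x)"
      by (simp add: s)
    also have "(LINT x:{1-a..<1}|lborel. f (x + a)) = (LINT x:{1-a..<1}|lborel. f (x + (a - 1)))"
      using per[of "_ + (a - 1)"] by (simp add: algebra_simps)
    also have "\<dots> = (LINT x:{0..<a}|lborel. f x)"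
      by (simp add: s)
    also have "(LINT x:{a..<1}|lborel. f x) + (LINT x:{0..<a}|lborel. f x) = (LINT x:{0..<1}|lborel. f x)"
      using a unfolding e2 by (subst set_integral_Un) (auto intro!: set_integrable_bounded[where C=C] bd f)
    finally show ?thesis by (simp add: integral_ivm half fa)
  qed
  have "f (x + a) = f (x + frac a)" for x
    using periodic_int[of f "x + frac a" "\<lfloor>a\<rfloor>", OF per] by (simp add: frac_def)
  then show ?thesis using main[OF frac_ge_0 frac_lt_1, of a] by simp
qed

text \<open>The map x \<mapsto> 1 - x preserves the unit interval and turns the reflection into a
  translation by a - 1.\<close>

lemma integral_ivm_reflect:
  fixes f :: "real \<Rightarrow> real"
  assumes [measurable]: "f \<in> borel_measurable borel" and per: "\<And>x. f (x + 1) = f x" and bd: "\<And>x. \<bar>f x\<bar> \<le> C"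
  shows "(\<integral>x. f (a - x) \<partial>ivm 0 1) = (\<integral>x. f x \<partial>ivm 0 1)"
proof -
  have "(\<integral>x. f (a - x) \<partial>ivm 0 1) = (\<integral>x. f (x + (a - 1)) \<partial>ivm 0 1)"
    by (subst (1 2) integral_ivm, measurable, unfold set_lebesgue_integral_def, subst lborel_integral_real_affine[of "-1" _ 1])
       (auto intro!: Bochner_Integration.integral_cong simp: algebra_simps split: split_indicator)
  also have "\<dots> = (\<integral>x. f x \<partial>ivm 0 1)" by (rule integral_ivm_shift[OF assms])
  finally show ?thesis .
qed

section \<open>The nonlocal source\<close>

lemma FW_Kp_periodic: "FW_Kp (x + 1) = FW_Kp x"
  by (simp add: FW_Kp_def frac_1_eq)

lemma FW_Kp_measurable[measurable]: "FW_Kp \<in> borel_measurable borel"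
proof -
  have "(\<lambda>z::real. sinh (z - 1/2)) \<in> borel_measurable borel"
    by (intro borel_measurable_continuous_onI continuous_intros)
  moreover have "(\<lambda>x::real. frac x) \<in> borel_measurable borel" unfolding frac_def by measurable
  ultimately show ?thesis unfolding FW_Kp_def[abs_def]
    by (intro borel_measurable_times borel_measurable_const) (rule measurable_compose)
qed

text \<open>The supremum of |K'|, attained at the integers. Its value is 1/2, half the unit jump of
  K' there, as it should be for the Green function of 1 - d^2/dx^2. It is the Lipschitz constant of
  the source in L1 and fixes the exponents of all growth factors.\<close>

definition FW_B :: real where
  "FW_B = sqrt (exp 1) / (exp 1 - 1) * sinh (1/2)"

lemma FW_B_nonneg: "FW_B \<ge> 0"
  unfolding FW_B_def by (intro mult_nonneg_nonneg divide_nonneg_nonneg) auto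

lemma FW_Kp_bound: "\<bar>FW_Kp x\<bar> \<le> FW_B"
proof -
  have f: "frac x \<ge> 0" "frac x < 1" by (auto simp: frac_lt_1)
  have "sinh (frac x - 1/2) \<le> sinh (1/2)"
    by (subst sinh_real_le_iff) (use f in simp)
  moreover have "sinh (-(1/2)) \<le> sinh (frac x - 1/2)"
    by (subst sinh_real_le_iff) (use f in simp)
  ultimately have "\<bar>sinh (frac x - 1/2)\<bar> \<le> sinh (1/2)"
    unfolding abs_le_iff using sinh_minus[of "1/2 :: real"] by linarith
  then show ?thesis unfolding FW_Kp_def FW_B_def abs_mult
    by (intro mult_mono) (auto intro!: divide_nonneg_nonneg)
qed

text \<open>K' is the derivative of a continuous periodic function, so its mean vanishes;
  concretely, \<open>cosh\<close> takes the same value at -1/2 and 1/2. Consequently the source does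
  not see constants.\<close>

lemma integral_FW_Kp_zero: "(\<integral>y. FW_Kp (x - y) \<partial>ivm 0 1) = 0"
proof -
  let ?c = "sqrt (exp 1) / (exp 1 - 1) :: real"
  have [measurable]: "(\<lambda>z::real. sinh (z - 1/2)) \<in> borel_measurable borel"
    by (intro borel_measurable_continuous_onI continuous_intros)
  have "(\<integral>y. FW_Kp (x - y) \<partial>ivm 0 1) = (\<integral>y. FW_Kp y \<partial>ivm 0 1)"
    by (rule integral_ivm_reflect[OF FW_Kp_measurable FW_Kp_periodic FW_Kp_bound])
  also have "\<dots> = (\<integral>y. ?c * sinh (y - 1/2) \<partial>ivm 0 1)"
  proof (rule integral_cong_AE)
    have "AE y in lborel. y \<noteq> (1::real)" by (rule AE_lborel_singleton)
    then show "AE y in ivm 0 1. FW_Kp y = ?c * sinh (y - 1/2)"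
      unfolding AE_ivm_iff
    proof eventually_elim
      case (elim y)
      show ?case
      proof
        assume "y \<in> {0..1}"
        with elim have "frac y = y" by (auto simp: frac_eq)
        then show "FW_Kp y = ?c * sinh (y - 1/2)" by (simp add: FW_Kp_def)
      qed
    qed
  qed measurable
  also have "\<dots> = ?c * (\<integral>y. sinh (y - 1/2) \<partial>ivm 0 1)" by simp
  also have "(\<integral>y. sinh (y - 1/2) \<partial>ivm 0 1) = cosh (1 - 1/2) - cosh (0 - 1/2 :: real)"
    unfolding integral_ivm[OF \<open>(\<lambda>z::real. sinh (z - 1/2)) \<in> borel_measurable borel\<close>] set_lebesgue_integral_def real_scaleR_def
    by (subst mult.commute, rule integral_FTC_Icc_real) (auto intro!: derivative_eq_intros continuous_intros)
  also have "\<dots> = 0" using cosh_minus[of "1/2::real"] by simp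
  finally show ?thesis by simp
qed

lemma FW_conv_eq:
  assumes [measurable]: "w \<in> borel_measurable borel"
  shows "FW_conv w x = (\<integral>y. FW_Kp (x - y) * w y \<partial>ivm 0 1)"
  unfolding FW_conv_def by (subst integral_ivm) auto

lemma FW_conv_measurable[measurable]:
  assumes [measurable]: "w \<in> borel_measurable borel"
  shows "FW_conv w \<in> borel_measurable borel"
proof -
  have "(\<lambda>x. \<integral>y. FW_Kp (x - y) * w y \<partial>ivm 0 1) \<in> borel_measurable borel" by measurable
  then show ?thesis by (simp add: FW_conv_eq[OF assms] cong: measurable_cong)
qed

lemma FW_conv_measurable2[measurable]:
  assumes [measurable]: "(\<lambda>p. u (fst p) (snd p)) \<in> borel_measurable (borel \<Otimes>\<^sub>M borel)"
  shows "(\<lambda>p. FW_conv (\<lambda>y. u y (snd p)) (fst p)) \<in> borel_measurable (borel \<Otimes>\<^sub>M borel)"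
proof -
  have s: "(\<lambda>y. u y t) \<in> borel_measurable borel" for t
    using measurable_compose[of "\<lambda>y. (y,t)" borel "borel \<Otimes>\<^sub>M borel" "\<lambda>p. u (fst p) (snd p)" borel] assms by simp
  have "(\<lambda>q. u (snd q) (snd (fst q))) \<in> borel_measurable ((borel \<Otimes>\<^sub>M borel) \<Otimes>\<^sub>M borel)"
    using measurable_compose[of "\<lambda>q. (snd q, snd (fst q))" "(borel \<Otimes>\<^sub>M borel) \<Otimes>\<^sub>M borel" "borel \<Otimes>\<^sub>M borel" "\<lambda>p. u (fst p) (snd p)" borel] assms by simp
  then have "(\<lambda>p. \<integral>y. FW_Kp (fst p - y) * u y (snd p) \<partial>ivm 0 1) \<in> borel_measurable (borel \<Otimes>\<^sub>M borel)"
    by measurable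
  then show ?thesis by (simp add: FW_conv_eq[OF s])
qed

lemma integrable_FW_Kp_mult:
  assumes [measurable]: "w \<in> borel_measurable borel" and b: "\<And>y. \<bar>w y\<bar> \<le> M"
  shows "integrable (ivm 0 1) (\<lambda>y. FW_Kp (x - y) * w y)"
  by (rule integrable_ivm[where C="FW_B * M"])
     (use FW_Kp_bound FW_B_nonneg b in \<open>auto simp: abs_mult intro!: mult_mono\<close>)

text \<open>K' has mean zero. The source may therefore be taken of u instead of u - c, the same at
  every level, and the doubling can subtract the sources of two functions although the levels
  differ.\<close>

lemma FW_conv_diff_const:
  assumes [measurable]: "w \<in> borel_measurable borel" and "\<And>y. \<bar>w y\<bar> \<le> M"
  shows "FW_conv (\<lambda>y. w y - c) x = FW_conv w x"
proof -
  have i: "integrable (ivm 0 1) (\<lambda>y. FW_Kp (x - y) * w y)" "integrable (ivm 0 1) (\<lambda>y. FW_Kp (x - y) * c)"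
    by (rule integrable_FW_Kp_mult[where M=M] integrable_FW_Kp_mult[where M="\<bar>c\<bar>"]; use assms in simp)+
  have "FW_conv (\<lambda>y. w y - c) x = (\<integral>y. FW_Kp (x - y) * w y - FW_Kp (x - y) * c \<partial>ivm 0 1)"
    by (subst FW_conv_eq) (auto simp: algebra_simps)
  also have "\<dots> = FW_conv w x - (\<integral>y. FW_Kp (x - y) * c \<partial>ivm 0 1)"
    using i by (simp add: FW_conv_eq)
  also have "(\<integral>y. FW_Kp (x - y) * c \<partial>ivm 0 1) = 0" using integral_FW_Kp_zero[of x] by simp
  finally show ?thesis by simp
qed

text \<open>A bounded kernel turns an L1 distance into a uniform one. The right-hand side does not
  depend on x; it is in this global form that the weight of the doubling has to absorb the
  source.\<close>

lemma FW_conv_diff_bound: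
  assumes [measurable]: "w \<in> borel_measurable borel" "z \<in> borel_measurable borel"
    and b: "\<And>y. \<bar>w y\<bar> \<le> M" "\<And>y. \<bar>z y\<bar> \<le> M'"
  shows "\<bar>FW_conv w x - FW_conv z x\<bar> \<le> FW_B * (\<integral>y. \<bar>w y - z y\<bar> \<partial>ivm 0 1)"
proof -
  have i: "integrable (ivm 0 1) (\<lambda>y. FW_Kp (x - y) * w y)" "integrable (ivm 0 1) (\<lambda>y. FW_Kp (x - y) * z y)"
    by (auto intro: integrable_FW_Kp_mult b)
  have "FW_conv w x - FW_conv z x = (\<integral>y. FW_Kp (x - y) * (w y - z y) \<partial>ivm 0 1)"
    using i by (simp add: FW_conv_eq right_diff_distrib)
  then have "\<bar>FW_conv w x - FW_conv z x\<bar> \<le> (\<integral>y. \<bar>FW_Kp (x - y) * (w y - z y)\<bar> \<partial>ivm 0 1)"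
    by (metis integral_abs_bound)
  also have "\<dots> \<le> (\<integral>y. FW_B * \<bar>w y - z y\<bar> \<partial>ivm 0 1)"
  proof (rule integral_ivm_mono)
    have d: "\<bar>w y - z y\<bar> \<le> M + M'" for y using b[of y] by linarith
    show "\<bar>\<bar>FW_Kp (x - y) * (w y - z y)\<bar>\<bar> \<le> FW_B * (M + M')" for y
      using FW_Kp_bound[of "x - y"] d[of y] FW_B_nonneg by (auto simp: abs_mult intro!: mult_mono)
    show "\<bar>FW_B * \<bar>w y - z y\<bar>\<bar> \<le> FW_B * (M + M')" for y
      using d[of y] FW_B_nonneg by (auto simp: abs_mult intro!: mult_mono)
    show "\<bar>FW_Kp (x - y) * (w y - z y)\<bar> \<le> FW_B * \<bar>w y - z y\<bar>" for y
      using FW_Kp_bound[of "x - y"] by (auto simp: abs_mult intro!: mult_mono)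
  qed measurable
  finally show ?thesis by simp
qed

lemma FW_conv_bound:
  assumes [measurable]: "w \<in> borel_measurable borel" and b: "\<And>y. \<bar>w y\<bar> \<le> M"
  shows "\<bar>FW_conv w x\<bar> \<le> FW_B * M"
proof -
  have "\<bar>FW_conv w x\<bar> \<le> (1 - 0) * (FW_B * M)"
    unfolding FW_conv_eq[OF assms(1)] using FW_Kp_bound FW_B_nonneg b
    by (intro integral_ivm_bound) (auto simp: abs_mult intro!: mult_mono)
  then show ?thesis by simp
qed

lemma FW_conv_shift:
  assumes [measurable]: "w \<in> borel_measurable borel" and b: "\<And>y. \<bar>w y\<bar> \<le> M" and per: "\<And>y. w (y + 1) = w y"
  shows "FW_conv w (x + a) = FW_conv (\<lambda>y. w (y + a)) x"
proof -
  have "x + a - (y + 1) + 1 = x + a - y" for y by simp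
  then have p: "FW_Kp (x + a - (y + 1)) * w (y + 1) = FW_Kp (x + a - y) * w y" for y
    using FW_Kp_periodic[of "x + a - (y + 1)"] per[of y] by metis
  have "(\<integral>y. FW_Kp (x + a - (y + a)) * w (y + a) \<partial>ivm 0 1) = (\<integral>y. FW_Kp (x + a - y) * w y \<partial>ivm 0 1)"
    by (rule integral_ivm_shift[of "\<lambda>y. FW_Kp (x + a - y) * w y" "FW_B * M" a])
       (use p FW_Kp_bound FW_B_nonneg b in \<open>auto simp: abs_mult intro!: mult_mono\<close>)
  then show ?thesis by (simp add: FW_conv_eq)
qed

lemma FW_conv_periodic:
  assumes [measurable]: "w \<in> borel_measurable borel"
  shows "FW_conv w (x + 1) = FW_conv w x"
  using FW_Kp_periodic[of "x - _"] by (simp add: FW_conv_eq algebra_simps)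

section \<open>The transport-collapse scheme\<close>

text \<open>Kruzhkov's flux of u^2/2 for the entropy |u - b|. Its symmetry in a and b is what
  cancels the flux terms when variables are doubled.\<close>

definition kflux :: "real \<Rightarrow> real \<Rightarrow> real" where
  "kflux a b = sgn (a - b) * (a\<^sup>2 - b\<^sup>2) / 2"

lemma kflux_commute: "kflux a b = kflux b a"
  unfolding kflux_def by (auto simp: sgn_real_def)

text \<open>Without the sign the flux is visibly continuous: measurability, the Lipschitz bound and
  the limit in the level all start from this form.\<close>

lemma kflux_eq: "kflux a b = \<bar>a - b\<bar> * (a + b) / 2"
  unfolding kflux_def by (simp add: sgn_real_def abs_if power2_eq_square algebra_simps)

lemma kflux_measurable[measurable]:
  "f \<in> borel_measurable M \<Longrightarrow> g \<in> borel_measurable M \<Longrightarrow> (\<lambda>x. kflux (f x) (g x)) \<in> borel_measurable M"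
  unfolding kflux_eq by (intro borel_measurable_divide borel_measurable_times borel_measurable_add borel_measurable_abs borel_measurable_diff borel_measurable_const)

lemma kflux_bound: "\<bar>a\<bar> \<le> R \<Longrightarrow> \<bar>b\<bar> \<le> R \<Longrightarrow> \<bar>kflux a b\<bar> \<le> 2 * R\<^sup>2"
proof -
  assume "\<bar>a\<bar> \<le> R" "\<bar>b\<bar> \<le> R"
  then have "\<bar>a - b\<bar> * \<bar>a + b\<bar> \<le> (2 * R) * (2 * R)" by (intro mult_mono) auto
  then show ?thesis by (simp add: kflux_eq abs_mult power2_eq_square)
qed

lemma kflux_lipschitz:
  assumes "\<bar>a\<bar> \<le> R" "\<bar>b\<bar> \<le> R" "\<bar>c\<bar> \<le> R"
  shows "\<bar>kflux a c - kflux b c\<bar> \<le> 2 * R * \<bar>a - b\<bar>"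
proof -
  have "kflux a c - kflux b c = ((\<bar>a - c\<bar> - \<bar>b - c\<bar>) * (a + c) + \<bar>b - c\<bar> * (a - b)) / 2"
    by (simp add: kflux_eq field_simps)
  also have "\<bar>\<dots>\<bar> \<le> (\<bar>\<bar>a - c\<bar> - \<bar>b - c\<bar>\<bar> * \<bar>a + c\<bar> + \<bar>b - c\<bar> * \<bar>a - b\<bar>) / 2"
    using abs_triangle_ineq[of "(\<bar>a - c\<bar> - \<bar>b - c\<bar>) * (a + c)" "\<bar>b - c\<bar> * (a - b)"] by (simp add: abs_mult)
  also have "\<dots> \<le> (\<bar>a - b\<bar> * (2 * R) + (2 * R) * \<bar>a - b\<bar>) / 2"
    using assms by (intro divide_right_mono add_mono mult_mono) auto
  finally show ?thesis by simp
qed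

text \<open>Brenier's transport-collapse operator: the kinetic density
  \<open>\<xi> \<mapsto> 1\<^bsub>\<xi> < w x\<^esub>\<close> is transported freely with speed \<open>\<xi>\<close> for time \<open>h\<close> and then
  collapsed by integration in \<open>\<xi> \<in> [-R, R]\<close>.\<close>

definition tcoll :: "real \<Rightarrow> real \<Rightarrow> (real \<Rightarrow> real) \<Rightarrow> real \<Rightarrow> real" where
  "tcoll R h w x = (\<integral>\<xi>. of_bool (\<xi> < w (x - h * \<xi>)) \<partial>ivm (-R) R) - R"

text \<open>Explains the \<open>- R\<close> in \<open>tcoll\<close>: the kinetic density of the
  state c has mass c + R on [-R, R], provided the cutoff contains c.\<close>

lemma integral_of_bool_less:
  assumes "\<bar>c\<bar> \<le> R"
  shows "(\<integral>\<xi>. of_bool (\<xi> < c) \<partial>ivm (-R) R) = c + R"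
proof -
  have "(\<integral>\<xi>. of_bool (\<xi> < c) \<partial>ivm (-R) R) = (\<integral>\<xi>. indicator {..<c} \<xi> \<partial>ivm (-R) R)"
    by (intro Bochner_Integration.integral_cong) (auto simp: indicator_def)
  also have "\<dots> = measure (ivm (-R) R) {..<c}" by simp
  also have "\<dots> = measure lborel ({..<c} \<inter> {-R..R})" by (simp add: measure_def emeasure_ivm)
  also have "{..<c} \<inter> {-R..R} = {-R..<c}" using assms by auto
  finally show ?thesis using assms by (simp add: measure_def)
qed

lemma tcoll_measurable[measurable]:
  assumes [measurable]: "w \<in> borel_measurable borel"
  shows "tcoll R h w \<in> borel_measurable borel"
proof -
  have "(\<lambda>x. (\<integral>\<xi>. of_bool (\<xi> < w (x - h * \<xi>)) \<partial>ivm (-R) R) - R) \<in> borel_measurable borel"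
    by measurable
  then show ?thesis by (simp add: tcoll_def[abs_def])
qed

lemma tcoll_periodic: "(\<And>x. w (x + 1) = w x) \<Longrightarrow> tcoll R h w (x + 1) = tcoll R h w x"
  unfolding tcoll_def by (simp add: diff_add_eq[symmetric])

text \<open>The kinetic density increases with the state, and only states at the feet of
  characteristics with |\<xi>| <= R enter. Comparison with constants, which \<open>tcoll\<close>
  preserves, will give the maximum principle.\<close>

lemma tcoll_mono:
  assumes [measurable]: "w \<in> borel_measurable borel" "z \<in> borel_measurable borel"
    and le: "\<And>\<xi>. \<bar>\<xi>\<bar> \<le> R \<Longrightarrow> w (x - h * \<xi>) \<le> z (y - h * \<xi>)"
  shows "tcoll R h w x \<le> tcoll R h z y"
  unfolding tcoll_def
  by (intro diff_right_mono integral_ivm_mono[where C=1 and D=1]) (use le in \<open>auto simp: abs_le_iff intro: order.strict_trans2\<close>)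

lemma tcoll_const: "\<bar>c\<bar> \<le> R \<Longrightarrow> tcoll R h (\<lambda>_. c) x = c"
  by (simp add: tcoll_def integral_of_bool_less)

lemma tcoll_bound:
  assumes [measurable]: "w \<in> borel_measurable borel" and "\<And>x. \<bar>w x\<bar> \<le> m" "m \<le> R"
  shows "\<bar>tcoll R h w x\<bar> \<le> m"
proof -
  have le: "w x \<le> m" "- m \<le> w x" for x using assms(2)[of x] by linarith+
  have m: "\<bar>m\<bar> \<le> R" "\<bar>-m\<bar> \<le> R" using assms(2)[of 0] assms(3) by auto
  have "tcoll R h w x \<le> tcoll R h (\<lambda>_. m) x" by (rule tcoll_mono) (auto simp: le)
  moreover have "tcoll R h (\<lambda>_. -m) x \<le> tcoll R h w x" by (rule tcoll_mono) (auto simp: le)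
  ultimately show ?thesis by (simp add: tcoll_const m)
qed

text \<open>Speeds are at most R, so the feet of the characteristics through x lie within h R of x,
  where w varies by at most L h R. Monotonicity then encloses the collapsed value between two
  constants.\<close>

lemma tcoll_lipschitz_dist:
  assumes [measurable]: "w \<in> borel_measurable borel" and b: "\<And>x. \<bar>w x\<bar> \<le> R"
    and lip: "\<And>x y. \<bar>w x - w y\<bar> \<le> L * \<bar>x - y\<bar>" and "h \<ge> 0" "L \<ge> 0"
  shows "\<bar>tcoll R h w x - w x\<bar> \<le> L * h * R"
proof -
  have R: "R \<ge> 0" using b[of 0] by simp
  have d: "\<bar>w (x - h * \<xi>) - w x\<bar> \<le> L * h * R" if "\<bar>\<xi>\<bar> \<le> R" for \<xi>
  proof -
    have "\<bar>w (x - h * \<xi>) - w x\<bar> \<le> L * (h * \<bar>\<xi>\<bar>)" using lip[of "x - h * \<xi>" x] \<open>h \<ge> 0\<close> by (simp add: abs_mult)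
    also have "\<dots> \<le> L * (h * R)" using that assms by (intro mult_left_mono) auto
    finally show ?thesis by simp
  qed
  \<comment> \<open>Truncated to [-R, R], because constants are preserved only within the
    cutoff.\<close>
  let ?a = "min R (w x + L * h * R)" and ?b = "max (-R) (w x - L * h * R)"
  have n: "L * h * R \<ge> 0" using R assms by simp
  have ab: "\<bar>?a\<bar> \<le> R" "\<bar>?b\<bar> \<le> R" using b[of x] R n by auto
  have wR: "w y \<le> R" "- R \<le> w y" for y using b[of y] by linarith+
  have "tcoll R h w x \<le> tcoll R h (\<lambda>_. ?a) x"
    by (rule tcoll_mono) (use d wR in \<open>auto simp: abs_le_iff algebra_simps\<close>)
  moreover have "tcoll R h (\<lambda>_. ?b) x \<le> tcoll R h w x"
  proof (rule tcoll_mono)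
    show "?b \<le> w (x - h * \<xi>)" if "\<bar>\<xi>\<bar> \<le> R" for \<xi> using d[OF that] wR[of "x - h * \<xi>"] by linarith
  qed measurable
  ultimately have "tcoll R h w x \<le> ?a" "?b \<le> tcoll R h w x" unfolding tcoll_const[OF ab(1)] tcoll_const[OF ab(2)] .
  then show ?thesis by linarith
qed

text \<open>The collapse integrates a difference of densities, so its modulus is at most the
  integral of the modulus. For fixed \<xi> the transport is a translation in x and can be moved over
  to the weight \<phi>. With \<phi> = 1 this becomes the L1 contraction; with a smooth \<phi> the
  expansion in h produces the entropy flux.\<close>

lemma tcoll_L1:
  assumes [measurable]: "w \<in> borel_measurable borel" "z \<in> borel_measurable borel" "\<phi> \<in> borel_measurable borel"
    and per: "\<And>x. w (x + 1) = w x" "\<And>x. z (x + 1) = z x" "\<And>x. \<phi> (x + 1) = \<phi> x"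
    and \<phi>: "\<And>x. 0 \<le> \<phi> x" "\<And>x. \<phi> x \<le> D" and R: "R \<ge> 0"
  shows "(\<integral>x. \<bar>tcoll R h w x - tcoll R h z x\<bar> * \<phi> x \<partial>ivm 0 1)
    \<le> (\<integral>x. (\<integral>\<xi>. \<bar>of_bool (\<xi> < w x) - of_bool (\<xi> < z x)\<bar> * \<phi> (x + h * \<xi>) \<partial>ivm (-R) R) \<partial>ivm 0 1)"
proof -
  define G where "G x \<xi> = \<bar>of_bool (\<xi> < w x) - of_bool (\<xi> < z x) :: real\<bar>" for x \<xi>
  have G01: "0 \<le> G x \<xi>" "G x \<xi> \<le> 1" for x \<xi> by (auto simp: G_def)
  have [measurable]: "(\<lambda>p. G (fst p) (snd p)) \<in> borel_measurable (borel \<Otimes>\<^sub>M borel)" unfolding G_def by measurable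
  have Gm[measurable]: "(\<lambda>p. G (f p) (g p)) \<in> borel_measurable N" if [measurable]: "f \<in> borel_measurable N" "g \<in> borel_measurable N" for f g and N :: "'c measure"
    unfolding G_def by measurable
  have D: "D \<ge> 0" using \<phi>[of 0] by simp
  have GD: "\<bar>G x \<xi> * \<phi> y\<bar> \<le> D" for x \<xi> y
    using mult_mono[OF G01(2)[of x \<xi>] \<phi>(2)[of y]] G01(1)[of x \<xi>] \<phi>(1)[of y] by (simp add: abs_mult)
  have pt: "\<bar>tcoll R h w x - tcoll R h z x\<bar> * \<phi> x \<le> (\<integral>\<xi>. G (x - h * \<xi>) \<xi> * \<phi> x \<partial>ivm (-R) R)" for x
  proof -
    have "tcoll R h w x - tcoll R h z x = (\<integral>\<xi>. of_bool (\<xi> < w (x - h * \<xi>)) - of_bool (\<xi> < z (x - h * \<xi>)) \<partial>ivm (-R) R)"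
      unfolding tcoll_def by (subst Bochner_Integration.integral_diff) (auto intro!: integrable_ivm[where C=1])
    then have "\<bar>tcoll R h w x - tcoll R h z x\<bar> \<le> (\<integral>\<xi>. G (x - h * \<xi>) \<xi> \<partial>ivm (-R) R)"
      unfolding G_def by (metis integral_abs_bound)
    then show ?thesis using \<phi>(1)[of x] by (simp add: mult_right_mono)
  qed
  have inb: "\<bar>\<integral>\<xi>. G (f \<xi>) \<xi> * \<phi> (g \<xi>) \<partial>ivm (-R) R\<bar> \<le> (R - - R) * D"
    if [measurable]: "f \<in> borel_measurable borel" "g \<in> borel_measurable borel" for f g
    by (rule integral_ivm_bound) (use R GD in auto)
  have "(\<integral>x. \<bar>tcoll R h w x - tcoll R h z x\<bar> * \<phi> x \<partial>ivm 0 1)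
    \<le> (\<integral>x. (\<integral>\<xi>. G (x - h * \<xi>) \<xi> * \<phi> x \<partial>ivm (-R) R) \<partial>ivm 0 1)"
  proof (rule integral_ivm_mono)
    show i: "\<bar>\<integral>\<xi>. G (x - h * \<xi>) \<xi> * \<phi> x \<partial>ivm (-R) R\<bar> \<le> (R - - R) * D" for x by (rule inb) measurable
    show "\<bar>\<bar>tcoll R h w x - tcoll R h z x\<bar> * \<phi> x\<bar> \<le> (R - - R) * D" for x
      using i[of x] pt[of x] mult_nonneg_nonneg[OF abs_ge_zero[of "tcoll R h w x - tcoll R h z x"] \<phi>(1)[of x]] by linarith
  qed (use pt in measurable)
  also have "\<dots> = (\<integral>\<xi>. (\<integral>x. G (x - h * \<xi>) \<xi> * \<phi> x \<partial>ivm 0 1) \<partial>ivm (-R) R)"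
    by (rule Fubini_ivm[where C=D]) (auto simp: GD)
  also have "\<dots> = (\<integral>\<xi>. (\<integral>x. G x \<xi> * \<phi> (x + h * \<xi>) \<partial>ivm 0 1) \<partial>ivm (-R) R)"
  proof (rule Bochner_Integration.integral_cong)
    fix \<xi>
    have "x + 1 + h * \<xi> = x + h * \<xi> + 1" for x by simp
    then have "G (x + 1) \<xi> * \<phi> (x + 1 + h * \<xi>) = G x \<xi> * \<phi> (x + h * \<xi>)" for x
      by (simp only: G_def per)
    from integral_ivm_shift[of "\<lambda>x. G x \<xi> * \<phi> (x + h * \<xi>)", OF _ this GD, of "- h * \<xi>"]
    show "(\<integral>x. G (x - h * \<xi>) \<xi> * \<phi> x \<partial>ivm 0 1) = (\<integral>x. G x \<xi> * \<phi> (x + h * \<xi>) \<partial>ivm 0 1)" by simp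
  qed simp
  also have "\<dots> = (\<integral>x. (\<integral>\<xi>. G x \<xi> * \<phi> (x + h * \<xi>) \<partial>ivm (-R) R) \<partial>ivm 0 1)"
    by (rule Fubini_ivm[where C=D]) (auto simp: GD)
  finally show ?thesis unfolding G_def .
qed

text \<open>The densities of a and b differ exactly between b and a, and the zeroth and first
  moments of this interval are a - b and (a^2 - b^2)/2. Here free transport with speed \<xi> becomes
  the Burgers flux.\<close>

lemma integral_between_ivm:
  assumes "\<bar>a\<bar> \<le> R" "\<bar>b\<bar> \<le> R" "b \<le> a"
  shows "(\<integral>\<xi>. \<bar>of_bool (\<xi> < a) - of_bool (\<xi> < b)\<bar> * (p + \<xi> * q) \<partial>ivm (-R) R) = p * (a - b) + q * (a\<^sup>2 - b\<^sup>2) / 2"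
proof -
  have m: "(\<lambda>\<xi>. \<bar>of_bool (\<xi> < a) - of_bool (\<xi> < b)\<bar> * (p + \<xi> * q)) \<in> borel_measurable borel"
    by measurable
  have "(\<integral>\<xi>. \<bar>of_bool (\<xi> < a) - of_bool (\<xi> < b)\<bar> * (p + \<xi> * q) \<partial>ivm (-R) R)
      = (\<integral>\<xi>. (p + \<xi> * q) * indicator {b..a} \<xi> \<partial>lborel)"
    unfolding integral_ivm[OF m] set_lebesgue_integral_def
  proof (rule integral_cong_AE)
    have "AE \<xi> in lborel. \<xi> \<noteq> a" by (rule AE_lborel_singleton)
    then show "AE \<xi> in lborel. indicat_real {-R..R} \<xi> *\<^sub>R (\<bar>of_bool (\<xi> < a) - of_bool (\<xi> < b)\<bar> * (p + \<xi> * q)) = (p + \<xi> * q) * indicator {b..a} \<xi>"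
      by eventually_elim (use assms in \<open>auto simp: indicator_def\<close>)
  qed measurable
  also have "\<dots> = (p * a + a\<^sup>2 * q / 2) - (p * b + b\<^sup>2 * q / 2)"
    by (rule integral_FTC_Icc_real[OF \<open>b \<le> a\<close>]) (auto intro!: derivative_eq_intros continuous_intros)
  finally show ?thesis by (simp add: field_simps)
qed

text \<open>If f is p + \<xi> q up to \<eta>, the moments yield the entropy |a - b| and Kruzhkov's
  flux, and the error is \<eta> |a - b| <= 2 r \<eta>. The expansion is asked for |\<xi>| <= r,
  where the densities can differ; thus the bound r of the states, and not the cutoff R, enters the
  error.\<close>

lemma integral_between_le:
  assumes ab: "\<bar>a\<bar> \<le> r" "\<bar>b\<bar> \<le> r" and r: "r \<le> R" and [measurable]: "f \<in> borel_measurable borel"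
    and f: "\<And>\<xi>. \<bar>\<xi>\<bar> \<le> r \<Longrightarrow> \<bar>f \<xi> - p - \<xi> * q\<bar> \<le> \<eta>"
  shows "(\<integral>\<xi>. \<bar>of_bool (\<xi> < a) - of_bool (\<xi> < b)\<bar> * f \<xi> \<partial>ivm (-R) R) \<le> p * \<bar>a - b\<bar> + q * kflux a b + 2 * r * \<eta>"
proof -
  have r0: "r \<ge> 0" using ab by simp
  have \<eta>: "\<eta> \<ge> 0" using f[of 0] r0 by simp
  have *: "(\<integral>\<xi>. \<bar>of_bool (\<xi> < a) - of_bool (\<xi> < b)\<bar> * f \<xi> \<partial>ivm (-R) R) \<le> p * \<bar>a - b\<bar> + q * (a\<^sup>2 - b\<^sup>2) / 2 + \<eta> * \<bar>a - b\<bar>"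
    if ab: "\<bar>a\<bar> \<le> r" "\<bar>b\<bar> \<le> r" "b \<le> a" for a b
  proof -
    have "(\<integral>\<xi>. \<bar>of_bool (\<xi> < a) - of_bool (\<xi> < b)\<bar> * f \<xi> \<partial>ivm (-R) R)
      \<le> (\<integral>\<xi>. \<bar>of_bool (\<xi> < a) - of_bool (\<xi> < b)\<bar> * ((p + \<eta>) + \<xi> * q) \<partial>ivm (-R) R)"
    proof (rule integral_ivm_mono)
      fix \<xi> :: real
      let ?C = "\<bar>p\<bar> + r * \<bar>q\<bar> + \<eta>"
      have C0: "?C \<ge> 0" using r0 \<eta> by simp
      have "\<bar>f \<xi>\<bar> \<le> ?C \<and> \<bar>p + \<eta> + \<xi> * q\<bar> \<le> ?C \<and> f \<xi> \<le> (p + \<eta>) + \<xi> * q" if x: "\<bar>\<xi>\<bar> \<le> r"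
      proof -
        have "\<bar>\<xi> * q\<bar> \<le> r * \<bar>q\<bar>" using x by (simp add: abs_mult mult_right_mono)
        then show ?thesis using f[OF x] \<eta> by linarith
      qed
      moreover have "\<bar>of_bool (\<xi> < a) - of_bool (\<xi> < b) :: real\<bar> = 0 \<or> \<bar>\<xi>\<bar> \<le> r \<and> \<bar>of_bool (\<xi> < a) - of_bool (\<xi> < b) :: real\<bar> = 1"
        using ab by auto
      ultimately show "\<bar>\<bar>of_bool (\<xi> < a) - of_bool (\<xi> < b)\<bar> * f \<xi>\<bar> \<le> ?C"
        and "\<bar>\<bar>of_bool (\<xi> < a) - of_bool (\<xi> < b)\<bar> * ((p + \<eta>) + \<xi> * q)\<bar> \<le> ?C"
        and "\<bar>of_bool (\<xi> < a) - of_bool (\<xi> < b)\<bar> * f \<xi> \<le> \<bar>of_bool (\<xi> < a) - of_bool (\<xi> < b)\<bar> * ((p + \<eta>) + \<xi> * q)"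
        using C0 by (elim disjE conjE; simp only: mult_zero_left mult_1_left abs_zero order_refl simp_thms)+
    qed measurable
    also have "\<dots> = (p + \<eta>) * (a - b) + q * (a\<^sup>2 - b\<^sup>2) / 2" by (rule integral_between_ivm) (use ab r in auto)
    finally show ?thesis using ab by (simp add: algebra_simps)
  qed
  have "\<eta> * \<bar>a - b\<bar> \<le> \<eta> * (2 * r)" using \<eta> ab by (intro mult_left_mono) auto
  moreover have "(\<integral>\<xi>. \<bar>of_bool (\<xi> < a) - of_bool (\<xi> < b)\<bar> * f \<xi> \<partial>ivm (-R) R) \<le> p * \<bar>a - b\<bar> + q * kflux a b + \<eta> * \<bar>a - b\<bar>"
  proof (cases "b \<le> a")
    case True
    then have e: "q * (a\<^sup>2 - b\<^sup>2) / 2 = q * kflux a b" by (auto simp: kflux_def sgn_real_def)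
    show ?thesis using *[OF ab True] by (simp only: e)
  next
    case False
    then have e: "q * (b\<^sup>2 - a\<^sup>2) / 2 = q * kflux a b" by (auto simp: kflux_def sgn_real_def)
    have e': "\<bar>of_bool (\<xi> < b) - of_bool (\<xi> < a)\<bar> = \<bar>of_bool (\<xi> < a) - of_bool (\<xi> < b) :: real\<bar>" for \<xi> by simp
    show ?thesis using *[OF ab(2,1)] False by (simp only: e e' abs_minus_commute[of b a] linear le_cases)
  qed
  ultimately show ?thesis by (simp add: mult.commute)
qed

section \<open>One time step: transport-collapse together with the source\<close>

text \<open>The source is taken at the old state w and not at the collapsed one, so that the
  difference of two steps splits at once into an L1 contraction and a term of size h
  \<open>FW_B\<close> times the L1 distance.\<close>

definition scheme :: "real \<Rightarrow> real \<Rightarrow> (real \<Rightarrow> real) \<Rightarrow> real \<Rightarrow> real" where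
  "scheme R h w x = tcoll R h w x - h * FW_conv w x"

lemma scheme_measurable[measurable]:
  assumes [measurable]: "w \<in> borel_measurable borel"
  shows "scheme R h w \<in> borel_measurable borel"
proof -
  have "(\<lambda>x. tcoll R h w x - h * FW_conv w x) \<in> borel_measurable borel" by measurable
  then show ?thesis by (simp add: scheme_def[abs_def])
qed

lemma scheme_periodic:
  "w \<in> borel_measurable borel \<Longrightarrow> (\<And>x. w (x + 1) = w x) \<Longrightarrow> scheme R h w (x + 1) = scheme R h w x"
  unfolding scheme_def by (simp add: tcoll_periodic FW_conv_periodic)

lemma scheme_shift:
  assumes "w \<in> borel_measurable borel" "\<And>y. \<bar>w y\<bar> \<le> M" "\<And>y. w (y + 1) = w y"
  shows "scheme R h (\<lambda>y. w (y + a)) x = scheme R h w (x + a)"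
  unfolding scheme_def FW_conv_shift[OF assms] tcoll_def by (simp add: diff_add_eq)

lemma scheme_bound:
  assumes [measurable]: "w \<in> borel_measurable borel" and b: "\<And>x. \<bar>w x\<bar> \<le> m" "m \<le> R" and "h \<ge> 0"
  shows "\<bar>scheme R h w x\<bar> \<le> (1 + h * FW_B) * m"
proof -
  have "\<bar>h * FW_conv w x\<bar> \<le> h * (FW_B * m)"
    using FW_conv_bound[OF assms(1) b(1)] \<open>h \<ge> 0\<close> by (simp add: abs_mult mult_left_mono)
  moreover have "\<bar>tcoll R h w x\<bar> \<le> m" by (rule tcoll_bound[OF assms(1) b])
  ultimately show ?thesis unfolding scheme_def by (simp add: algebra_simps abs_le_iff)
qed

text \<open>The zeroth moment makes the collapse a contraction, and the source adds its L1 Lipschitz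
  constant. Applied to translates and to consecutive iterates, this yields the moduli in space and
  in time.\<close>

lemma scheme_L1:
  assumes [measurable]: "w \<in> borel_measurable borel" "z \<in> borel_measurable borel"
    and per: "\<And>x. w (x + 1) = w x" "\<And>x. z (x + 1) = z x"
    and b: "\<And>x. \<bar>w x\<bar> \<le> R" "\<And>x. \<bar>z x\<bar> \<le> R" and "h \<ge> 0"
  shows "(\<integral>x. \<bar>scheme R h w x - scheme R h z x\<bar> \<partial>ivm 0 1) \<le> (1 + h * FW_B) * (\<integral>x. \<bar>w x - z x\<bar> \<partial>ivm 0 1)"
proof -
  have R: "R \<ge> 0" using b(1)[of 0] by simp
  let ?d = "\<integral>x. \<bar>w x - z x\<bar> \<partial>ivm 0 1"
  have tb: "\<bar>tcoll R h w x - tcoll R h z x\<bar> \<le> 2 * R" for x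
    using tcoll_bound[OF assms(1) b(1) order_refl, of h x] tcoll_bound[OF assms(2) b(2) order_refl, of h x] by linarith
  have cb: "\<bar>FW_conv w x - FW_conv z x\<bar> \<le> FW_B * ?d" for x
    by (rule FW_conv_diff_bound[OF assms(1,2) b])
  have i: "integrable (ivm 0 1) (\<lambda>x. \<bar>tcoll R h w x - tcoll R h z x\<bar>)"
    by (rule integrable_ivm[where C="2*R"]) (use tb in auto)
  have "(\<integral>x. \<bar>scheme R h w x - scheme R h z x\<bar> \<partial>ivm 0 1) \<le> (\<integral>x. \<bar>tcoll R h w x - tcoll R h z x\<bar> + h * (FW_B * ?d) \<partial>ivm 0 1)"
  proof (rule integral_ivm_mono)
    fix x
    have "h * \<bar>FW_conv w x - FW_conv z x\<bar> \<le> h * (FW_B * ?d)" using cb \<open>h \<ge> 0\<close> by (intro mult_left_mono) auto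
    moreover have "\<bar>h * (FW_conv w x - FW_conv z x)\<bar> = h * \<bar>FW_conv w x - FW_conv z x\<bar>" using \<open>h \<ge> 0\<close> by (simp add: abs_mult)
    ultimately show le: "\<bar>scheme R h w x - scheme R h z x\<bar> \<le> \<bar>tcoll R h w x - tcoll R h z x\<bar> + h * (FW_B * ?d)"
      unfolding scheme_def right_diff_distrib by linarith
    show "\<bar>\<bar>tcoll R h w x - tcoll R h z x\<bar> + h * (FW_B * ?d)\<bar> \<le> 2 * R + \<bar>h * (FW_B * ?d)\<bar>" using tb[of x] by linarith
    then show "\<bar>\<bar>scheme R h w x - scheme R h z x\<bar>\<bar> \<le> 2 * R + \<bar>h * (FW_B * ?d)\<bar>" using le by linarith
  qed measurable
  also have "\<dots> = (\<integral>x. \<bar>tcoll R h w x - tcoll R h z x\<bar> \<partial>ivm 0 1) + h * (FW_B * ?d)"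
    by (subst Bochner_Integration.integral_add[OF i]) (auto simp: integral_ivm_const[of 0 1, simplified])
  also have "(\<integral>x. \<bar>tcoll R h w x - tcoll R h z x\<bar> \<partial>ivm 0 1) \<le> ?d"
  proof -
    have "(\<integral>x. \<bar>tcoll R h w x - tcoll R h z x\<bar> * 1 \<partial>ivm 0 1)
      \<le> (\<integral>x. (\<integral>\<xi>. \<bar>of_bool (\<xi> < w x) - of_bool (\<xi> < z x)\<bar> * 1 \<partial>ivm (-R) R) \<partial>ivm 0 1)"
      using tcoll_L1[OF assms(1,2) borel_measurable_const[of 1] per, of 1 R h] R by simp
    also have "\<dots> \<le> ?d"
    proof (rule integral_ivm_mono)
      fix x
      show le: "(\<integral>\<xi>. \<bar>of_bool (\<xi> < w x) - of_bool (\<xi> < z x)\<bar> * 1 \<partial>ivm (-R) R) \<le> \<bar>w x - z x\<bar>"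
        using integral_between_le[OF b(1)[of x] b(2)[of x] order_refl, of "\<lambda>_. 1" 1 0 0] by simp
      show "\<bar>\<bar>w x - z x\<bar>\<bar> \<le> 2 * R" using b[of x] by linarith
      have "0 \<le> (\<integral>\<xi>. \<bar>of_bool (\<xi> < w x) - of_bool (\<xi> < z x)\<bar> * 1 \<partial>ivm (-R) R :: real)"
        by (rule Bochner_Integration.integral_nonneg) auto
      then show "\<bar>\<integral>\<xi>. \<bar>of_bool (\<xi> < w x) - of_bool (\<xi> < z x)\<bar> * 1 \<partial>ivm (-R) R\<bar> \<le> 2 * R"
        using le b[of x] by linarith
    qed measurable
    finally show ?thesis by simp
  qed
  finally show ?thesis by (simp add: algebra_simps)
qed

text \<open>Compare w with the constant c in \<open>tcoll_L1\<close> and expand \<phi> (x + h \<xi>)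
  to first order: the moments give entropy and flux at the old state. The remainder is h r \<eta>
  for each speed, and the densities differ on a set of speeds of length at most 2 r, whence 2 r^2
  \<eta> h. The sign in the source term is that of the new state.\<close>

lemma scheme_entropy_step:
  assumes [measurable]: "w \<in> borel_measurable borel" "\<phi> \<in> borel_measurable borel" "\<phi>' \<in> borel_measurable borel"
    and per: "\<And>x. w (x + 1) = w x" "\<And>x. \<phi> (x + 1) = \<phi> x"
    and b: "\<And>x. \<bar>w x\<bar> \<le> r" and c: "\<bar>c\<bar> \<le> r" and rR: "r \<le> R" and h: "h \<ge> 0"
    and \<phi>: "\<And>x. 0 \<le> \<phi> x" "\<And>x. \<phi> x \<le> D" "\<And>x. \<bar>\<phi>' x\<bar> \<le> D"
    and deriv: "\<And>x. (\<phi> has_real_derivative \<phi>' x) (at x)"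
    and modulus: "\<And>x y. \<bar>x - y\<bar> \<le> h * r \<Longrightarrow> \<bar>\<phi>' x - \<phi>' y\<bar> \<le> \<eta>"
  shows "(\<integral>x. \<bar>scheme R h w x - c\<bar> * \<phi> x \<partial>ivm 0 1)
     \<le> (\<integral>x. \<bar>w x - c\<bar> * \<phi> x \<partial>ivm 0 1) + h * (\<integral>x. kflux (w x) c * \<phi>' x \<partial>ivm 0 1)
       - h * (\<integral>x. sgn (scheme R h w x - c) * FW_conv w x * \<phi> x \<partial>ivm 0 1) + h * (2 * r\<^sup>2 * \<eta>)"
proof -
  have R: "R \<ge> 0" and r: "r \<ge> 0" using c rR by auto
  have D: "D \<ge> 0" using \<phi>(1)[of 0] \<phi>(2)[of 0] by simp
  \<comment> \<open>The remainder is governed by the oscillation \<eta> of \<phi>' over the distance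
    h r that a characteristic can travel, which is what a C^1 test function offers.\<close>
  have taylor: "\<bar>\<phi> (x + h * \<xi>) - \<phi> x - \<xi> * (h * \<phi>' x)\<bar> \<le> h * r * \<eta>" if "\<bar>\<xi>\<bar> \<le> r" for x \<xi>
  proof -
    have hx: "\<bar>h * \<xi>\<bar> \<le> h * r" using that h by (simp add: abs_mult mult_left_mono)
    have "norm (\<phi> (x + h * \<xi>) - \<phi> x - \<phi>' x * (x + h * \<xi> - x)) \<le> norm (x + h * \<xi> - x) * \<eta>"
    proof (rule differentiable_bound_linearization[where S="closed_segment x (x + h * \<xi>)" and f'="\<lambda>y d. \<phi>' y * d"])
      show "x + t *\<^sub>R (x + h * \<xi> - x) \<in> closed_segment x (x + h * \<xi>)" if "t \<in> {0..1}" for t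
        using that by (auto simp: closed_segment_def algebra_simps intro!: exI[of _ t])
      show "(\<phi> has_derivative (*) (\<phi>' y)) (at y within closed_segment x (x + h * \<xi>))" for y
        using deriv[of y] by (simp add: has_field_derivative_def has_derivative_at_withinI)
      show "onorm ((\<lambda>d. \<phi>' y * d) - (\<lambda>d. \<phi>' x * d)) \<le> \<eta>" if "y \<in> closed_segment x (x + h * \<xi>)" for y
        unfolding fun_diff_def
      proof (rule onorm_le)
        fix d
        have "\<bar>y - x\<bar> \<le> h * r" using that hx by (auto simp: closed_segment_eq_real_ivl split: if_splits)
        from modulus[OF this] show "norm (\<phi>' y * d - \<phi>' x * d) \<le> \<eta> * norm d"
          by (simp add: left_diff_distrib[symmetric] abs_mult mult_right_mono)
      qed
    qed simp
    also have "norm (x + h * \<xi> - x) * \<eta> \<le> h * r * \<eta>"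
      using hx modulus[of x x] h r by (auto intro!: mult_right_mono)
    finally show ?thesis by (simp add: algebra_simps)
  qed
  have \<eta>: "\<eta> \<ge> 0" using modulus[of 0 0] h r by simp
  have tb: "\<bar>tcoll R h w x\<bar> \<le> r" for x by (rule tcoll_bound[OF assms(1) b rR])
  have sb: "\<bar>scheme R h w x\<bar> \<le> (1 + h * FW_B) * r" for x by (rule scheme_bound[OF assms(1) b rR h])
  have cb: "\<bar>FW_conv w x\<bar> \<le> FW_B * r" for x by (rule FW_conv_bound[OF assms(1) b])
  have \<phi>b: "\<bar>a * \<phi> x\<bar> \<le> A * D" if "\<bar>a\<bar> \<le> A" for a A x
    using mult_mono[OF that \<phi>(2)[of x]] \<phi>(1)[of x] that by (simp add: abs_mult)
  have sgb: "\<bar>sgn a * FW_conv w x\<bar> \<le> FW_B * r" for a x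
    using cb[of x] by (auto simp: abs_mult sgn_real_def)
  have i1: "integrable (ivm 0 1) (\<lambda>x. \<bar>tcoll R h w x - c\<bar> * \<phi> x)"
    by (rule integrable_ivm[where C="2 * r * D"]) (measurable, rule \<phi>b, use tb c in \<open>smt (verit)\<close>)
  have i2: "integrable (ivm 0 1) (\<lambda>x. sgn (scheme R h w x - c) * FW_conv w x * \<phi> x)"
    by (rule integrable_ivm[where C="FW_B * r * D"]) (measurable, rule \<phi>b, rule sgb)
  have i3: "integrable (ivm 0 1) (\<lambda>x. \<bar>scheme R h w x - c\<bar> * \<phi> x)"
    by (rule integrable_ivm[where C="((1 + h * FW_B) * r + r) * D"]) (measurable, rule \<phi>b, use sb c in \<open>smt (verit)\<close>)
  have i4: "integrable (ivm 0 1) (\<lambda>x. \<bar>w x - c\<bar> * \<phi> x)"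
    by (rule integrable_ivm[where C="2 * r * D"]) (measurable, rule \<phi>b, use b c in \<open>smt (verit)\<close>)
  have i5: "integrable (ivm 0 1) (\<lambda>x. kflux (w x) c * \<phi>' x)"
    by (rule integrable_ivm[where C="2 * r\<^sup>2 * D"])
       (use kflux_bound[OF b c] \<phi>(3) in \<open>auto simp: abs_mult intro!: mult_mono\<close>)
  have "(\<integral>x. \<bar>scheme R h w x - c\<bar> * \<phi> x \<partial>ivm 0 1)
     \<le> (\<integral>x. \<bar>tcoll R h w x - c\<bar> * \<phi> x - h * (sgn (scheme R h w x - c) * FW_conv w x * \<phi> x) \<partial>ivm 0 1)"
  proof (rule integral_mono)
    fix x
    let ?b = "scheme R h w x - c"
    have "\<bar>tcoll R h w x - c\<bar> = \<bar>?b + h * FW_conv w x\<bar>" by (simp add: scheme_def)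
    \<comment> \<open>Convexity of the absolute value: its subgradient at the new state multiplies
      the increment h K' * w.\<close>
    moreover have "sgn ?b * (?b + h * FW_conv w x) \<le> \<bar>?b + h * FW_conv w x\<bar>"
      by (auto simp: sgn_real_def)
    moreover have "sgn ?b * (?b + h * FW_conv w x) = \<bar>?b\<bar> + h * (sgn ?b * FW_conv w x)"
      by (auto simp: sgn_real_def)
    ultimately have "\<bar>?b\<bar> \<le> \<bar>tcoll R h w x - c\<bar> - h * (sgn ?b * FW_conv w x)"
      by linarith
    from mult_right_mono[OF this \<phi>(1)[of x]]
    show "\<bar>?b\<bar> * \<phi> x \<le> \<bar>tcoll R h w x - c\<bar> * \<phi> x - h * (sgn ?b * FW_conv w x * \<phi> x)"
      by (simp add: algebra_simps)
  qed (use i1 i2 i3 in auto)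
  also have "\<dots> = (\<integral>x. \<bar>tcoll R h w x - c\<bar> * \<phi> x \<partial>ivm 0 1) - h * (\<integral>x. sgn (scheme R h w x - c) * FW_conv w x * \<phi> x \<partial>ivm 0 1)"
    using i1 i2 by simp
  also have "(\<integral>x. \<bar>tcoll R h w x - c\<bar> * \<phi> x \<partial>ivm 0 1)
     \<le> (\<integral>x. (\<integral>\<xi>. \<bar>of_bool (\<xi> < w x) - of_bool (\<xi> < c)\<bar> * \<phi> (x + h * \<xi>) \<partial>ivm (-R) R) \<partial>ivm 0 1)"
    using tcoll_L1[of w "\<lambda>_. c" \<phi> D R h] per \<phi> R order_trans[OF c rR] by (simp add: tcoll_const)
  also have "\<dots> \<le> (\<integral>x. \<bar>w x - c\<bar> * \<phi> x + h * (kflux (w x) c * \<phi>' x) + h * (2 * r\<^sup>2 * \<eta>) \<partial>ivm 0 1)"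
  proof (rule integral_mono)
    show "integrable (ivm 0 1) (\<lambda>x. \<integral>\<xi>. \<bar>of_bool (\<xi> < w x) - of_bool (\<xi> < c)\<bar> * \<phi> (x + h * \<xi>) \<partial>ivm (-R) R)"
    proof (rule integrable_ivm[where C="(R - - R) * D"])
      fix x
      show "\<bar>\<integral>\<xi>. \<bar>of_bool (\<xi> < w x) - of_bool (\<xi> < c)\<bar> * \<phi> (x + h * \<xi>) \<partial>ivm (-R) R\<bar> \<le> (R - - R) * D"
      proof (rule integral_ivm_bound)
        show "\<bar>\<bar>of_bool (\<xi> < w x) - of_bool (\<xi> < c)\<bar> * \<phi> (x + h * \<xi>)\<bar> \<le> D" for \<xi>
          using \<phi>b[of "\<bar>of_bool (\<xi> < w x) - of_bool (\<xi> < c)\<bar>" 1] by simp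
      qed (use R in auto)
    qed measurable
    show "integrable (ivm 0 1) (\<lambda>x. \<bar>w x - c\<bar> * \<phi> x + h * (kflux (w x) c * \<phi>' x) + h * (2 * r\<^sup>2 * \<eta>))"
      using i4 i5 by simp
    show "(\<integral>\<xi>. \<bar>of_bool (\<xi> < w x) - of_bool (\<xi> < c)\<bar> * \<phi> (x + h * \<xi>) \<partial>ivm (-R) R)
      \<le> \<bar>w x - c\<bar> * \<phi> x + h * (kflux (w x) c * \<phi>' x) + h * (2 * r\<^sup>2 * \<eta>)" for x
      using integral_between_le[OF b c rR, of "\<lambda>\<xi>. \<phi> (x + h * \<xi>)" "\<phi> x" "h * \<phi>' x" "h * r * \<eta>" x] taylor
      by (simp add: algebra_simps power2_eq_square)
  qed
  also have "\<dots> = (\<integral>x. \<bar>w x - c\<bar> * \<phi> x \<partial>ivm 0 1) + h * (\<integral>x. kflux (w x) c * \<phi>' x \<partial>ivm 0 1) + h * (2 * r\<^sup>2 * \<eta>)"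
    using i4 i5 integral_ivm_const[of 0 1 "h * (2 * r\<^sup>2 * \<eta>)"] by simp
  finally show ?thesis by simp
qed

lemma integral_ivm_split:
  fixes f :: "real \<Rightarrow> real"
  assumes [measurable]: "f \<in> borel_measurable borel" and b: "\<And>x. a \<le> x \<Longrightarrow> x \<le> c \<Longrightarrow> \<bar>f x\<bar> \<le> C" and "a \<le> b" "b \<le> c"
  shows "integral\<^sup>L (ivm a c) f = integral\<^sup>L (ivm a b) f + integral\<^sup>L (ivm b c) f"
proof -
  let ?i = "\<lambda>a b. \<lambda>x. indicat_real {a..b} x *\<^sub>R f x"
  have C: "\<bar>?i a c x\<bar> \<le> \<bar>C\<bar>" for x using b[of x] by (auto simp: indicator_def)
  have int: "integrable lborel (?i p q)" if "a \<le> p" "q \<le> c" for p q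
  proof (rule integrableI_bounded_set[where A="{p..q}" and B=C])
    show "AE x in lborel. x \<in> {p..q} \<longrightarrow> norm (?i p q x) \<le> C" using b that by auto
  qed (auto simp: emeasure_lborel_Icc_eq)
  have "integral\<^sup>L lborel (?i a c) = integral\<^sup>L lborel (\<lambda>x. ?i a b x + ?i b c x)"
  proof (rule integral_cong_AE)
    have "AE x in lborel. x \<noteq> b" by (rule AE_lborel_singleton)
    then show "AE x in lborel. ?i a c x = ?i a b x + ?i b c x"
      by eventually_elim (use assms in \<open>auto simp: indicator_def\<close>)
  qed measurable
  also have "\<dots> = integral\<^sup>L lborel (?i a b) + integral\<^sup>L lborel (?i b c)"
    using int[of a b] int[of b c] assms by (intro Bochner_Integration.integral_add) auto
  finally show ?thesis by (simp add: integral_ivm set_lebesgue_integral_def)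
qed

section \<open>The weak entropy functional and its behaviour over one step\<close>

text \<open>The integrand of the entropy inequality, with the partial derivatives of the test
  function as arguments in place of \<open>deriv\<close>, and with the source of u itself, which is
  legitimate because K' has mean zero.\<close>

definition ent_int :: "(real \<Rightarrow> real \<Rightarrow> real) \<Rightarrow> real \<Rightarrow> (real \<Rightarrow> real \<Rightarrow> real) \<Rightarrow> (real \<Rightarrow> real \<Rightarrow> real) \<Rightarrow> (real \<Rightarrow> real \<Rightarrow> real) \<Rightarrow> real \<Rightarrow> real \<Rightarrow> real" where
  "ent_int u c \<phi> \<phi>x \<phi>t x t = \<bar>u x t - c\<bar> * \<phi>t x t + kflux (u x t) c * \<phi>x x t
     - sgn (u x t - c) * FW_conv (\<lambda>y. u y t) x * \<phi> x t"

definition ent_fun :: "real \<Rightarrow> (real \<Rightarrow> real) \<Rightarrow> (real \<Rightarrow> real \<Rightarrow> real) \<Rightarrow> real \<Rightarrow> (real \<Rightarrow> real \<Rightarrow> real) \<Rightarrow> (real \<Rightarrow> real \<Rightarrow> real) \<Rightarrow> (real \<Rightarrow> real \<Rightarrow> real) \<Rightarrow> real" where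
  "ent_fun T u0 u c \<phi> \<phi>x \<phi>t =
     (\<integral>p. ent_int u c \<phi> \<phi>x \<phi>t (fst p) (snd p) \<partial>(ivm 0 1 \<Otimes>\<^sub>M ivm 0 T)) + (\<integral>x. \<bar>u0 x - c\<bar> * \<phi> x 0 \<partial>ivm 0 1)"

abbreviation measurable2 :: "(real \<Rightarrow> real \<Rightarrow> real) \<Rightarrow> bool" where
  "measurable2 f \<equiv> (\<lambda>p. f (fst p) (snd p)) \<in> borel_measurable (borel \<Otimes>\<^sub>M borel)"

lemma measurable2_compose:
  assumes "measurable2 f" "g \<in> borel_measurable M" "h \<in> borel_measurable M"
  shows "(\<lambda>x. f (g x) (h x)) \<in> borel_measurable M"
  using measurable_compose[of "\<lambda>x. (g x, h x)" M "borel \<Otimes>\<^sub>M borel" "\<lambda>p. f (fst p) (snd p)" borel] assms by simp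

text \<open>A quantitative test function: it carries its partial derivatives and one bound D for
  itself and for both of them, so that errors can be stated as explicit multiples of D.\<close>

definition test_data :: "real \<Rightarrow> (real \<Rightarrow> real \<Rightarrow> real) \<Rightarrow> (real \<Rightarrow> real \<Rightarrow> real) \<Rightarrow> (real \<Rightarrow> real \<Rightarrow> real) \<Rightarrow> bool" where
  "test_data D \<phi> \<phi>x \<phi>t \<longleftrightarrow>
     measurable2 \<phi> \<and> measurable2 \<phi>x \<and> measurable2 \<phi>t \<and>
     (\<forall>x t. 0 \<le> \<phi> x t \<and> \<phi> x t \<le> D \<and> \<bar>\<phi>x x t\<bar> \<le> D \<and> \<bar>\<phi>t x t\<bar> \<le> D) \<and>
     (\<forall>x t. \<phi> (x + 1) t = \<phi> x t) \<and>
     (\<forall>x t. ((\<lambda>x. \<phi> x t) has_real_derivative \<phi>x x t) (at x)) \<and>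
     (\<forall>x t. ((\<lambda>t. \<phi> x t) has_real_derivative \<phi>t x t) (at t)) \<and>
     (\<forall>x. continuous_on UNIV (\<phi>t x))"

lemma ent_int_measurable:
  assumes "measurable2 u" "test_data D \<phi> \<phi>x \<phi>t"
  shows "measurable2 (ent_int u c \<phi> \<phi>x \<phi>t)"
proof -
  have [measurable]: "measurable2 u" "measurable2 \<phi>" "measurable2 \<phi>x" "measurable2 \<phi>t" using assms by (auto simp: test_data_def)
  show ?thesis unfolding ent_int_def by measurable
qed

lemma ent_int_bound:
  assumes u: "measurable2 u" "\<And>x t. \<bar>u x t\<bar> \<le> R" "\<bar>c\<bar> \<le> R" and td: "test_data D \<phi> \<phi>x \<phi>t"
  shows "\<bar>ent_int u c \<phi> \<phi>x \<phi>t x t\<bar> \<le> (2 * R + 2 * R\<^sup>2 + FW_B * R) * D"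
proof -
  have um: "(\<lambda>y. u y t) \<in> borel_measurable borel" by (rule measurable2_compose[OF u(1)]) auto
  have td: "0 \<le> \<phi> x t" "\<phi> x t \<le> D" "\<bar>\<phi>x x t\<bar> \<le> D" "\<bar>\<phi>t x t\<bar> \<le> D" using td by (auto simp: test_data_def)
  have "\<bar>u x t - c\<bar> \<le> 2 * R" using u(2)[of x t] u(3) by linarith
  then have 1: "\<bar>\<bar>u x t - c\<bar> * \<phi>t x t\<bar> \<le> (2 * R) * D" unfolding abs_mult using td by (intro mult_mono) auto
  have 2: "\<bar>kflux (u x t) c * \<phi>x x t\<bar> \<le> (2 * R\<^sup>2) * D"
    unfolding abs_mult using kflux_bound[OF u(2)[of x t] u(3)] td by (intro mult_mono) auto
  have "\<bar>sgn (u x t - c) * FW_conv (\<lambda>y. u y t) x\<bar> \<le> FW_B * R"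
    using FW_conv_bound[OF um u(2), of x] by (auto simp: abs_mult sgn_real_def)
  then have 3: "\<bar>sgn (u x t - c) * FW_conv (\<lambda>y. u y t) x * \<phi> x t\<bar> \<le> (FW_B * R) * D"
    unfolding abs_mult[of _ "\<phi> x t"] using td by (intro mult_mono) auto
  show ?thesis unfolding ent_int_def using 1 2 3 by (simp add: algebra_simps)
qed

text \<open>On the step the approximation is the constant state v = \<open>scheme R h w\<close>, so
  the time derivative integrates exactly to the values of \<phi> at both ends, and
  \<open>scheme_entropy_step\<close> pays for the jump from w to v at t0. Freezing flux and source
  at the old state and time costs, per unit of time, 2 r D d + 2 r^2 \<eta> and B D d + B r D h,
  where B is \<open>FW_B\<close> and d bounds the L1 size of the step. With the 2 r^2 \<eta> of the
  jump this is the stated error.\<close>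

lemma scheme_weak_step:
  assumes w[measurable]: "w \<in> borel_measurable borel" and per: "\<And>x. w (x + 1) = w x"
    and b: "\<And>x. \<bar>w x\<bar> \<le> r" "\<And>x. \<bar>scheme R h w x\<bar> \<le> r" and c: "\<bar>c\<bar> \<le> r" and rR: "r \<le> R" and h: "h \<ge> 0"
    and td: "test_data D \<phi> \<phi>x \<phi>t"
    and modulus: "\<And>x y s t. \<bar>x - y\<bar> \<le> h * r \<Longrightarrow> \<bar>s - t\<bar> \<le> h \<Longrightarrow> \<bar>\<phi>x x s - \<phi>x y t\<bar> \<le> \<eta>"
    and d: "(\<integral>x. \<bar>scheme R h w x - w x\<bar> \<partial>ivm 0 1) \<le> d"
  shows "(\<integral>t. (\<integral>x. ent_int (\<lambda>x t. scheme R h w x) c \<phi> \<phi>x \<phi>t x t \<partial>ivm 0 1) \<partial>ivm t0 (t0 + h))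
    \<ge> (\<integral>x. \<bar>scheme R h w x - c\<bar> * \<phi> x (t0 + h) \<partial>ivm 0 1) - (\<integral>x. \<bar>w x - c\<bar> * \<phi> x t0 \<partial>ivm 0 1)
      - h * (4 * r\<^sup>2 * \<eta> + (2 * r + FW_B) * D * d + FW_B * r * D * h)"
proof -
  have r: "r \<ge> 0" using c by simp
  have D: "D \<ge> 0" and [measurable]: "measurable2 \<phi>" "measurable2 \<phi>x" "measurable2 \<phi>t"
    and \<phi>: "\<And>x t. 0 \<le> \<phi> x t" "\<And>x t. \<phi> x t \<le> D" "\<And>x t. \<bar>\<phi>x x t\<bar> \<le> D" "\<And>x t. \<bar>\<phi>t x t\<bar> \<le> D"
    and \<phi>per: "\<And>x t. \<phi> (x + 1) t = \<phi> x t"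
    and dx: "\<And>x t. ((\<lambda>x. \<phi> x t) has_real_derivative \<phi>x x t) (at x)"
    and dt: "\<And>x t. ((\<lambda>t. \<phi> x t) has_real_derivative \<phi>t x t) (at t)"
    and ct: "\<And>x. continuous_on UNIV (\<phi>t x)"
    using td order_trans[of 0 "\<phi> 0 0" D] unfolding test_data_def by auto
  have slice[measurable]: "(\<lambda>x. \<phi> x t) \<in> borel_measurable borel" "(\<lambda>x. \<phi>x x t) \<in> borel_measurable borel" "(\<lambda>x. \<phi>t x t) \<in> borel_measurable borel"
      "(\<lambda>t. \<phi>t x t) \<in> borel_measurable borel" for x t
    by (rule measurable2_compose; simp)+
  define v where "v = scheme R h w"
  have v[measurable]: "v \<in> borel_measurable borel" unfolding v_def by measurable
  have vb: "\<bar>v x\<bar> \<le> r" for x using b(2) by (simp add: v_def)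
  have \<eta>: "\<eta> \<ge> 0" using modulus[of 0 0 0 0] h r by simp
  have mb: "\<bar>a * b\<bar> \<le> A * B" if "\<bar>a\<bar> \<le> A" "\<bar>b\<bar> \<le> B" for a b A B :: real
    using that unfolding abs_mult by (intro mult_mono) auto
  have vc: "\<bar>\<bar>v x - c\<bar>\<bar> \<le> 2 * r" "\<bar>\<bar>w x - c\<bar>\<bar> \<le> 2 * r" for x using vb[of x] b(1)[of x] c by linarith+
  have \<phi>a: "\<bar>\<phi> x t\<bar> \<le> D" for x t using \<phi>[of x t] by simp
  have sg: "\<bar>sgn (v x - c) * FW_conv z x\<bar> \<le> FW_B * r" if "z \<in> borel_measurable borel" "\<And>x. \<bar>z x\<bar> \<le> r" for x z
    using FW_conv_bound[OF that, of x] by (auto simp: abs_mult sgn_real_def)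
  have kb: "\<bar>kflux (v x) c\<bar> \<le> 2 * r\<^sup>2" "\<bar>kflux (w x) c\<bar> \<le> 2 * r\<^sup>2" for x by (rule kflux_bound[OF vb c] kflux_bound[OF b(1) c])+
  have i: "integrable (ivm 0 1) (\<lambda>x. \<bar>v x - c\<bar> * \<phi>t x t)" "integrable (ivm 0 1) (\<lambda>x. \<bar>v x - c\<bar> * \<phi> x t)"
    "integrable (ivm 0 1) (\<lambda>x. kflux (v x) c * \<phi>x x t)" "integrable (ivm 0 1) (\<lambda>x. kflux (w x) c * \<phi>x x t)"
    "integrable (ivm 0 1) (\<lambda>x. sgn (v x - c) * FW_conv v x * \<phi> x t)"
    "integrable (ivm 0 1) (\<lambda>x. sgn (v x - c) * FW_conv w x * \<phi> x t)" for t
    by (rule integrable_ivm, measurable, rule mb, (rule vc kb sg[OF v vb] sg[OF w b(1)]), rule \<phi> \<phi>a)+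
  have ivw: "integrable (ivm 0 1) (\<lambda>x. \<bar>v x - w x\<bar>)"
    by (rule integrable_ivm[where C="2*r"]) (measurable, use vb b(1) in \<open>smt (verit)\<close>)
  define A where "A t = (\<integral>x. \<bar>v x - c\<bar> * \<phi>t x t \<partial>ivm 0 1)" for t
  define Fl where "Fl t = (\<integral>x. kflux (v x) c * \<phi>x x t \<partial>ivm 0 1)" for t
  define Sr where "Sr t = (\<integral>x. sgn (v x - c) * FW_conv v x * \<phi> x t \<partial>ivm 0 1)" for t
  define fl where "fl = (\<integral>x. kflux (w x) c * \<phi>x x t0 \<partial>ivm 0 1)"
  define sr where "sr = (\<integral>x. sgn (v x - c) * FW_conv w x * \<phi> x t0 \<partial>ivm 0 1)"
  note [measurable (raw)] = measurable2_compose[OF \<open>measurable2 \<phi>\<close>] measurable2_compose[OF \<open>measurable2 \<phi>x\<close>] measurable2_compose[OF \<open>measurable2 \<phi>t\<close>]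
  have [measurable]: "A \<in> borel_measurable borel" "Fl \<in> borel_measurable borel" "Sr \<in> borel_measurable borel"
    unfolding A_def Fl_def Sr_def by measurable
  have ei: "(\<integral>x. ent_int (\<lambda>x t. v x) c \<phi> \<phi>x \<phi>t x t \<partial>ivm 0 1) = A t + Fl t - Sr t" for t
    unfolding ent_int_def A_def Fl_def Sr_def using i by simp
  have Ab: "\<bar>A t\<bar> \<le> 2 * r * D" for t
    unfolding A_def using integral_ivm_bound[of "\<lambda>x. \<bar>v x - c\<bar> * \<phi>t x t" 0 1 "2 * r * D"] mb[OF vc(1) \<phi>(4)] by simp
  \<comment> \<open>State and time are changed one after the other: the Lipschitz bound of the flux
    pays for the state, the modulus \<eta> of \<phi>x for the time.\<close>
  have flux: "Fl t \<ge> fl - (2 * r * D * d + 2 * r\<^sup>2 * \<eta>)" if t: "t0 \<le> t" "t \<le> t0 + h" for t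
  proof -
    have "fl - Fl t = (\<integral>x. kflux (w x) c * \<phi>x x t0 - kflux (v x) c * \<phi>x x t \<partial>ivm 0 1)"
      unfolding Fl_def fl_def using i by simp
    also have "\<dots> \<le> (\<integral>x. 2 * r * D * \<bar>v x - w x\<bar> + 2 * r\<^sup>2 * \<eta> \<partial>ivm 0 1)"
    proof (rule integral_mono)
      fix x
      have "\<bar>(kflux (w x) c - kflux (v x) c) * \<phi>x x t0\<bar> \<le> (2 * r * \<bar>w x - v x\<bar>) * D"
        by (rule mb[OF kflux_lipschitz[OF b(1) vb c] \<phi>(3)])
      moreover have "\<bar>kflux (v x) c * (\<phi>x x t0 - \<phi>x x t)\<bar> \<le> 2 * r\<^sup>2 * \<eta>"
        by (rule mb[OF kb(1)]) (use t h r in \<open>auto intro!: modulus\<close>)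
      ultimately show "kflux (w x) c * \<phi>x x t0 - kflux (v x) c * \<phi>x x t \<le> 2 * r * D * \<bar>v x - w x\<bar> + 2 * r\<^sup>2 * \<eta>"
        by (simp add: algebra_simps abs_minus_commute)
    qed (use i ivw in auto)
    also have "\<dots> = 2 * r * D * (\<integral>x. \<bar>v x - w x\<bar> \<partial>ivm 0 1) + 2 * r\<^sup>2 * \<eta>"
      using ivw integral_ivm_const[of 0 1 "2 * r\<^sup>2 * \<eta>"] by simp
    also have "\<dots> \<le> 2 * r * D * d + 2 * r\<^sup>2 * \<eta>"
      using d r D unfolding v_def by (intro add_right_mono mult_left_mono) auto
    finally show ?thesis by simp
  qed
  \<comment> \<open>Both terms carry the sign at v, so only the convolution and \<phi> change and
    the discontinuity of sgn is never met.\<close>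
  have source: "Sr t \<le> sr + (FW_B * D * d + FW_B * r * D * h)" if t: "t0 \<le> t" "t \<le> t0 + h" for t
  proof -
    have "Sr t - sr = (\<integral>x. sgn (v x - c) * FW_conv v x * \<phi> x t - sgn (v x - c) * FW_conv w x * \<phi> x t0 \<partial>ivm 0 1)"
      unfolding Sr_def sr_def using i by simp
    also have "\<dots> \<le> (\<integral>x. FW_B * d * D + FW_B * r * (D * h) \<partial>ivm 0 1)"
    proof (rule integral_mono)
      fix x
      have "\<bar>FW_conv v x - FW_conv w x\<bar> \<le> FW_B * (\<integral>y. \<bar>v y - w y\<bar> \<partial>ivm 0 1)"
        by (rule FW_conv_diff_bound[OF v w vb b(1)])
      also have "\<dots> \<le> FW_B * d" using d FW_B_nonneg unfolding v_def by (intro mult_left_mono) auto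
      finally have "\<bar>sgn (v x - c) * (FW_conv v x - FW_conv w x)\<bar> \<le> FW_B * d"
        by (auto simp: abs_mult sgn_real_def)
      then have 1: "\<bar>sgn (v x - c) * (FW_conv v x - FW_conv w x) * \<phi> x t\<bar> \<le> FW_B * d * D"
        by (rule mb[OF _ \<phi>a])
      have "norm (\<phi> x t - \<phi> x t0) \<le> D * norm (t - t0)"
        by (rule field_differentiable_bound[of UNIV _ "\<phi>t x"]) (use dt \<phi> in auto)
      also have "\<dots> \<le> D * h" using t D by (intro mult_left_mono) auto
      finally have 2: "\<bar>sgn (v x - c) * FW_conv w x * (\<phi> x t - \<phi> x t0)\<bar> \<le> FW_B * r * (D * h)"
        by (intro mb[OF sg[OF w b(1)]]) simp
      show "sgn (v x - c) * FW_conv v x * \<phi> x t - sgn (v x - c) * FW_conv w x * \<phi> x t0 \<le> FW_B * d * D + FW_B * r * (D * h)"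
        using 1 2 by (simp add: algebra_simps)
    qed (use i in auto)
    also have "\<dots> = FW_B * d * D + FW_B * r * (D * h)"
      using integral_ivm_const[of 0 1 "FW_B * d * D + FW_B * r * (D * h)"] by simp
    finally show ?thesis by (simp add: algebra_simps)
  qed
  \<comment> \<open>The state is constant on the step, so after Fubini the fundamental theorem
    applies for each x.\<close>
  have time: "(\<integral>t. A t \<partial>ivm t0 (t0 + h)) = (\<integral>x. \<bar>v x - c\<bar> * \<phi> x (t0 + h) \<partial>ivm 0 1) - (\<integral>x. \<bar>v x - c\<bar> * \<phi> x t0 \<partial>ivm 0 1)"
  proof -
    have "(\<integral>t. A t \<partial>ivm t0 (t0 + h)) = (\<integral>x. (\<integral>t. \<bar>v x - c\<bar> * \<phi>t x t \<partial>ivm t0 (t0 + h)) \<partial>ivm 0 1)"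
      unfolding A_def by (rule Fubini_ivm[where C="2 * r * D"]) (measurable, rule mb[OF vc(1) \<phi>(4)])
    also have "\<dots> = (\<integral>x. \<bar>v x - c\<bar> * \<phi> x (t0 + h) - \<bar>v x - c\<bar> * \<phi> x t0 \<partial>ivm 0 1)"
    proof (rule Bochner_Integration.integral_cong)
      fix x
      have "(\<integral>t. \<phi>t x t \<partial>ivm t0 (t0 + h)) = (\<integral>t. \<phi>t x t * indicator {t0..t0+h} t \<partial>lborel)"
        by (subst integral_ivm) (auto simp: set_lebesgue_integral_def mult.commute)
      also have "\<dots> = \<phi> x (t0 + h) - \<phi> x t0"
        by (rule integral_FTC_Icc_real) (use h dt ct in \<open>auto simp: continuous_on_eq_continuous_at\<close>)
      finally show "(\<integral>t. \<bar>v x - c\<bar> * \<phi>t x t \<partial>ivm t0 (t0 + h)) = \<bar>v x - c\<bar> * \<phi> x (t0 + h) - \<bar>v x - c\<bar> * \<phi> x t0"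
        by (simp add: right_diff_distrib)
    qed simp
    finally show ?thesis using i by simp
  qed
  let ?K = "fl - (2 * r * D * d + 2 * r\<^sup>2 * \<eta>) - (sr + (FW_B * D * d + FW_B * r * D * h))"
  have iA: "integrable (ivm t0 (t0 + h)) A"
    by (rule integrable_ivm[where C="2 * r * D"]) (use Ab in auto)
  have Flb: "\<bar>Fl t\<bar> \<le> 2 * r\<^sup>2 * D" for t
    unfolding Fl_def using integral_ivm_bound[of "\<lambda>x. kflux (v x) c * \<phi>x x t" 0 1 "2 * r\<^sup>2 * D"] mb[OF kb(1) \<phi>(3)] by simp
  have Srb: "\<bar>Sr t\<bar> \<le> FW_B * r * D" for t
    unfolding Sr_def using integral_ivm_bound[of "\<lambda>x. sgn (v x - c) * FW_conv v x * \<phi> x t" 0 1 "FW_B * r * D"] mb[OF sg[OF v vb] \<phi>a] by simp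
  have iFS: "integrable (ivm t0 (t0 + h)) (\<lambda>t. Fl t - Sr t)"
    by (rule integrable_ivm[where C="2 * r\<^sup>2 * D + FW_B * r * D"]) (measurable, use Flb Srb in \<open>smt (verit)\<close>)
  have "(\<integral>t. Fl t - Sr t \<partial>ivm t0 (t0 + h)) \<ge> (\<integral>t. ?K \<partial>ivm t0 (t0 + h))"
    by (rule integral_mono_AE) (use iFS flux source in \<open>auto intro!: AE_ivmI diff_mono\<close>)
  moreover have "(\<integral>t. ?K \<partial>ivm t0 (t0 + h)) = h * ?K"
    by (subst integral_ivm_const) (use h in auto)
  ultimately have FS: "(\<integral>t. Fl t - Sr t \<partial>ivm t0 (t0 + h)) \<ge> h * ?K" by linarith
  have "(\<integral>x. \<bar>v x - c\<bar> * \<phi> x t0 \<partial>ivm 0 1)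
     \<le> (\<integral>x. \<bar>w x - c\<bar> * \<phi> x t0 \<partial>ivm 0 1) + h * fl - h * sr + h * (2 * r\<^sup>2 * \<eta>)"
    unfolding v_def fl_def sr_def
    by (rule scheme_entropy_step[OF w _ _ per _ b(1) c rR h, where D=D]) (use \<phi> \<phi>per dx modulus h in auto)
  moreover have "(\<integral>t. A t + (Fl t - Sr t) \<partial>ivm t0 (t0 + h)) = (\<integral>t. A t \<partial>ivm t0 (t0 + h)) + (\<integral>t. Fl t - Sr t \<partial>ivm t0 (t0 + h))"
    by (rule Bochner_Integration.integral_add[OF iA iFS])
  ultimately show ?thesis
    unfolding v_def[symmetric] ei using FS time by (simp add: algebra_simps)
qed

section \<open>Iterating the scheme from Lipschitz data\<close>

definition vseq :: "real \<Rightarrow> real \<Rightarrow> (real \<Rightarrow> real) \<Rightarrow> nat \<Rightarrow> real \<Rightarrow> real" where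
  "vseq R h v0 n = (scheme R h ^^ n) v0"

text \<open>The value at the end of each time step is used on the whole step, so that the
  signum in the discrete entropy inequality is evaluated at the same state as in \<open>ent_int\<close>.\<close>

definition vsol :: "real \<Rightarrow> real \<Rightarrow> (real \<Rightarrow> real) \<Rightarrow> real \<Rightarrow> real \<Rightarrow> real" where
  "vsol R h v0 x t = vseq R h v0 (Suc (nat \<lfloor>t / h\<rfloor>)) x"

lemma vseq_0: "vseq R h v0 0 = v0" and vseq_Suc: "vseq R h v0 (Suc n) = scheme R h (vseq R h v0 n)"
  by (simp_all add: vseq_def)

lemma integrable_abs_diff:
  fixes f g :: "real \<Rightarrow> real"
  assumes "f \<in> borel_measurable borel" "g \<in> borel_measurable borel" "\<And>x. \<bar>f x\<bar> \<le> R" "\<And>x. \<bar>g x\<bar> \<le> R"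
  shows "integrable (ivm a b) (\<lambda>x. \<bar>f x - g x\<bar>)"
proof (rule integrable_ivm[where C="2*R"])
  show "\<bar>\<bar>f x - g x\<bar>\<bar> \<le> 2 * R" for x using assms(3)[of x] assms(4)[of x] by linarith
qed (use assms in measurable)

lemma L1_triangle:
  fixes f g k :: "real \<Rightarrow> real"
  assumes "f \<in> borel_measurable borel" "g \<in> borel_measurable borel" "k \<in> borel_measurable borel"
    and "\<And>x. \<bar>f x\<bar> \<le> R" "\<And>x. \<bar>g x\<bar> \<le> R" "\<And>x. \<bar>k x\<bar> \<le> R"
  shows "(\<integral>x. \<bar>f x - g x\<bar> \<partial>ivm a b) \<le> (\<integral>x. \<bar>f x - k x\<bar> \<partial>ivm a b) + (\<integral>x. \<bar>k x - g x\<bar> \<partial>ivm a b)"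
proof -
  have i: "integrable (ivm a b) (\<lambda>x. \<bar>f x - k x\<bar>)" "integrable (ivm a b) (\<lambda>x. \<bar>k x - g x\<bar>)" "integrable (ivm a b) (\<lambda>x. \<bar>f x - g x\<bar>)"
    using assms by (auto intro: integrable_abs_diff)
  have "(\<integral>x. \<bar>f x - g x\<bar> \<partial>ivm a b) \<le> (\<integral>x. \<bar>f x - k x\<bar> + \<bar>k x - g x\<bar> \<partial>ivm a b)"
    by (rule integral_mono) (use i in auto)
  then show ?thesis using i by simp
qed

text \<open>Each step multiplies the bounds by at most 1 + h \<open>FW_B\<close>, and N + 1 steps
  occur because the value at the end of a step is used, even at t = T. Since (N + 1) h <= 2 T, the
  total growth is at most exp (2 \<open>FW_B\<close> T). The cutoff R has to dominate every
  iterate.\<close>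

locale lipschitz_scheme =
  fixes T M0 R L :: real and v0 :: "real \<Rightarrow> real" and N :: nat
  assumes T: "T > 0" and N: "N > 0" and v0_measurable: "v0 \<in> borel_measurable borel"
    and v0_periodic: "\<And>x. v0 (x + 1) = v0 x" and v0_bound: "\<And>x. \<bar>v0 x\<bar> \<le> M0"
    and v0_lipschitz: "\<And>x y. \<bar>v0 x - v0 y\<bar> \<le> L * \<bar>x - y\<bar>" and L: "L \<ge> 0"
    and R: "M0 * exp (2 * FW_B * T) \<le> R"
begin

definition h where "h = T / real N"

abbreviation V where "V \<equiv> vseq R h v0"

definition E where "E = exp (2 * FW_B * T)"

text \<open>A bound for the L1 speed: the first step moves the Lipschitz data pointwise by at most
  (L + \<open>FW_B\<close>) R h, and the later steps enlarge this by a factor of at most E.\<close>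

definition \<Lambda> where "\<Lambda> = E * (L * R + FW_B * R)"

lemma h: "h > 0" "real N * h = T" "h \<le> T"
  using T N by (auto simp: h_def field_simps)

lemma M0: "M0 \<ge> 0" using v0_bound[of 0] by simp

lemma E: "E \<ge> 1" using FW_B_nonneg T by (simp add: E_def)

lemma R': "M0 * E \<le> R" "M0 \<le> R" "R \<ge> 0"
proof -
  show "M0 * E \<le> R" using R by (simp add: E_def)
  moreover have "M0 * 1 \<le> M0 * E" using E M0 by (intro mult_left_mono) auto
  ultimately show "M0 \<le> R" by simp
  then show "R \<ge> 0" using M0 by simp
qed

lemma growth: "n \<le> Suc N \<Longrightarrow> (1 + h * FW_B) ^ n \<le> E"
proof -
  assume n: "n \<le> Suc N"
  have "(1 + h * FW_B) ^ n \<le> exp (h * FW_B) ^ n"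
    using h FW_B_nonneg by (intro power_mono) auto
  also have "\<dots> = exp (real n * (h * FW_B))" by (simp add: exp_of_nat_mult)
  also have "\<dots> \<le> E"
  proof -
    have "real n * h \<le> real (Suc N) * h" using n h by (intro mult_right_mono) auto
    also have "\<dots> \<le> 2 * T" using h by (simp add: algebra_simps)
    finally have "real n * h * FW_B \<le> 2 * T * FW_B" using FW_B_nonneg by (intro mult_right_mono)
    then show ?thesis by (simp add: E_def algebra_simps)
  qed
  finally show ?thesis .
qed

lemma V_measurable[measurable]: "V n \<in> borel_measurable borel"
  by (induction n) (simp_all add: vseq_0 vseq_Suc v0_measurable)

lemma V_periodic: "V n (x + 1) = V n x"
  by (induction n arbitrary: x) (simp_all add: vseq_0 vseq_Suc v0_periodic scheme_periodic)

text \<open>The induction carries the exact power: the next step needs the current bound below the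
  cutoff R, and \<open>growth\<close> supplies this from the power.\<close>

lemma V_bound_pow: "n \<le> Suc N \<Longrightarrow> \<bar>V n x\<bar> \<le> (1 + h * FW_B) ^ n * M0"
proof (induction n arbitrary: x)
  case 0 then show ?case by (simp add: vseq_0 v0_bound)
next
  case (Suc n)
  have "(1 + h * FW_B) ^ n * M0 \<le> E * M0" using growth[of n] Suc.prems M0 by (intro mult_right_mono) auto
  then have "(1 + h * FW_B) ^ n * M0 \<le> R" using R' by (simp add: mult.commute)
  from scheme_bound[OF V_measurable Suc.IH this, of h x] Suc.prems h show ?case
    by (simp add: vseq_Suc mult.assoc)
qed

lemma V_bound: "n \<le> Suc N \<Longrightarrow> \<bar>V n x\<bar> \<le> M0 * E"
  using V_bound_pow[of n x] mult_right_mono[OF growth[of n] M0] by (simp add: mult.commute)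

lemma V_boundR: "n \<le> Suc N \<Longrightarrow> \<bar>V n x\<bar> \<le> R"
  using V_bound[of n x] R' by linarith

text \<open>The scheme commutes with translations, so the translate of an iterate is the iterate of
  the translated data, and \<open>scheme_L1\<close> propagates their distance. Pointwise Lipschitz
  continuity enters for the data alone.\<close>

lemma V_shift: "n \<le> Suc N \<Longrightarrow> (\<integral>x. \<bar>V n (x + a) - V n x\<bar> \<partial>ivm 0 1) \<le> E * L * \<bar>a\<bar>"
proof -
  have "n \<le> Suc N \<Longrightarrow> (\<integral>x. \<bar>V n (x + a) - V n x\<bar> \<partial>ivm 0 1) \<le> (1 + h * FW_B) ^ n * (L * \<bar>a\<bar>)"
  proof (induction n)
    case 0
    have "\<bar>\<integral>x. \<bar>v0 (x + a) - v0 x\<bar> \<partial>ivm 0 1\<bar> \<le> (1 - 0) * (L * \<bar>a\<bar>)"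
      by (rule integral_ivm_bound) (use v0_measurable v0_lipschitz[of "x + a" x for x] in auto)
    then show ?case by (simp add: vseq_0)
  next
    case (Suc n)
    have sh: "V (Suc n) (x + a) = scheme R h (\<lambda>y. V n (y + a)) x" for x
      using scheme_shift[OF V_measurable V_bound[of n] V_periodic] Suc.prems by (simp add: vseq_Suc)
    have p: "V n (x + 1 + a) = V n (x + a)" for x using V_periodic[of n "x + a"] by (simp add: algebra_simps)
    have "(\<integral>x. \<bar>V (Suc n) (x + a) - V (Suc n) x\<bar> \<partial>ivm 0 1) \<le> (1 + h * FW_B) * (\<integral>x. \<bar>V n (x + a) - V n x\<bar> \<partial>ivm 0 1)"
      unfolding sh unfolding vseq_Suc
      by (rule scheme_L1) (use p V_periodic V_boundR Suc.prems h in auto)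
    also have "\<dots> \<le> (1 + h * FW_B) * ((1 + h * FW_B) ^ n * (L * \<bar>a\<bar>))"
      using Suc h FW_B_nonneg by (intro mult_left_mono) auto
    finally show ?case by (simp add: mult.assoc)
  qed
  moreover assume n: "n \<le> Suc N"
  moreover have "(1 + h * FW_B) ^ n * (L * \<bar>a\<bar>) \<le> E * (L * \<bar>a\<bar>)"
    using growth[OF n] L by (intro mult_right_mono) auto
  ultimately show ?thesis by (simp add: mult.assoc)
qed

text \<open>Two consecutive iterates are the images of the two preceding ones, hence only the first
  step is estimated directly; there the Lipschitz continuity of v0 is used.\<close>

lemma V_step: "n \<le> N \<Longrightarrow> (\<integral>x. \<bar>V (Suc n) x - V n x\<bar> \<partial>ivm 0 1) \<le> \<Lambda> * h"
proof -
  have "n \<le> N \<Longrightarrow> (\<integral>x. \<bar>V (Suc n) x - V n x\<bar> \<partial>ivm 0 1) \<le> (1 + h * FW_B) ^ n * ((L * R + FW_B * R) * h)"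
  proof (induction n)
    case 0
    have "\<bar>scheme R h v0 x - v0 x\<bar> \<le> (L * R + FW_B * R) * h" for x
    proof -
      have "\<bar>tcoll R h v0 x - v0 x\<bar> \<le> L * h * R"
        by (rule tcoll_lipschitz_dist[OF v0_measurable _ v0_lipschitz _ L]) (use V_boundR[of 0] h in \<open>auto simp: vseq_0\<close>)
      moreover have "\<bar>h * FW_conv v0 x\<bar> \<le> h * (FW_B * R)"
        using FW_conv_bound[OF v0_measurable, of R x] V_boundR[of 0] h by (auto simp: vseq_0 abs_mult)
      ultimately show ?thesis unfolding scheme_def by (simp add: algebra_simps)
    qed
    then have "\<bar>\<integral>x. \<bar>scheme R h v0 x - v0 x\<bar> \<partial>ivm 0 1\<bar> \<le> (1 - 0) * ((L * R + FW_B * R) * h)"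
      by (intro integral_ivm_bound) (use v0_measurable in auto)
    then show ?case by (simp add: vseq_0 vseq_Suc)
  next
    case (Suc n)
    have "(\<integral>x. \<bar>V (Suc (Suc n)) x - V (Suc n) x\<bar> \<partial>ivm 0 1) \<le> (1 + h * FW_B) * (\<integral>x. \<bar>V (Suc n) x - V n x\<bar> \<partial>ivm 0 1)"
      using scheme_L1[of "V (Suc n)" "V n" R h] V_periodic V_boundR[of n] V_boundR[of "Suc n"] Suc.prems h
      by (simp add: vseq_Suc[of R h v0 "Suc n"] vseq_Suc[of R h v0 n, symmetric])
    also have "\<dots> \<le> (1 + h * FW_B) * ((1 + h * FW_B) ^ n * ((L * R + FW_B * R) * h))"
      using Suc h FW_B_nonneg by (intro mult_left_mono) auto
    finally show ?case by (simp add: mult.assoc)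
  qed
  moreover assume n: "n \<le> N"
  moreover have "(1 + h * FW_B) ^ n * ((L * R + FW_B * R) * h) \<le> E * ((L * R + FW_B * R) * h)"
    using growth[of n] n L R' h FW_B_nonneg by (intro mult_right_mono) auto
  ultimately show ?thesis by (simp add: mult.assoc \<Lambda>_def)
qed

lemma \<Lambda>: "\<Lambda> \<ge> 0"
  using E L R' FW_B_nonneg by (simp add: \<Lambda>_def)

lemma V_time: "n \<le> m \<Longrightarrow> m \<le> Suc N \<Longrightarrow> (\<integral>x. \<bar>V m x - V n x\<bar> \<partial>ivm 0 1) \<le> \<Lambda> * h * real (m - n)"
proof (induction m rule: dec_induct)
  case base then show ?case by simp
next
  case (step m)
  then have b: "\<bar>V (Suc m) x\<bar> \<le> R" "\<bar>V m x\<bar> \<le> R" "\<bar>V n x\<bar> \<le> R" for x by (auto intro!: V_boundR)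
  have "(\<integral>x. \<bar>V (Suc m) x - V n x\<bar> \<partial>ivm 0 1) \<le> (\<integral>x. \<bar>V (Suc m) x - V m x\<bar> \<partial>ivm 0 1) + (\<integral>x. \<bar>V m x - V n x\<bar> \<partial>ivm 0 1)"
    by (rule L1_triangle[where R=R]) (use b in auto)
  also have "\<dots> \<le> \<Lambda> * h + \<Lambda> * h * real (m - n)"
    using step V_step[of m] by (intro add_mono) auto
  also have "\<dots> = \<Lambda> * h * real (Suc m - n)" using step by (simp add: Suc_diff_le algebra_simps)
  finally show ?case .
qed

text \<open>Cut off to 0 outside [0, T], where the iterates are not controlled, so that the bounds
  hold on the whole plane.\<close>

definition U where "U x t = (if 0 \<le> t \<and> t \<le> T then vsol R h v0 x t else 0)"

definition step_of where "step_of t = Suc (nat \<lfloor>t / h\<rfloor>)"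

text \<open>At t = T the index is N + 1, one beyond the N steps that partition [0, T]: a single
  time, but the bounds have to cover it.\<close>

lemma step_of: "0 \<le> t \<Longrightarrow> t \<le> T \<Longrightarrow> step_of t \<le> Suc N"
proof -
  assume t: "0 \<le> t" "t \<le> T"
  have "t / h \<le> real N" using t h by (simp add: field_simps)
  then have "\<lfloor>t / h\<rfloor> \<le> int N" by linarith
  then show ?thesis by (simp add: step_of_def)
qed

lemma U_eq: "0 \<le> t \<Longrightarrow> t \<le> T \<Longrightarrow> U x t = V (step_of t) x"
  by (simp add: U_def vsol_def step_of_def)

lemma U_step: "real n * h \<le> t \<Longrightarrow> t < real n * h + h \<Longrightarrow> n < N \<Longrightarrow> U x t = V (Suc n) x"
proof -
  assume t: "real n * h \<le> t" "t < real n * h + h" "n < N"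
  have "0 \<le> real n * h" using h by simp
  then have "0 \<le> t" using t by linarith
  have "real n \<le> t / h" "t / h < real n + 1" using t h by (auto simp: field_simps)
  then have "\<lfloor>t / h\<rfloor> = int n" by linarith
  moreover have "t \<le> T"
  proof -
    have "(real n + 1) * h \<le> real N * h" using t h by (intro mult_right_mono) auto
    then show ?thesis using t h by (simp add: algebra_simps)
  qed
  ultimately show ?thesis using \<open>0 \<le> t\<close> by (simp add: U_def vsol_def)
qed

lemma U_measurable: "measurable2 U"
proof -
  have "(\<lambda>p. V (step_of (snd p)) (fst p)) \<in> borel_measurable (borel \<Otimes>\<^sub>M borel)"
    by (rule measurable_compose_countable[where f="\<lambda>n p. V n (fst p)" and g="\<lambda>p. step_of (snd p)"])
       (measurable, unfold step_of_def, measurable)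
  then have "(\<lambda>p. if 0 \<le> snd p \<and> snd p \<le> T then V (step_of (snd p)) (fst p) else 0) \<in> borel_measurable (borel \<Otimes>\<^sub>M borel)"
    by measurable
  moreover have "(\<lambda>p. U (fst p) (snd p)) = (\<lambda>p. if 0 \<le> snd p \<and> snd p \<le> T then V (step_of (snd p)) (fst p) else 0)"
    by (auto simp: U_def vsol_def step_of_def)
  ultimately show ?thesis by simp
qed

lemma U_bound: "\<bar>U x t\<bar> \<le> M0 * E"
  using V_bound[OF step_of, of t x] U_eq[of t x] M0 E by (cases "0 \<le> t \<and> t \<le> T") (auto simp: U_def)

lemma U_periodic: "U (x + 1) t = U x t"
  by (simp add: U_def vsol_def V_periodic)

lemma step_of_diff:
  assumes "0 \<le> s" "s \<le> t" "t \<le> T"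
  shows "step_of s \<le> step_of t" "h * real (step_of t - step_of s) \<le> t - s + h"
proof -
  have m: "\<lfloor>s / h\<rfloor> \<le> \<lfloor>t / h\<rfloor>" using assms h by (intro floor_mono divide_right_mono) auto
  then show le: "step_of s \<le> step_of t" by (simp add: step_of_def nat_mono)
  have "0 \<le> \<lfloor>s / h\<rfloor>" using assms h by simp
  moreover from this m have "0 \<le> \<lfloor>t / h\<rfloor>" by (rule order_trans)
  ultimately have "real (step_of t - step_of s) = real_of_int \<lfloor>t / h\<rfloor> - real_of_int \<lfloor>s / h\<rfloor>"
    using m by (simp add: step_of_def of_nat_diff nat_mono)
  also have "\<dots> \<le> t / h - s / h + 1" by linarith
  finally have "h * real (step_of t - step_of s) \<le> h * (t / h - s / h + 1)" using h by (intro mult_left_mono) auto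
  then show "h * real (step_of t - step_of s) \<le> t - s + h" using h by (simp add: algebra_simps)
qed

text \<open>The steps containing s and t may be further apart than |t - s|, by at most h, whence the
  additional h; the translation is split off by the triangle inequality.\<close>

lemma U_modulus:
  assumes "0 \<le> s" "s \<le> T" "0 \<le> t" "t \<le> T"
  shows "(\<integral>x. \<bar>U x t - U (x - z) s\<bar> \<partial>ivm 0 1) \<le> \<Lambda> * (\<bar>t - s\<bar> + h) + E * L * \<bar>z\<bar>"
proof -
  let ?n = "step_of t" and ?m = "step_of s"
  have nm: "?n \<le> Suc N" "?m \<le> Suc N" using step_of assms by auto
  have "(\<integral>x. \<bar>U x t - U (x - z) s\<bar> \<partial>ivm 0 1) = (\<integral>x. \<bar>V ?n x - V ?m (x - z)\<bar> \<partial>ivm 0 1)"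
    using assms by (simp add: U_eq)
  also have "\<dots> \<le> (\<integral>x. \<bar>V ?n x - V ?m x\<bar> \<partial>ivm 0 1) + (\<integral>x. \<bar>V ?m x - V ?m (x - z)\<bar> \<partial>ivm 0 1)"
    by (rule L1_triangle[where R=R]) (use V_boundR nm in auto)
  also have "(\<integral>x. \<bar>V ?m x - V ?m (x - z)\<bar> \<partial>ivm 0 1) \<le> E * L * \<bar>z\<bar>"
    using V_shift[OF nm(2), of "-z"] by (simp add: abs_minus_commute)
  also have "(\<integral>x. \<bar>V ?n x - V ?m x\<bar> \<partial>ivm 0 1) \<le> \<Lambda> * (\<bar>t - s\<bar> + h)"
  proof (cases "s \<le> t")
    case True
    have "(\<integral>x. \<bar>V ?n x - V ?m x\<bar> \<partial>ivm 0 1) \<le> \<Lambda> * (h * real (?n - ?m))"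
      using V_time[OF step_of_diff(1)[OF _ True] nm(1)] assms by simp
    also have "\<dots> \<le> \<Lambda> * (t - s + h)"
      using step_of_diff(2)[OF _ True] assms \<Lambda> by (intro mult_left_mono) auto
    finally show ?thesis using True by simp
  next
    case False
    then have le: "t \<le> s" by simp
    have "(\<integral>x. \<bar>V ?m x - V ?n x\<bar> \<partial>ivm 0 1) \<le> \<Lambda> * (h * real (?m - ?n))"
      using V_time[OF step_of_diff(1)[OF _ le] nm(2)] assms by simp
    also have "\<dots> \<le> \<Lambda> * (s - t + h)"
      using step_of_diff(2)[OF _ le] assms \<Lambda> by (intro mult_left_mono) auto
    finally show ?thesis using le by (simp add: abs_minus_commute)
  qed
  finally show ?thesis by simp
qed

text \<open>At time 0 the function U already equals the first iterate and not v0; the step between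
  them accounts for the second h.\<close>

lemma U_initial:
  assumes "0 \<le> s" "s \<le> T"
  shows "(\<integral>x. \<bar>v0 x - U (x - z) s\<bar> \<partial>ivm 0 1) \<le> \<Lambda> * (s + 2 * h) + E * L * \<bar>z\<bar>"
proof -
  have [measurable]: "(\<lambda>x. U (x - z) s) \<in> borel_measurable borel" "(\<lambda>x. U x 0) \<in> borel_measurable borel" "v0 \<in> borel_measurable borel"
    by (rule measurable2_compose[OF U_measurable]; simp)+ (rule v0_measurable)
  have b: "\<bar>v0 x\<bar> \<le> R" "\<bar>U x t\<bar> \<le> R" for x t using U_bound[of x t] R' v0_bound[of x] by linarith+
  have "(\<integral>x. \<bar>v0 x - U (x - z) s\<bar> \<partial>ivm 0 1) \<le> (\<integral>x. \<bar>v0 x - U x 0\<bar> \<partial>ivm 0 1) + (\<integral>x. \<bar>U x 0 - U (x - z) s\<bar> \<partial>ivm 0 1)"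
    by (rule L1_triangle[where R=R]) (use b in auto)
  also have "(\<integral>x. \<bar>U x 0 - U (x - z) s\<bar> \<partial>ivm 0 1) \<le> \<Lambda> * (s + h) + E * L * \<bar>z\<bar>"
    using U_modulus[of s 0 z] assms T by simp
  also have "(\<integral>x. \<bar>v0 x - U x 0\<bar> \<partial>ivm 0 1) = (\<integral>x. \<bar>V (Suc 0) x - V 0 x\<bar> \<partial>ivm 0 1)"
    using T by (simp add: U_eq step_of_def vseq_0 abs_minus_commute)
  also have "\<dots> \<le> \<Lambda> * h" by (rule V_step) simp
  finally show ?thesis by (simp add: algebra_simps)
qed

text \<open>Summing \<open>scheme_weak_step\<close> over the N steps, the boundary values telescope
  to those at 0 and T, and N errors of h times a constant add up to T times that constant. The
  estimate is in terms of the state bound r, which may lie far below the cutoff R.\<close>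

lemma U_weak:
  assumes c: "\<bar>c\<bar> \<le> r" and r: "M0 * E \<le> r" "r \<le> R" and td: "test_data D \<phi> \<phi>x \<phi>t"
    and modulus: "\<And>x y s t. \<bar>x - y\<bar> \<le> h * r \<Longrightarrow> \<bar>s - t\<bar> \<le> h \<Longrightarrow> \<bar>\<phi>x x s - \<phi>x y t\<bar> \<le> \<eta>"
  shows "ent_fun T v0 U c \<phi> \<phi>x \<phi>t \<ge> - T * (4 * r\<^sup>2 * \<eta> + (2 * r + FW_B) * D * (\<Lambda> * h) + FW_B * r * D * h)"
proof -
  let ?e = "4 * r\<^sup>2 * \<eta> + (2 * r + FW_B) * D * (\<Lambda> * h) + FW_B * r * D * h"
  let ?g = "\<lambda>t. \<integral>x. ent_int U c \<phi> \<phi>x \<phi>t x t \<partial>ivm 0 1"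
  let ?a = "\<lambda>n t. \<integral>x. \<bar>V n x - c\<bar> * \<phi> x t \<partial>ivm 0 1"
  have bR: "\<bar>U x t\<bar> \<le> r" for x t using U_bound[of x t] r by linarith
  have Vr: "\<bar>V n x\<bar> \<le> r" if "n \<le> Suc N" for n x using V_bound[OF that, of x] r by linarith
  note eim = ent_int_measurable[OF U_measurable td, of c]
  note eib = ent_int_bound[OF U_measurable bR c td]
  define C where "C = (2 * r + 2 * r\<^sup>2 + FW_B * r) * D"
  have [measurable]: "?g \<in> borel_measurable borel"
  proof -
    note [measurable (raw)] = measurable2_compose[OF eim]
    show ?thesis by measurable
  qed
  have gb: "\<bar>?g t\<bar> \<le> C" for t
    using integral_ivm_bound[of "\<lambda>x. ent_int U c \<phi> \<phi>x \<phi>t x t" 0 1 C] eib measurable2_compose[OF eim, of "\<lambda>x. x" borel "\<lambda>_. t"] by (auto simp: C_def)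
  have step: "(\<integral>t. ?g t \<partial>ivm (real n * h) (real n * h + h)) \<ge> ?a (Suc n) (real n * h + h) - ?a n (real n * h) - h * ?e" if n: "n < N" for n
  proof -
    let ?I = "ivm (real n * h) (real n * h + h)"
    have "(\<integral>t. ?g t \<partial>?I) = (\<integral>t. (\<integral>x. ent_int (\<lambda>x t. V (Suc n) x) c \<phi> \<phi>x \<phi>t x t \<partial>ivm 0 1) \<partial>?I)"
    proof (rule integral_cong_AE)
      have "measurable2 (\<lambda>x t. V (Suc n) x)" by measurable
      note [measurable (raw)] = measurable2_compose[OF ent_int_measurable[OF this td, of c]]
      show "(\<lambda>t. \<integral>x. ent_int (\<lambda>x t. V (Suc n) x) c \<phi> \<phi>x \<phi>t x t \<partial>ivm 0 1) \<in> borel_measurable ?I" by measurable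
      \<comment> \<open>At the right end of the step U already has the next value; this is a null
        set of times.\<close>
      have "AE t in lborel. t \<noteq> real n * h + h" by (rule AE_lborel_singleton)
      then show "AE t in ?I. ?g t = (\<integral>x. ent_int (\<lambda>x t. V (Suc n) x) c \<phi> \<phi>x \<phi>t x t \<partial>ivm 0 1)"
        unfolding AE_ivm_iff
        by eventually_elim (use U_step[OF _ _ n] in \<open>auto simp: ent_int_def\<close>)
    qed measurable
    also have "\<dots> \<ge> ?a (Suc n) (real n * h + h) - ?a n (real n * h) - h * ?e"
      unfolding vseq_Suc
      by (rule scheme_weak_step[OF V_measurable V_periodic Vr _ c r(2) _ td modulus])
         (use n h Vr[of "Suc n"] V_step[of n] in \<open>auto simp: vseq_Suc\<close>)
    finally show ?thesis .
  qed
  have "k \<le> N \<Longrightarrow> (\<integral>t. ?g t \<partial>ivm 0 (real k * h)) \<ge> ?a k (real k * h) - ?a 0 0 - real k * h * ?e" for k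
  proof (induction k)
    case 0
    have "(\<integral>t. ?g t \<partial>ivm 0 0) = 0" using integral_ivm_bound[of ?g 0 0 C] gb by auto
    then show ?case by simp
  next
    case (Suc k)
    have "(\<integral>t. ?g t \<partial>ivm 0 (real (Suc k) * h)) = (\<integral>t. ?g t \<partial>ivm 0 (real k * h)) + (\<integral>t. ?g t \<partial>ivm (real k * h) (real (Suc k) * h))"
      by (rule integral_ivm_split[where C=C]) (use gb h in auto)
    moreover have "real (Suc k) * h = real k * h + h" by (simp add: algebra_simps)
    ultimately show ?case using Suc step[of k] by (simp add: algebra_simps)
  qed
  from this[of N] have "(\<integral>t. ?g t \<partial>ivm 0 T) \<ge> ?a N T - ?a 0 0 - T * ?e" using h by simp
  \<comment> \<open>Dropping the term at T by its sign matches the definition, which has no boundary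
    term at T and admits test functions that do not vanish there.\<close>
  moreover have "?a N T \<ge> 0" using td by (intro Bochner_Integration.integral_nonneg) (auto simp: test_data_def)
  moreover have "(\<integral>p. ent_int U c \<phi> \<phi>x \<phi>t (fst p) (snd p) \<partial>(ivm 0 1 \<Otimes>\<^sub>M ivm 0 T)) = (\<integral>t. ?g t \<partial>ivm 0 T)"
    using integral_pair_ivm_iterated(2)[OF eim eib] by simp
  ultimately show ?thesis by (simp add: ent_fun_def vseq_0)
qed

end

section \<open>Doubling of variables\<close>

abbreviation measurable4 :: "(real \<Rightarrow> real \<Rightarrow> real \<Rightarrow> real \<Rightarrow> real) \<Rightarrow> bool" where
  "measurable4 K \<equiv> (\<lambda>q. K (fst (fst q)) (snd (fst q)) (fst (snd q)) (snd (snd q)))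
     \<in> borel_measurable ((borel \<Otimes>\<^sub>M borel) \<Otimes>\<^sub>M (borel \<Otimes>\<^sub>M borel))"

lemma measurable4_compose:
  assumes "measurable4 K" "a \<in> borel_measurable M" "b \<in> borel_measurable M" "c \<in> borel_measurable M" "d \<in> borel_measurable M"
  shows "(\<lambda>x. K (a x) (b x) (c x) (d x)) \<in> borel_measurable M"
  using measurable_compose[of "\<lambda>x. ((a x, b x), (c x, d x))" M "(borel \<Otimes>\<^sub>M borel) \<Otimes>\<^sub>M (borel \<Otimes>\<^sub>M borel)"
    "\<lambda>q. K (fst (fst q)) (snd (fst q)) (fst (snd q)) (snd (snd q))" borel] assms by simp

lemma integral_ivm_bound1:
  fixes f :: "real \<Rightarrow> real"
  assumes "f \<in> borel_measurable borel" "\<And>x. \<bar>f x\<bar> \<le> C"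
  shows "\<bar>integral\<^sup>L (ivm 0 1) f\<bar> \<le> C"
  using integral_ivm_bound[of f 0 1 C] assms by simp

lemma measure_ivm: "a \<le> b \<Longrightarrow> measure (ivm a b) UNIV = b - a"
  using integral_ivm_const[of a b 1] by simp

lemma integrable_pair_pair_ivm:
  assumes K: "measurable4 K" and b: "\<And>x t y s. \<bar>K x t y s\<bar> \<le> C"
  shows "integrable ((ivm 0 1 \<Otimes>\<^sub>M ivm 0 T) \<Otimes>\<^sub>M (ivm 0 1 \<Otimes>\<^sub>M ivm 0 T)) (\<lambda>(p, q). K (fst p) (snd p) (fst q) (snd q))"
proof -
  note [measurable (raw)] = measurable4_compose[OF K]
  show ?thesis
    by (intro finite_measure.integrable_const_bound[where B=C])
       (auto simp: case_prod_beta' b intro!: finite_measure_pair_measure ivmp.finite_measure_axioms)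
qed

text \<open>The substitution y = x - z makes the integral in x innermost, at fixed times and fixed
  displacement z. Since the source is controlled only by an L1 distance in x, the doubled integrand
  can be estimated in this order but not pointwise in (x, y).\<close>

lemma doubling_variables:
  assumes K: "measurable4 K" and b: "\<And>x t y s. \<bar>K x t y s\<bar> \<le> C" and per: "\<And>x t y s. K x t (y + 1) s = K x t y s" and T: "0 \<le> T"
  shows "(\<integral>p. (\<integral>q. K (fst p) (snd p) (fst q) (snd q) \<partial>(ivm 0 1 \<Otimes>\<^sub>M ivm 0 T)) \<partial>(ivm 0 1 \<Otimes>\<^sub>M ivm 0 T))
    = (\<integral>t. (\<integral>s. (\<integral>z. (\<integral>x. K x t (x - z) s \<partial>ivm 0 1) \<partial>ivm 0 1) \<partial>ivm 0 T) \<partial>ivm 0 T)"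
proof -
  note [measurable (raw)] = measurable4_compose[OF K]
  have b1: "\<bar>\<integral>y. K x t y s \<partial>ivm 0 1\<bar> \<le> C" for x t s by (rule integral_ivm_bound1) (use b in auto)
  have b2: "\<bar>\<integral>s. (\<integral>y. K x t y s \<partial>ivm 0 1) \<partial>ivm 0 T\<bar> \<le> (T - 0) * C" for x t
    by (rule integral_ivm_bound) (use b1 T in auto)
  have "(\<integral>q. K (fst p) (snd p) (fst q) (snd q) \<partial>(ivm 0 1 \<Otimes>\<^sub>M ivm 0 T)) = (\<integral>s. (\<integral>y. K (fst p) (snd p) y s \<partial>ivm 0 1) \<partial>ivm 0 T)" for p
    using integral_pair_ivm_iterated(2)[of "\<lambda>q. K (fst p) (snd p) (fst q) (snd q)" 0 1 0 T C] b by simp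
  then have "(\<integral>p. (\<integral>q. K (fst p) (snd p) (fst q) (snd q) \<partial>(ivm 0 1 \<Otimes>\<^sub>M ivm 0 T)) \<partial>(ivm 0 1 \<Otimes>\<^sub>M ivm 0 T))
    = (\<integral>p. (\<integral>s. (\<integral>y. K (fst p) (snd p) y s \<partial>ivm 0 1) \<partial>ivm 0 T) \<partial>(ivm 0 1 \<Otimes>\<^sub>M ivm 0 T))" by simp
  also have "\<dots> = (\<integral>t. (\<integral>x. (\<integral>s. (\<integral>y. K x t y s \<partial>ivm 0 1) \<partial>ivm 0 T) \<partial>ivm 0 1) \<partial>ivm 0 T)"
    using integral_pair_ivm_iterated(2)[of "\<lambda>p. \<integral>s. (\<integral>y. K (fst p) (snd p) y s \<partial>ivm 0 1) \<partial>ivm 0 T" 0 1 0 T "(T - 0) * C"] b2 by simp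
  also have "\<dots> = (\<integral>t. (\<integral>s. (\<integral>x. (\<integral>y. K x t y s \<partial>ivm 0 1) \<partial>ivm 0 1) \<partial>ivm 0 T) \<partial>ivm 0 T)"
    by (intro Bochner_Integration.integral_cong refl Fubini_ivm[where C=C]) (use b1 in auto)
  also have "\<dots> = (\<integral>t. (\<integral>s. (\<integral>x. (\<integral>z. K x t (x - z) s \<partial>ivm 0 1) \<partial>ivm 0 1) \<partial>ivm 0 T) \<partial>ivm 0 T)"
    by (intro Bochner_Integration.integral_cong refl integral_ivm_reflect[symmetric, where C=C]) (use b per in auto)
  also have "\<dots> = (\<integral>t. (\<integral>s. (\<integral>z. (\<integral>x. K x t (x - z) s \<partial>ivm 0 1) \<partial>ivm 0 1) \<partial>ivm 0 T) \<partial>ivm 0 T)"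
    by (intro Bochner_Integration.integral_cong refl Fubini_ivm[where C=C]) (use b in auto)
  finally show ?thesis .
qed

text \<open>\<open>\<omega>\<close> is supported in \<open>(-\<epsilon>, 0)\<close>, so that the doubled test function
  \<open>\<rho> (x - y) * \<theta> t * \<omega> (t - s)\<close> charges the initial trace in one variable only; the decay
  of \<open>\<theta>\<close> absorbs the nonlocal source, which replaces Gronwall's lemma.\<close>

locale doubling_kernel =
  fixes T D \<epsilon> k :: real and \<rho> \<rho>' \<omega> \<omega>' \<theta> \<theta>' :: "real \<Rightarrow> real"
  assumes T: "T > 0" and meas: "\<rho> \<in> borel_measurable borel" "\<rho>' \<in> borel_measurable borel" "\<omega> \<in> borel_measurable borel"
      "\<omega>' \<in> borel_measurable borel" "\<theta> \<in> borel_measurable borel" "\<theta>' \<in> borel_measurable borel"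
    and nonneg: "\<And>z. 0 \<le> \<rho> z" "\<And>z. 0 \<le> \<omega> z" "\<And>z. 0 \<le> \<theta> z"
    and bound: "\<And>z. \<rho> z \<le> D" "\<And>z. \<bar>\<rho>' z\<bar> \<le> D" "\<And>z. \<omega> z \<le> D" "\<And>z. \<bar>\<omega>' z\<bar> \<le> D" "\<And>z. \<theta> z \<le> 1" "\<And>z. \<bar>\<theta>' z\<bar> \<le> D"
    and \<rho>_periodic: "\<And>z. \<rho> (z + 1) = \<rho> z" and \<rho>_integral: "(\<integral>z. \<rho> z \<partial>ivm 0 1) = 1"
    and \<omega>_support: "\<And>z. 0 \<le> z \<Longrightarrow> \<omega> z = 0"
    and \<omega>_integral_le: "\<And>t. (\<integral>s. \<omega> (t - s) \<partial>ivm 0 T) \<le> 1"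
    and \<omega>_integral: "\<And>t. 0 \<le> t \<Longrightarrow> t \<le> T - \<epsilon> \<Longrightarrow> (\<integral>s. \<omega> (t - s) \<partial>ivm 0 T) = 1"
    and \<theta>_decay: "\<And>t. 0 \<le> t \<Longrightarrow> t \<le> T \<Longrightarrow> \<theta>' t \<le> - (FW_B + 1) * \<theta> t"
    and k: "k > 0" "\<And>t. 0 \<le> t \<Longrightarrow> t \<le> T \<Longrightarrow> k \<le> \<theta> t" and \<epsilon>: "\<epsilon> > 0"
begin

declare meas[measurable]

text \<open>One kernel read in two ways: \<open>\<Phi>\<close> is a test function of (x, t) for u
  with parameters (y, s), and \<open>\<Psi>\<close> one of (y, s) for v with parameters (x, t). The
  weight \<theta> depends on t alone, so adding the two time derivatives cancels \<omega>' and
  leaves \<theta>'.\<close>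

definition \<Phi> where "\<Phi> y s x t = \<rho> (x - y) * \<theta> t * \<omega> (t - s)"
definition \<Phi>x where "\<Phi>x y s x t = \<rho>' (x - y) * \<theta> t * \<omega> (t - s)"
definition \<Phi>t where "\<Phi>t y s x t = \<rho> (x - y) * (\<theta>' t * \<omega> (t - s) + \<theta> t * \<omega>' (t - s))"
definition \<Psi> where "\<Psi> x t y s = \<rho> (x - y) * \<theta> t * \<omega> (t - s)"
definition \<Psi>x where "\<Psi>x x t y s = - (\<rho>' (x - y) * \<theta> t * \<omega> (t - s))"
definition \<Psi>t where "\<Psi>t x t y s = - (\<rho> (x - y) * \<theta> t * \<omega>' (t - s))"

lemma D: "D \<ge> 0" using nonneg(1)[of 0] bound(1)[of 0] by simp

text \<open>Kruzhkov's doubling, in which u is never compared with itself at neighbouring points. In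
  the bound, one \<delta> comes from the initial term and T \<delta> from replacing v at (x - z, s)
  by v at (x, t); 2 e T are the two entropy defects integrated over the parameters; division by k
  undoes the weight; and 2 R \<epsilon> covers the times after T - \<epsilon>, where part of
  \<omega> falls outside [0, T].\<close>

lemma doubling_contraction:
  assumes u: "measurable2 u" "\<And>x t. \<bar>u x t\<bar> \<le> R" and v: "measurable2 v" "\<And>x t. \<bar>v x t\<bar> \<le> R" "\<And>x t. v (x + 1) t = v x t"
    and u0: "u0 \<in> borel_measurable borel" "\<And>x. \<bar>u0 x\<bar> \<le> R" and v0: "v0 \<in> borel_measurable borel" "\<And>x. \<bar>v0 x\<bar> \<le> R"
    and ent_u: "\<And>y s. 0 \<le> s \<Longrightarrow> s \<le> T \<Longrightarrow> - e \<le> ent_fun T u0 u (v y s) (\<Phi> y s) (\<Phi>x y s) (\<Phi>t y s)"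
    and ent_v: "\<And>x t. 0 \<le> t \<Longrightarrow> t \<le> T \<Longrightarrow> - e \<le> ent_fun T v0 v (u x t) (\<Psi> x t) (\<Psi>x x t) (\<Psi>t x t)"
    and modulus: "\<And>t s z. 0 \<le> t \<Longrightarrow> t \<le> T \<Longrightarrow> 0 \<le> s \<Longrightarrow> s \<le> T \<Longrightarrow> 0 \<le> z \<Longrightarrow> z \<le> 1 \<Longrightarrow> \<omega> (t - s) \<noteq> 0 \<Longrightarrow> \<rho> z \<noteq> 0 \<Longrightarrow>
        (\<integral>x. \<bar>v x t - v (x - z) s\<bar> \<partial>ivm 0 1) \<le> \<delta>"
    and initial: "\<And>s z. 0 \<le> s \<Longrightarrow> s \<le> T \<Longrightarrow> 0 \<le> z \<Longrightarrow> z \<le> 1 \<Longrightarrow> \<omega> (- s) \<noteq> 0 \<Longrightarrow> \<rho> z \<noteq> 0 \<Longrightarrow>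
        (\<integral>x. \<bar>v0 x - v (x - z) s\<bar> \<partial>ivm 0 1) \<le> \<delta>"
    and \<delta>: "\<delta> \<ge> 0"
  shows "(\<integral>t. (\<integral>x. \<bar>u x t - v x t\<bar> \<partial>ivm 0 1) \<partial>ivm 0 T)
    \<le> ((\<integral>x. \<bar>u0 x - v0 x\<bar> \<partial>ivm 0 1) + (1 + T) * \<delta> + 2 * e * T) / k + 2 * R * \<epsilon>"
proof -
  let ?Q = "ivm 0 1 \<Otimes>\<^sub>M ivm 0 T"
  note [measurable (raw)] = measurable2_compose[OF u(1)] measurable2_compose[OF v(1)]
    measurable2_compose[OF FW_conv_measurable2[OF u(1)], simplified] measurable2_compose[OF FW_conv_measurable2[OF v(1)], simplified]
  have [measurable]: "u0 \<in> borel_measurable borel" "v0 \<in> borel_measurable borel" by fact+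
  have us[measurable]: "(\<lambda>x. u x t) \<in> borel_measurable borel" "(\<lambda>x. v x t) \<in> borel_measurable borel" for t by measurable
  have R: "R \<ge> 0" using u(2)[of 0 0] by simp
  define cu where "cu x t = FW_conv (\<lambda>y. u y t) x" for x t
  define cv where "cv x t = FW_conv (\<lambda>y. v y t) x" for x t
  have [measurable (raw)]: "(\<lambda>x. cu (f x) (g x)) \<in> borel_measurable M" "(\<lambda>x. cv (f x) (g x)) \<in> borel_measurable M"
    if "f \<in> borel_measurable M" "g \<in> borel_measurable M" for f g and M :: "'c measure"
    unfolding cu_def cv_def
    using measurable2_compose[of "\<lambda>x t. FW_conv (\<lambda>y. u y t) x", OF FW_conv_measurable2[OF u(1)] that]
      measurable2_compose[of "\<lambda>x t. FW_conv (\<lambda>y. v y t) x", OF FW_conv_measurable2[OF v(1)] that] by auto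
  define w where "w x t y s = \<rho> (x - y) * \<theta> t * \<omega> (t - s)" for x t y s
  define H where "H x t y s = w x t y s * ((FW_B + 1) * \<bar>u x t - v y s\<bar> - \<bar>cu x t - cv y s\<bar>)" for x t y s
  define G1 where "G1 x t y s = ent_int u (v y s) (\<Phi> y s) (\<Phi>x y s) (\<Phi>t y s) x t" for x t y s
  define G2 where "G2 x t y s = ent_int v (u x t) (\<Psi> x t) (\<Psi>x x t) (\<Psi>t x t) y s" for x t y s
  have G1_eq: "G1 x t y s = \<bar>u x t - v y s\<bar> * (\<rho> (x - y) * (\<theta>' t * \<omega> (t - s) + \<theta> t * \<omega>' (t - s)))
      + kflux (u x t) (v y s) * (\<rho>' (x - y) * \<theta> t * \<omega> (t - s)) - sgn (u x t - v y s) * cu x t * w x t y s" for x t y s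
    by (simp add: G1_def ent_int_def \<Phi>_def \<Phi>x_def \<Phi>t_def cu_def w_def)
  have G2_eq: "G2 x t y s = \<bar>v y s - u x t\<bar> * (- (\<rho> (x - y) * \<theta> t * \<omega>' (t - s)))
      + kflux (v y s) (u x t) * (- (\<rho>' (x - y) * \<theta> t * \<omega> (t - s))) - sgn (v y s - u x t) * cv y s * w x t y s" for x t y s
    by (simp add: G2_def ent_int_def \<Psi>_def \<Psi>x_def \<Psi>t_def cv_def w_def)
  have mb: "\<bar>a * b\<bar> \<le> A * B" if "\<bar>a\<bar> \<le> A" "\<bar>b\<bar> \<le> B" for a b A B :: real
    using that unfolding abs_mult by (intro mult_mono) auto
  have ab: "\<bar>\<rho> z\<bar> \<le> D" "\<bar>\<omega> z\<bar> \<le> D" "\<bar>\<theta> z\<bar> \<le> 1" for z using nonneg[of z] bound[of z] by auto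
  have wb: "\<bar>w x t y s\<bar> \<le> D * 1 * D" for x t y s
    unfolding w_def by (intro mb ab)
  have uv: "\<bar>\<bar>u x t - v y s\<bar>\<bar> \<le> 2 * R" "\<bar>\<bar>v y s - u x t\<bar>\<bar> \<le> 2 * R" for x t y s using u(2)[of x t] v(2)[of y s] by linarith+
  have cb: "\<bar>cu x t\<bar> \<le> FW_B * R" "\<bar>cv x t\<bar> \<le> FW_B * R" for x t
    unfolding cu_def cv_def by (rule FW_conv_bound[OF us(1)], rule u(2)) (rule FW_conv_bound[OF us(2)], rule v(2))
  have sb: "\<bar>sgn a\<bar> \<le> 1" for a :: real by (simp add: sgn_real_def)
  define C where "C = (2 * R) * (D * (D * D + 1 * D)) + (2 * R\<^sup>2) * (D * 1 * D) + 1 * (FW_B * R) * (D * 1 * D) + (2 * R) * (D * 1 * D)"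
  have Cb: "\<bar>G1 x t y s\<bar> \<le> C" "\<bar>G2 x t y s\<bar> \<le> C" for x t y s
  proof -
    have "\<bar>\<theta>' t * \<omega> (t - s) + \<theta> t * \<omega>' (t - s)\<bar> \<le> D * D + 1 * D"
      by (rule order_trans[OF abs_triangle_ineq]) (intro add_mono mb ab bound)
    then have 1: "\<bar>\<bar>u x t - v y s\<bar> * (\<rho> (x - y) * (\<theta>' t * \<omega> (t - s) + \<theta> t * \<omega>' (t - s)))\<bar> \<le> (2 * R) * (D * (D * D + 1 * D))"
      by (intro mb uv ab)
    have 2: "\<bar>kflux (u x t) (v y s) * (\<rho>' (x - y) * \<theta> t * \<omega> (t - s))\<bar> \<le> (2 * R\<^sup>2) * (D * 1 * D)"
      "\<bar>kflux (v y s) (u x t) * (- (\<rho>' (x - y) * \<theta> t * \<omega> (t - s)))\<bar> \<le> (2 * R\<^sup>2) * (D * 1 * D)"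
      unfolding mult_minus_right abs_minus_cancel by (intro mb ab bound kflux_bound u v)+
    have 3: "\<bar>sgn (u x t - v y s) * cu x t * w x t y s\<bar> \<le> 1 * (FW_B * R) * (D * 1 * D)"
      "\<bar>sgn (v y s - u x t) * cv y s * w x t y s\<bar> \<le> 1 * (FW_B * R) * (D * 1 * D)" by (intro mb sb cb wb)+
    have 4: "\<bar>\<bar>v y s - u x t\<bar> * (- (\<rho> (x - y) * \<theta> t * \<omega>' (t - s)))\<bar> \<le> (2 * R) * (D * 1 * D)"
      unfolding mult_minus_right abs_minus_cancel by (intro mb uv ab bound)
    have nn: "0 \<le> (2 * R) * (D * (D * D + 1 * D))" "0 \<le> (2 * R) * (D * 1 * D)" using R D by auto
    show "\<bar>G1 x t y s\<bar> \<le> C" unfolding G1_eq C_def using 1 2 3 nn by linarith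
    show "\<bar>G2 x t y s\<bar> \<le> C" unfolding G2_eq C_def using 4 2 3 nn by linarith
  qed
  have m4[measurable]: "measurable4 G1" "measurable4 G2" "measurable4 H" "measurable4 w"
    unfolding G1_eq G2_eq H_def w_def by measurable
  note [measurable (raw)] = measurable4_compose[OF m4(1)] measurable4_compose[OF m4(2)] measurable4_compose[OF m4(3)] measurable4_compose[OF m4(4)]
  have Hb: "\<bar>H x t y s\<bar> \<le> (D * 1 * D) * ((FW_B + 1) * (2 * R) + 2 * (FW_B * R))" for x t y s
  proof -
    have "\<bar>(FW_B + 1) * \<bar>u x t - v y s\<bar>\<bar> \<le> (FW_B + 1) * (2 * R)" using FW_B_nonneg by (intro mb uv) auto
    moreover have "\<bar>cu x t - cv y s\<bar> \<le> 2 * (FW_B * R)" using cb(1)[of x t] cb(2)[of y s] by linarith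
    ultimately show ?thesis unfolding H_def by (intro mb wb) linarith
  qed
  \<comment> \<open>The fluxes cancel because \<open>kflux\<close> is symmetric and
    \<open>\<Phi>x\<close> and \<open>\<Psi>x\<close> are opposite; the \<omega>' terms cancel as
    well. The decay of \<theta> contributes (\<open>FW_B\<close> + 1) |u - v|, to be set against the
    difference of the sources; the sign of the resulting \<open>H\<close> is not determined
    pointwise.\<close>
  have pointwise: "G1 x t y s + G2 x t y s \<le> - H x t y s" if t: "0 \<le> t" "t \<le> T" for x t y s
  proof -
    have "G1 x t y s + G2 x t y s = \<bar>u x t - v y s\<bar> * (\<rho> (x - y) * \<omega> (t - s)) * \<theta>' t - sgn (u x t - v y s) * (cu x t - cv y s) * w x t y s"
      unfolding G1_eq G2_eq kflux_commute[of "v y s"] abs_minus_commute[of "v y s"] sgn_minus[of "u x t - v y s", simplified]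
      by (simp add: algebra_simps)
    moreover have "\<bar>u x t - v y s\<bar> * (\<rho> (x - y) * \<omega> (t - s)) * \<theta>' t \<le> \<bar>u x t - v y s\<bar> * (\<rho> (x - y) * \<omega> (t - s)) * (- (FW_B + 1) * \<theta> t)"
      using \<theta>_decay[OF t] nonneg by (intro mult_left_mono) auto
    moreover have "- (sgn (u x t - v y s) * (cu x t - cv y s)) * w x t y s \<le> \<bar>cu x t - cv y s\<bar> * w x t y s"
    proof (rule mult_right_mono)
      show "- (sgn (u x t - v y s) * (cu x t - cv y s)) \<le> \<bar>cu x t - cv y s\<bar>" by (auto simp: sgn_real_def)
    qed (use nonneg in \<open>auto simp: w_def\<close>)
    ultimately show ?thesis unfolding H_def w_def by (simp add: algebra_simps)
  qed
  define Bu where "Bu y s = (\<integral>x. \<bar>u0 x - v y s\<bar> * \<Phi> y s x 0 \<partial>ivm 0 1)" for y s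
  have [measurable (raw)]: "(\<lambda>x. Bu (f x) (g x)) \<in> borel_measurable M" if [measurable]: "f \<in> borel_measurable M" "g \<in> borel_measurable M" for f g and M :: "'c measure"
    unfolding Bu_def \<Phi>_def by measurable
  have u0v: "\<bar>\<bar>u0 x - v y s\<bar>\<bar> \<le> 2 * R" for x y s using u0(2)[of x] v(2)[of y s] by linarith
  have Bub: "\<bar>Bu y s\<bar> \<le> 2 * R * (D * 1 * D)" for y s
    unfolding Bu_def \<Phi>_def by (rule integral_ivm_bound1) (measurable, intro mb ab u0v)
  have intT: "(\<integral>p. c \<partial>?Q) = T * c" for c :: real
    using integral_pair_ivm_iterated(2)[of "\<lambda>_. c" 0 1 0 T "\<bar>c\<bar>"] T by (auto simp: measure_ivm)
  have "- (e * T) \<le> (\<integral>q. (\<integral>p. G1 (fst p) (snd p) (fst q) (snd q) \<partial>?Q) + Bu (fst q) (snd q) \<partial>?Q)"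
  proof -
    have "(\<integral>q. - e \<partial>?Q) \<le> (\<integral>q. (\<integral>p. G1 (fst p) (snd p) (fst q) (snd q) \<partial>?Q) + Bu (fst q) (snd q) \<partial>?Q)"
    proof (rule integral_mono_AE)
      show "integrable ?Q (\<lambda>q. (\<integral>p. G1 (fst p) (snd p) (fst q) (snd q) \<partial>?Q) + Bu (fst q) (snd q))"
      proof (intro Bochner_Integration.integrable_add)
        show "integrable ?Q (\<lambda>q. \<integral>p. G1 (fst p) (snd p) (fst q) (snd q) \<partial>?Q)"
          by (rule ivm4.integrable_snd[OF integrable_pair_pair_ivm[OF m4(1) Cb(1)]])
        show "integrable ?Q (\<lambda>q. Bu (fst q) (snd q))" by (rule integrable_pair_ivm) (use Bub in auto)
      qed
      show "AE q in ?Q. - e \<le> (\<integral>p. G1 (fst p) (snd p) (fst q) (snd q) \<partial>?Q) + Bu (fst q) (snd q)"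
        using ent_u by (intro AE_pair_ivmI) (auto simp: ent_fun_def G1_def Bu_def)
    qed auto
    then show ?thesis unfolding intT by (simp add: mult.commute)
  qed
  moreover have "(\<integral>q. (\<integral>p. G1 (fst p) (snd p) (fst q) (snd q) \<partial>?Q) + Bu (fst q) (snd q) \<partial>?Q)
     = (\<integral>q. (\<integral>p. G1 (fst p) (snd p) (fst q) (snd q) \<partial>?Q) \<partial>?Q) + (\<integral>q. Bu (fst q) (snd q) \<partial>?Q)"
    by (intro Bochner_Integration.integral_add ivm4.integrable_snd[OF integrable_pair_pair_ivm[OF m4(1) Cb(1)]] integrable_pair_ivm[where C="2 * R * (D * 1 * D)"])
       (use Bub in auto)
  \<comment> \<open>The first inequality holds for each (y, s), the second for each (x, t); Fubini
    brings them to a common order.\<close>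
  moreover have "(\<integral>q. (\<integral>p. G1 (fst p) (snd p) (fst q) (snd q) \<partial>?Q) \<partial>?Q) = (\<integral>p. (\<integral>q. G1 (fst p) (snd p) (fst q) (snd q) \<partial>?Q) \<partial>?Q)"
    by (rule ivm4.Fubini_integral[OF integrable_pair_pair_ivm[OF m4(1) Cb(1)]])
  ultimately have ineq1: "- (e * T) \<le> (\<integral>p. (\<integral>q. G1 (fst p) (snd p) (fst q) (snd q) \<partial>?Q) \<partial>?Q) + (\<integral>q. Bu (fst q) (snd q) \<partial>?Q)"
    by linarith
  have iG: "integrable ?Q (\<lambda>p. \<integral>q. K (fst p) (snd p) (fst q) (snd q) \<partial>?Q)" if "measurable4 K" "\<And>x t y s. \<bar>K x t y s\<bar> \<le> B" for K B
    using ivm4.integrable_fst'[OF integrable_pair_pair_ivm[OF that]] by simp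
  have iGq: "integrable ?Q (\<lambda>q. K (fst p) (snd p) (fst q) (snd q))" if K: "measurable4 K" "\<And>x t y s. \<bar>K x t y s\<bar> \<le> B" for K B p
  proof -
    note [measurable (raw)] = measurable4_compose[OF K(1)]
    show ?thesis by (rule integrable_pair_ivm[where C=B]) (use K in auto)
  qed
  have ineq2: "- (e * T) \<le> (\<integral>p. (\<integral>q. G2 (fst p) (snd p) (fst q) (snd q) \<partial>?Q) \<partial>?Q)"
  proof -
    have "(\<integral>p. - e \<partial>?Q) \<le> (\<integral>p. (\<integral>q. G2 (fst p) (snd p) (fst q) (snd q) \<partial>?Q) \<partial>?Q)"
    proof (rule integral_mono_AE)
      show "integrable ?Q (\<lambda>p. \<integral>q. G2 (fst p) (snd p) (fst q) (snd q) \<partial>?Q)" by (rule iG[OF m4(2) Cb(2)])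
      show "AE p in ?Q. - e \<le> (\<integral>q. G2 (fst p) (snd p) (fst q) (snd q) \<partial>?Q)"
      proof (rule AE_pair_ivmI)
        fix x t assume "0 \<le> t" "t \<le> T"
        \<comment> \<open>The initial term of v carries \<omega> t, which is 0 for t >= 0: here
          one-sidedness removes it.\<close>
        from ent_v[OF this, of x] \<omega>_support[OF this(1)]
        show "- e \<le> (\<integral>q. G2 (fst (x, t)) (snd (x, t)) (fst q) (snd q) \<partial>?Q)"
          by (simp add: ent_fun_def G2_def \<Psi>_def)
      qed
    qed auto
    then show ?thesis unfolding intT by (simp add: mult.commute)
  qed
  have "(\<integral>p. (\<integral>q. G1 (fst p) (snd p) (fst q) (snd q) \<partial>?Q) + (\<integral>q. G2 (fst p) (snd p) (fst q) (snd q) \<partial>?Q) \<partial>?Q)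
      \<le> (\<integral>p. - (\<integral>q. H (fst p) (snd p) (fst q) (snd q) \<partial>?Q) \<partial>?Q)"
  proof (rule integral_mono_AE)
    show "AE p in ?Q. (\<integral>q. G1 (fst p) (snd p) (fst q) (snd q) \<partial>?Q) + (\<integral>q. G2 (fst p) (snd p) (fst q) (snd q) \<partial>?Q)
      \<le> - (\<integral>q. H (fst p) (snd p) (fst q) (snd q) \<partial>?Q)"
    proof (rule AE_pair_ivmI)
      fix x t assume t: "0 \<le> t" "t \<le> T"
      note i = iGq[OF m4(1) Cb(1), of "(x, t)"] iGq[OF m4(2) Cb(2), of "(x, t)"] iGq[OF m4(3) Hb, of "(x, t)"]
      have "(\<integral>q. G1 x t (fst q) (snd q) + G2 x t (fst q) (snd q) \<partial>?Q) \<le> (\<integral>q. - H x t (fst q) (snd q) \<partial>?Q)"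
        by (rule integral_mono) (use i pointwise[OF t] in auto)
      then show "(\<integral>q. G1 (fst (x, t)) (snd (x, t)) (fst q) (snd q) \<partial>?Q) + (\<integral>q. G2 (fst (x, t)) (snd (x, t)) (fst q) (snd q) \<partial>?Q)
        \<le> - (\<integral>q. H (fst (x, t)) (snd (x, t)) (fst q) (snd q) \<partial>?Q)"
        using i by simp
    qed
  qed (use iG[OF m4(1) Cb(1)] iG[OF m4(2) Cb(2)] iG[OF m4(3) Hb] in auto)
  then have main: "(\<integral>p. (\<integral>q. H (fst p) (snd p) (fst q) (snd q) \<partial>?Q) \<partial>?Q) \<le> 2 * e * T + (\<integral>q. Bu (fst q) (snd q) \<partial>?Q)"
    using ineq1 ineq2 iG[OF m4(1) Cb(1)] iG[OF m4(2) Cb(2)] by simp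

  have vz[measurable]: "(\<lambda>x. v (x - z) s) \<in> borel_measurable borel" for z s by measurable
  have cv_periodic: "cv (y + 1) s = cv y s" for y s
    unfolding cv_def by (rule FW_conv_periodic) measurable
  have \<rho>_shift: "\<rho> (x - (y + 1)) = \<rho> (x - y)" for x y
    using \<rho>_periodic[of "x - (y + 1)"] by (simp add: algebra_simps)
  define Dd where "Dd t = (\<integral>x. \<bar>u x t - v x t\<bar> \<partial>ivm 0 1)" for t
  have [measurable]: "Dd \<in> borel_measurable borel" unfolding Dd_def by measurable
  have Ddb: "0 \<le> Dd t" "Dd t \<le> 2 * R" for t
  proof -
    show "0 \<le> Dd t" unfolding Dd_def by (rule Bochner_Integration.integral_nonneg) auto
    show "Dd t \<le> 2 * R" using integral_ivm_bound1[of "\<lambda>x. \<bar>u x t - v x t\<bar>" "2 * R"] uv unfolding Dd_def by fastforce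
  qed
  define W where "W t = (\<integral>s. \<omega> (t - s) \<partial>ivm 0 T)" for t
  have [measurable]: "W \<in> borel_measurable borel" unfolding W_def by measurable
  have Wb: "0 \<le> W t" "W t \<le> 1" for t
    unfolding W_def using \<omega>_integral_le nonneg by (auto intro!: Bochner_Integration.integral_nonneg)
  let ?CH = "(D * 1 * D) * ((FW_B + 1) * (2 * R) + 2 * (FW_B * R))"
  \<comment> \<open>With \<open>Ed\<close> the L1 distance at displacement z, the sources differ by
    at most \<open>FW_B * Ed\<close> at every x. Integrating (B + 1) |u - v| - |cu - cv| over x,
    with B = \<open>FW_B\<close>, therefore leaves at least (B + 1) Ed - B Ed = Ed. This is the
    origin of the constant \<open>FW_B + 1\<close> in the decay of \<theta>.\<close>
  have inner: "(\<integral>x. H x t (x - z) s \<partial>ivm 0 1) \<ge> \<rho> z * (\<theta> t * \<omega> (t - s) * (Dd t - \<delta>))"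
    if t: "0 \<le> t" "t \<le> T" "0 \<le> s" "s \<le> T" "0 \<le> z" "z \<le> 1" for t s z
  proof (cases "\<omega> (t - s) = 0 \<or> \<rho> z = 0")
    case True
    then show ?thesis by (auto simp: H_def w_def)
  next
    case False
    define Ed where "Ed = (\<integral>x. \<bar>u x t - v (x - z) s\<bar> \<partial>ivm 0 1)"
    have i: "integrable (ivm 0 1) (\<lambda>x. \<bar>u x t - v (x - z) s\<bar>)"
      by (rule integrable_abs_diff[where R=R]) (use u v in auto)
    have "Dd t \<le> Ed + (\<integral>x. \<bar>v (x - z) s - v x t\<bar> \<partial>ivm 0 1)"
      unfolding Dd_def Ed_def by (rule L1_triangle[where R=R]) (use u v in auto)
    then have E: "Dd t - \<delta> \<le> Ed" using modulus[OF t] False by (simp add: abs_minus_commute)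
    have c: "\<bar>cu x t - cv (x - z) s\<bar> \<le> FW_B * Ed" for x
    proof -
      have "cv (x - z) s = FW_conv (\<lambda>y. v (y - z) s) x"
        using FW_conv_shift[of "\<lambda>y. v y s" R x "- z"] v by (simp add: cv_def)
      then show ?thesis unfolding cu_def Ed_def
        using FW_conv_diff_bound[of "\<lambda>y. u y t" "\<lambda>y. v (y - z) s" R R x] u v by simp
    qed
    have "Ed = (\<integral>x. (FW_B + 1) * \<bar>u x t - v (x - z) s\<bar> - FW_B * Ed \<partial>ivm 0 1)"
      using i by (simp add: measure_ivm Ed_def[symmetric] algebra_simps)
    then have "\<rho> z * (\<theta> t * \<omega> (t - s) * Ed) = (\<integral>x. \<rho> z * (\<theta> t * \<omega> (t - s)) * ((FW_B + 1) * \<bar>u x t - v (x - z) s\<bar> - FW_B * Ed) \<partial>ivm 0 1)"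
      by (simp add: mult.assoc)
    also have "\<dots> \<le> (\<integral>x. H x t (x - z) s \<partial>ivm 0 1)"
    proof (rule integral_mono)
      show "integrable (ivm 0 1) (\<lambda>x. H x t (x - z) s)" by (rule integrable_ivm[where C="?CH"]) (use Hb in auto)
      fix x
      have "H x t (x - z) s = \<rho> z * (\<theta> t * \<omega> (t - s)) * ((FW_B + 1) * \<bar>u x t - v (x - z) s\<bar> - \<bar>cu x t - cv (x - z) s\<bar>)"
        by (simp add: H_def w_def)
      then show "\<rho> z * (\<theta> t * \<omega> (t - s)) * ((FW_B + 1) * \<bar>u x t - v (x - z) s\<bar> - FW_B * Ed) \<le> H x t (x - z) s"
        using c[of x] nonneg by (auto intro!: mult_left_mono)
    qed (use i in auto)
    finally have "\<rho> z * (\<theta> t * \<omega> (t - s) * Ed) \<le> (\<integral>x. H x t (x - z) s \<partial>ivm 0 1)" .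
    moreover have "\<rho> z * (\<theta> t * \<omega> (t - s) * (Dd t - \<delta>)) \<le> \<rho> z * (\<theta> t * \<omega> (t - s) * Ed)"
      using E nonneg by (intro mult_left_mono) auto
    ultimately show ?thesis by linarith
  qed
  have DdB: "\<bar>Dd t - \<delta>\<bar> \<le> 2 * R + \<delta>" for t using Ddb[of t] \<delta> by linarith
  have fb: "\<bar>\<rho> z * (\<theta> t * \<omega> (t - s) * (Dd t - \<delta>))\<bar> \<le> D * (1 * D * (2 * R + \<delta>))" for z t s
    by (intro mb ab DdB)
  \<comment> \<open>As \<rho> has integral 1, the bound of \<open>inner\<close> integrates to an
    expression in t alone; \<open>W\<close> is the mass of \<omega> that remains in [0, T].\<close>
  have "(\<integral>t. \<theta> t * W t * (Dd t - \<delta>) \<partial>ivm 0 T) = (\<integral>t. (\<integral>s. (\<integral>z. \<rho> z * (\<theta> t * \<omega> (t - s) * (Dd t - \<delta>)) \<partial>ivm 0 1) \<partial>ivm 0 T) \<partial>ivm 0 T)"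
    by (simp add: \<rho>_integral W_def mult.assoc mult.left_commute)
  also have "\<dots> \<le> (\<integral>t. (\<integral>s. (\<integral>z. (\<integral>x. H x t (x - z) s \<partial>ivm 0 1) \<partial>ivm 0 1) \<partial>ivm 0 T) \<partial>ivm 0 T)"
  proof (rule integral_ivm_mono)
    have b1: "\<bar>\<integral>z. (\<integral>x. H x t (x - z) s \<partial>ivm 0 1) \<partial>ivm 0 1\<bar> \<le> ?CH" for t s
      by (intro integral_ivm_bound1 Hb) auto
    have b2: "\<bar>\<integral>z. \<rho> z * (\<theta> t * \<omega> (t - s) * (Dd t - \<delta>)) \<partial>ivm 0 1\<bar> \<le> D * (1 * D * (2 * R + \<delta>))" for t s
      by (intro integral_ivm_bound1 fb) auto
    show "\<bar>\<integral>s. (\<integral>z. (\<integral>x. H x t (x - z) s \<partial>ivm 0 1) \<partial>ivm 0 1) \<partial>ivm 0 T\<bar> \<le> (T - 0) * ?CH" for t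
      by (rule integral_ivm_bound) (use T b1 in auto)
    show "\<bar>\<integral>s. (\<integral>z. \<rho> z * (\<theta> t * \<omega> (t - s) * (Dd t - \<delta>)) \<partial>ivm 0 1) \<partial>ivm 0 T\<bar> \<le> (T - 0) * (D * (1 * D * (2 * R + \<delta>)))" for t
      by (rule integral_ivm_bound) (use T b2 in auto)
    show "(\<integral>s. (\<integral>z. \<rho> z * (\<theta> t * \<omega> (t - s) * (Dd t - \<delta>)) \<partial>ivm 0 1) \<partial>ivm 0 T) \<le> (\<integral>s. (\<integral>z. (\<integral>x. H x t (x - z) s \<partial>ivm 0 1) \<partial>ivm 0 1) \<partial>ivm 0 T)"
      if t: "0 \<le> t" "t \<le> T" for t
    proof (rule integral_ivm_mono[OF _ _ b2 b1])
      show "(\<integral>z. \<rho> z * (\<theta> t * \<omega> (t - s) * (Dd t - \<delta>)) \<partial>ivm 0 1) \<le> (\<integral>z. (\<integral>x. H x t (x - z) s \<partial>ivm 0 1) \<partial>ivm 0 1)"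
        if s: "0 \<le> s" "s \<le> T" for s
        by (rule integral_ivm_mono[OF _ _ fb integral_ivm_bound1[OF _ Hb] inner[OF t s]]) measurable
    qed measurable
  qed measurable
  also have "\<dots> = (\<integral>p. (\<integral>q. H (fst p) (snd p) (fst q) (snd q) \<partial>?Q) \<partial>?Q)"
    by (rule doubling_variables[symmetric, OF m4(3) Hb])
       (use T v(3) in \<open>auto simp: H_def w_def cv_periodic \<rho>_shift\<close>)
  finally have lower: "(\<integral>t. \<theta> t * W t * (Dd t - \<delta>) \<partial>ivm 0 T) \<le> 2 * e * T + (\<integral>q. Bu (fst q) (snd q) \<partial>?Q)"
    using main by linarith

  let ?I0 = "\<integral>x. \<bar>u0 x - v0 x\<bar> \<partial>ivm 0 1"
  have I0: "?I0 \<ge> 0" by (rule Bochner_Integration.integral_nonneg) auto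
  \<comment> \<open>The initial term compares u0 with v at a small time s and the point x - z;
    passing through v0 uses the strong initial trace of v at the price \<delta>.\<close>
  have B_s: "(\<integral>y. Bu y s \<partial>ivm 0 1) \<le> \<omega> (0 - s) * (?I0 + \<delta>)" if s: "0 \<le> s" "s \<le> T" for s
  proof -
    let ?f = "\<lambda>x y. \<bar>u0 x - v y s\<bar> * (\<rho> (x - y) * \<theta> 0 * \<omega> (0 - s))"
    have fb: "\<bar>?f x y\<bar> \<le> 2 * R * (D * 1 * D)" for x y by (intro mb ab u0v)
    have "(\<integral>y. Bu y s \<partial>ivm 0 1) = (\<integral>x. (\<integral>y. ?f x y \<partial>ivm 0 1) \<partial>ivm 0 1)"
      unfolding Bu_def \<Phi>_def by (rule Fubini_ivm[where C="2 * R * (D * 1 * D)"]) (use fb in auto)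
    also have "\<dots> = (\<integral>x. (\<integral>z. ?f x (x - z) \<partial>ivm 0 1) \<partial>ivm 0 1)"
      by (intro Bochner_Integration.integral_cong refl integral_ivm_reflect[symmetric, where C="2 * R * (D * 1 * D)"])
         (use fb v(3) in \<open>auto simp: \<rho>_shift\<close>)
    also have "\<dots> = (\<integral>z. (\<integral>x. ?f x (x - z) \<partial>ivm 0 1) \<partial>ivm 0 1)"
      by (rule Fubini_ivm[where C="2 * R * (D * 1 * D)"]) (measurable, rule fb)
    also have "\<dots> \<le> (\<integral>z. \<rho> z * (\<omega> (0 - s) * (?I0 + \<delta>)) \<partial>ivm 0 1)"
    proof (rule integral_ivm_mono[OF _ _ integral_ivm_bound1[OF _ fb]])
      show "\<bar>\<rho> z * (\<omega> (0 - s) * (?I0 + \<delta>))\<bar> \<le> D * (D * (?I0 + \<delta>))" for z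
        using I0 \<delta> by (intro mb ab) auto
      show "(\<integral>x. ?f x (x - z) \<partial>ivm 0 1) \<le> \<rho> z * (\<omega> (0 - s) * (?I0 + \<delta>))" if z: "0 \<le> z" "z \<le> 1" for z
      proof (cases "\<omega> (0 - s) = 0 \<or> \<rho> z = 0")
        case True then show ?thesis by auto
      next
        case False
        let ?J = "\<integral>x. \<bar>u0 x - v (x - z) s\<bar> \<partial>ivm 0 1"
        have "?J \<le> ?I0 + (\<integral>x. \<bar>v0 x - v (x - z) s\<bar> \<partial>ivm 0 1)"
          by (rule L1_triangle[where R=R]) (use u0 v0 v in auto)
        then have J: "?J \<le> ?I0 + \<delta>" using initial[OF s z] False by simp
        have J0: "?J \<ge> 0" by (rule Bochner_Integration.integral_nonneg) auto
        have "(\<integral>x. ?f x (x - z) \<partial>ivm 0 1) = \<rho> z * \<omega> (0 - s) * (\<theta> 0 * ?J)" by simp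
        also have "\<dots> \<le> \<rho> z * \<omega> (0 - s) * (?I0 + \<delta>)"
          using mult_mono[OF bound(5)[of 0] J] nonneg J0 by (intro mult_left_mono) auto
        finally show ?thesis by simp
      qed
    qed measurable
    also have "\<dots> = \<omega> (0 - s) * (?I0 + \<delta>)" by (simp add: \<rho>_integral)
    finally show ?thesis .
  qed
  have "(\<integral>q. Bu (fst q) (snd q) \<partial>?Q) = (\<integral>s. (\<integral>y. Bu y s \<partial>ivm 0 1) \<partial>ivm 0 T)"
    using integral_pair_ivm_iterated(2)[of "\<lambda>q. Bu (fst q) (snd q)" 0 1 0 T "2 * R * (D * 1 * D)"] Bub by simp
  also have "\<dots> \<le> (\<integral>s. \<omega> (0 - s) * (?I0 + \<delta>) \<partial>ivm 0 T)"
  proof (rule integral_ivm_mono[OF _ _ integral_ivm_bound1[OF _ Bub] _ B_s])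
    show "\<bar>\<omega> (0 - s) * (?I0 + \<delta>)\<bar> \<le> D * (?I0 + \<delta>)" for s
      using I0 \<delta> by (intro mb ab) auto
  qed measurable
  also have "\<dots> = W 0 * (?I0 + \<delta>)" by (simp add: W_def)
  also have "\<dots> \<le> ?I0 + \<delta>" using mult_right_mono[OF Wb(2)[of 0], of "?I0 + \<delta>"] I0 \<delta> by simp
  finally have Bu_le: "(\<integral>q. Bu (fst q) (snd q) \<partial>?Q) \<le> ?I0 + \<delta>" .

  have WD: "\<bar>\<theta> t * W t\<bar> \<le> 1" "0 \<le> \<theta> t * W t" for t using mb[OF ab(3)[of t], of "W t" 1] Wb[of t] nonneg(3)[of t] by auto
  have iWD: "integrable (ivm 0 T) (\<lambda>t. \<theta> t * W t * Dd t)"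
    by (rule integrable_ivm[where C="1 * (2 * R)"]) (measurable, use mb[OF WD(1)] Ddb in auto)
  have iW: "integrable (ivm 0 T) (\<lambda>t. \<theta> t * W t)" by (rule integrable_ivm[where C=1]) (use WD in auto)
  have "\<bar>\<integral>t. \<theta> t * W t \<partial>ivm 0 T\<bar> \<le> (T - 0) * 1" by (rule integral_ivm_bound) (use WD T in auto)
  then have "(\<integral>t. \<theta> t * W t \<partial>ivm 0 T) * \<delta> \<le> T * \<delta>" using \<delta> by (intro mult_right_mono) auto
  moreover have "(\<integral>t. \<theta> t * W t * (Dd t - \<delta>) \<partial>ivm 0 T) = (\<integral>t. \<theta> t * W t * Dd t \<partial>ivm 0 T) - (\<integral>t. \<theta> t * W t \<partial>ivm 0 T) * \<delta>"
    using iWD iW by (simp add: right_diff_distrib)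
  ultimately have weighted: "(\<integral>t. \<theta> t * W t * Dd t \<partial>ivm 0 T) \<le> ?I0 + (1 + T) * \<delta> + 2 * e * T"
    using lower Bu_le by (simp add: algebra_simps)

  have iI: "integrable (ivm 0 T) (\<lambda>t. indicat_real {T - \<epsilon><..} t)"
    by (rule integrable_ivm[where C=1]) (auto simp: indicator_def)
  \<comment> \<open>Up to T - \<epsilon> the mass \<open>W\<close> is 1 and \<theta> is at least k;
    in the remaining layer the crude bound 2 R is used.\<close>
  have "(\<integral>t. Dd t \<partial>ivm 0 T) \<le> (\<integral>t. (1 / k) * (\<theta> t * W t * Dd t) + 2 * R * indicat_real {T - \<epsilon><..} t \<partial>ivm 0 T)"
  proof (rule integral_mono_AE)
    show "integrable (ivm 0 T) Dd" by (rule integrable_ivm[where C="2*R"]) (use Ddb in auto)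
    show "AE t in ivm 0 T. Dd t \<le> (1 / k) * (\<theta> t * W t * Dd t) + 2 * R * indicat_real {T - \<epsilon><..} t"
    proof (rule AE_ivmI)
      fix t assume t: "0 \<le> t" "t \<le> T"
      show "Dd t \<le> (1 / k) * (\<theta> t * W t * Dd t) + 2 * R * indicat_real {T - \<epsilon><..} t"
      proof (cases "t \<le> T - \<epsilon>")
        case True
        then have "W t = 1" using \<omega>_integral t by (simp add: W_def)
        moreover have "k * Dd t \<le> \<theta> t * Dd t" using k(2)[OF t] Ddb(1)[of t] by (rule mult_right_mono)
        ultimately show ?thesis using k(1) True by (auto simp: field_simps)
      next
        case False
        have "0 \<le> (1 / k) * (\<theta> t * W t * Dd t)" using WD(2)[of t] Ddb(1)[of t] k(1) by simp
        then show ?thesis using False Ddb(2)[of t] by simp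
      qed
    qed
  qed (use iWD iI in auto)
  also have "\<dots> = (1 / k) * (\<integral>t. \<theta> t * W t * Dd t \<partial>ivm 0 T) + 2 * R * measure (ivm 0 T) {T - \<epsilon><..}"
    using iWD iI by simp
  also have "\<dots> \<le> (1 / k) * (?I0 + (1 + T) * \<delta> + 2 * e * T) + 2 * R * \<epsilon>"
  proof (intro add_mono mult_left_mono weighted)
    have "measure (ivm 0 T) {T - \<epsilon><..} = measure lborel ({T - \<epsilon><..} \<inter> {0..T})"
      by (simp add: measure_def emeasure_ivm)
    also have "\<dots> \<le> measure lborel {T - \<epsilon>..T}"
      by (rule measure_mono_fmeasurable) (auto simp: fmeasurable_def emeasure_lborel_Icc_eq)
    also have "\<dots> = \<epsilon>" using \<epsilon> by simp
    finally show "measure (ivm 0 T) {T - \<epsilon><..} \<le> \<epsilon>" .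
  qed (use k R in auto)
  finally show ?thesis by (simp add: Dd_def)
qed

end

section \<open>Mollifiers\<close>

text \<open>The doubling estimate works with bounds and integrals of the kernels. The regularity
  added here turns them into test functions, and the supports of width \<epsilon> make the
  displacements small; since \<rho> is periodic, its support meets [0, 1] near both ends.\<close>

locale smooth_kernel = doubling_kernel +
  assumes \<rho>_deriv: "\<And>z. (\<rho> has_real_derivative \<rho>' z) (at z)"
    and \<omega>_deriv: "\<And>z. (\<omega> has_real_derivative \<omega>' z) (at z)"
    and \<theta>_deriv: "\<And>z. (\<theta> has_real_derivative \<theta>' z) (at z)"
    and \<rho>'_lipschitz: "\<And>a b. \<bar>\<rho>' a - \<rho>' b\<bar> \<le> D * \<bar>a - b\<bar>"
    and \<omega>'_continuous: "continuous_on UNIV \<omega>'" and \<theta>'_continuous: "continuous_on UNIV \<theta>'"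
    and \<rho>_support: "\<And>z. 0 \<le> z \<Longrightarrow> z \<le> 1 \<Longrightarrow> \<rho> z \<noteq> 0 \<Longrightarrow> z < \<epsilon> \<or> 1 - \<epsilon> < z"
    and \<omega>_support': "\<And>z. z \<le> - \<epsilon> \<Longrightarrow> \<omega> z = 0"
begin

lemma \<rho>'_continuous: "continuous_on UNIV \<rho>'"
  by (rule continuous_on_subset[OF lipschitz_on_continuous_on[of D UNIV \<rho>']])
     (use \<rho>'_lipschitz D in \<open>auto simp: lipschitz_on_def dist_real_def\<close>)

lemma cont: "continuous_on S \<rho>" "continuous_on S \<omega>" "continuous_on S \<theta>" for S
  using \<rho>_deriv \<omega>_deriv \<theta>_deriv by (meson DERIV_isCont continuous_at_imp_continuous_on)+

lemma cont_compose:
  assumes "continuous_on S f"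
  shows "continuous_on S (\<lambda>p. \<rho> (f p))" "continuous_on S (\<lambda>p. \<omega> (f p))" "continuous_on S (\<lambda>p. \<theta> (f p))"
    "continuous_on S (\<lambda>p. \<rho>' (f p))" "continuous_on S (\<lambda>p. \<omega>' (f p))" "continuous_on S (\<lambda>p. \<theta>' (f p))"
  using continuous_on_compose2[OF cont(1)[of UNIV] assms] continuous_on_compose2[OF cont(2)[of UNIV] assms]
    continuous_on_compose2[OF cont(3)[of UNIV] assms] continuous_on_compose2[OF \<rho>'_continuous assms]
    continuous_on_compose2[OF \<omega>'_continuous assms] continuous_on_compose2[OF \<theta>'_continuous assms] by auto

lemma lipschitz_of_deriv:
  assumes "\<And>z. (f has_real_derivative f' z) (at z)" "\<And>z. \<bar>f' z\<bar> \<le> D"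
  shows "\<bar>f a - f b\<bar> \<le> D * \<bar>a - b\<bar>"
  using field_differentiable_bound[of UNIV f f' D a b] assms by auto

text \<open>A common constant for both kernels: the first summand bounds \<open>\<Phi>t\<close>,
  where the product rule produces \<open>D * D + D\<close>, the second the remaining functions. It
  also serves as a Lipschitz constant of the x-derivatives.\<close>

definition K where "K = D * (D * D + D) + D * D"

lemma K_bounds: "D * 1 * D \<le> K" "D * (D * D + 1 * D) \<le> K" "D * D * D + D * D \<le> K" "0 \<le> K"
  using D by (auto simp: K_def algebra_simps)

lemma mult_bound: "\<bar>a\<bar> \<le> A \<Longrightarrow> \<bar>b\<bar> \<le> B \<Longrightarrow> \<bar>a * b\<bar> \<le> A * B" for a b A B :: real
  unfolding abs_mult by (intro mult_mono) auto

lemma abs_bounds: "\<bar>\<rho> z\<bar> \<le> D" "\<bar>\<omega> z\<bar> \<le> D" "\<bar>\<theta> z\<bar> \<le> 1"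
  using nonneg[of z] bound[of z] by auto

text \<open>The three factors are changed one at a time. This provides the modulus that the weak
  inequality of the scheme asks of a test function.\<close>

lemma kernel_x_modulus:
  "\<bar>\<rho>' a * \<theta> t * \<omega> s - \<rho>' a' * \<theta> t' * \<omega> s'\<bar> \<le> K * (\<bar>a - a'\<bar> + \<bar>t - t'\<bar> + \<bar>s - s'\<bar>)"
proof -
  have "\<rho>' a * \<theta> t * \<omega> s - \<rho>' a' * \<theta> t' * \<omega> s'
     = (\<rho>' a - \<rho>' a') * \<theta> t * \<omega> s + \<rho>' a' * (\<theta> t - \<theta> t') * \<omega> s + \<rho>' a' * \<theta> t' * (\<omega> s - \<omega> s')"
    by (simp add: algebra_simps)
  also have "\<bar>\<dots>\<bar> \<le> (D * \<bar>a - a'\<bar>) * 1 * D + D * (D * \<bar>t - t'\<bar>) * D + D * 1 * (D * \<bar>s - s'\<bar>)"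
    by (intro order_trans[OF abs_triangle_ineq] add_mono mult_bound \<rho>'_lipschitz abs_bounds bound
          lipschitz_of_deriv[OF \<theta>_deriv bound(6)] lipschitz_of_deriv[OF \<omega>_deriv bound(4)])
  also have "\<dots> = (D * D) * \<bar>a - a'\<bar> + (D * D * D) * \<bar>t - t'\<bar> + (D * D) * \<bar>s - s'\<bar>" by (simp add: algebra_simps)
  also have "\<dots> \<le> K * \<bar>a - a'\<bar> + K * \<bar>t - t'\<bar> + K * \<bar>s - s'\<bar>"
    using D K_bounds(1) by (intro add_mono mult_right_mono) (auto simp: K_def algebra_simps)
  finally show ?thesis by (simp add: algebra_simps)
qed

lemma \<Phi>_test_data: "test_data K (\<Phi> y s) (\<Phi>x y s) (\<Phi>t y s)"
  unfolding test_data_def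
proof (intro conjI allI)
  show "measurable2 (\<Phi> y s)" "measurable2 (\<Phi>x y s)" "measurable2 (\<Phi>t y s)"
    unfolding \<Phi>_def \<Phi>x_def \<Phi>t_def by measurable
  fix x t
  show "0 \<le> \<Phi> y s x t" using nonneg by (simp add: \<Phi>_def)
  have "\<bar>\<Phi> y s x t\<bar> \<le> D * 1 * D" unfolding \<Phi>_def by (intro mult_bound abs_bounds)
  then show "\<Phi> y s x t \<le> K" using K_bounds by linarith
  have "\<bar>\<Phi>x y s x t\<bar> \<le> D * 1 * D" unfolding \<Phi>x_def by (intro mult_bound abs_bounds bound)
  then show "\<bar>\<Phi>x y s x t\<bar> \<le> K" using K_bounds by linarith
  have "\<bar>\<Phi>t y s x t\<bar> \<le> D * (D * D + 1 * D)" unfolding \<Phi>t_def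
    by (intro mult_bound abs_bounds order_trans[OF abs_triangle_ineq] add_mono bound)
  then show "\<bar>\<Phi>t y s x t\<bar> \<le> K" using K_bounds by linarith
  show "\<Phi> y s (x + 1) t = \<Phi> y s x t" using \<rho>_periodic[of "x - y"] by (simp add: \<Phi>_def algebra_simps)
  show "((\<lambda>x. \<Phi> y s x t) has_real_derivative \<Phi>x y s x t) (at x)"
    unfolding \<Phi>_def \<Phi>x_def by (auto intro!: derivative_eq_intros DERIV_chain2[OF \<rho>_deriv])
  show "(\<Phi> y s x has_real_derivative \<Phi>t y s x t) (at t)"
    unfolding \<Phi>_def[abs_def] \<Phi>t_def
    by (auto intro!: derivative_eq_intros DERIV_chain2[OF \<omega>_deriv] \<theta>_deriv simp: algebra_simps)
  show "continuous_on UNIV (\<Phi>t y s x)"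
    unfolding \<Phi>t_def[abs_def] by (intro continuous_intros cont_compose)
qed

lemma \<Psi>_test_data: "test_data K (\<Psi> x t) (\<Psi>x x t) (\<Psi>t x t)"
  unfolding test_data_def
proof (intro conjI allI)
  show "measurable2 (\<Psi> x t)" "measurable2 (\<Psi>x x t)" "measurable2 (\<Psi>t x t)"
    unfolding \<Psi>_def \<Psi>x_def \<Psi>t_def by measurable
  fix y s
  show "0 \<le> \<Psi> x t y s" using nonneg by (simp add: \<Psi>_def)
  have "\<bar>\<Psi> x t y s\<bar> \<le> D * 1 * D" unfolding \<Psi>_def by (intro mult_bound abs_bounds)
  then show "\<Psi> x t y s \<le> K" using K_bounds by linarith
  have "\<bar>\<Psi>x x t y s\<bar> \<le> D * 1 * D" unfolding \<Psi>x_def abs_minus_cancel by (intro mult_bound abs_bounds bound)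
  then show "\<bar>\<Psi>x x t y s\<bar> \<le> K" using K_bounds by linarith
  have "\<bar>\<Psi>t x t y s\<bar> \<le> D * 1 * D" unfolding \<Psi>t_def abs_minus_cancel by (intro mult_bound abs_bounds bound)
  then show "\<bar>\<Psi>t x t y s\<bar> \<le> K" using K_bounds by linarith
  show "\<Psi> x t (y + 1) s = \<Psi> x t y s" using \<rho>_periodic[of "x - (y + 1)"] by (simp add: \<Psi>_def algebra_simps)
  show "((\<lambda>y. \<Psi> x t y s) has_real_derivative \<Psi>x x t y s) (at y)"
    unfolding \<Psi>_def \<Psi>x_def by (auto intro!: derivative_eq_intros DERIV_chain2[OF \<rho>_deriv])
  show "(\<Psi> x t y has_real_derivative \<Psi>t x t y s) (at s)"
    unfolding \<Psi>_def[abs_def] \<Psi>t_def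
    by (auto intro!: derivative_eq_intros DERIV_chain2[OF \<omega>_deriv])
  show "continuous_on UNIV (\<Psi>t x t y)"
    unfolding \<Psi>t_def[abs_def] by (intro continuous_intros cont_compose)
qed

text \<open>The time t enters through \<theta> t and through \<omega> (t - s), hence the factor
  2.\<close>

lemma \<Phi>x_modulus: "\<bar>\<Phi>x y s a t - \<Phi>x y s a' t'\<bar> \<le> K * (\<bar>a - a'\<bar> + 2 * \<bar>t - t'\<bar>)"
  using kernel_x_modulus[of "a - y" t "t - s" "a' - y" t' "t' - s"] by (simp add: \<Phi>x_def add.commute)

lemma \<Psi>x_modulus: "\<bar>\<Psi>x x t a s - \<Psi>x x t a' s'\<bar> \<le> K * (\<bar>a - a'\<bar> + \<bar>s - s'\<bar>)"
  using kernel_x_modulus[of "x - a'" t "t - s'" "x - a" t "t - s"] by (simp add: \<Psi>x_def abs_minus_commute)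

text \<open>\<open>\<Phi>\<close> is tested against arbitrary entropy solutions and must be
  admissible in the sense of the definition; its compact support in time comes from \<omega>.
  \<open>\<Psi>\<close> meets approximations only, which are handled through
  \<open>test_data\<close>.\<close>

lemma \<Phi>_test_fn: "FW_test_fn (\<Phi> y s)"
  unfolding FW_test_fn_def
proof (intro conjI allI)
  show "0 \<le> \<Phi> y s x t" "\<Phi> y s (x + 1) t = \<Phi> y s x t" for x t using \<Phi>_test_data[of y s] by (auto simp: test_data_def)
  show "\<exists>R. \<forall>x t. R < \<bar>t\<bar> \<longrightarrow> \<Phi> y s x t = 0"
  proof (intro exI[of _ "\<bar>s\<bar> + \<epsilon>"] allI impI)
    fix x t assume "\<bar>s\<bar> + \<epsilon> < \<bar>t\<bar>"
    then have "0 \<le> t - s \<or> t - s \<le> - \<epsilon>" using \<epsilon> by linarith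
    then show "\<Phi> y s x t = 0" using \<omega>_support \<omega>_support' by (auto simp: \<Phi>_def)
  qed
  show "\<exists>\<phi>x \<phi>t. (\<forall>x t. ((\<lambda>p. \<Phi> y s (fst p) (snd p)) has_derivative (\<lambda>h. \<phi>x x t * fst h + \<phi>t x t * snd h)) (at (x, t))) \<and>
      continuous_on UNIV (\<lambda>p. \<phi>x (fst p) (snd p)) \<and> continuous_on UNIV (\<lambda>p. \<phi>t (fst p) (snd p))"
  proof (intro exI conjI allI)
    show "((\<lambda>p. \<Phi> y s (fst p) (snd p)) has_derivative (\<lambda>h. \<Phi>x y s x t * fst h + \<Phi>t y s x t * snd h)) (at (x, t))" for x t
    proof -
      have r: "((\<lambda>p. \<rho> (fst p - y)) has_derivative (\<lambda>h. \<rho>' (x - y) * fst h)) (at (x, t))"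
        by (rule has_derivative_compose[where g=\<rho> and g'="\<lambda>h. \<rho>' (x - y) * h" and f="\<lambda>p. fst p - y", of fst])
           (use \<rho>_deriv[of "x - y"] in \<open>auto simp: has_field_derivative_def intro!: derivative_eq_intros\<close>)
      have o: "((\<lambda>p. \<omega> (snd p - s)) has_derivative (\<lambda>h. \<omega>' (t - s) * snd h)) (at (x, t))"
        by (rule has_derivative_compose[where g=\<omega> and g'="\<lambda>h. \<omega>' (t - s) * h" and f="\<lambda>p. snd p - s", of snd])
           (use \<omega>_deriv[of "t - s"] in \<open>auto simp: has_field_derivative_def intro!: derivative_eq_intros\<close>)
      have th: "((\<lambda>p. \<theta> (snd p)) has_derivative (\<lambda>h. \<theta>' t * snd h)) (at (x, t))"
        by (rule has_derivative_compose[where g=\<theta> and g'="\<lambda>h. \<theta>' t * h" and f=snd, of snd])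
           (use \<theta>_deriv[of t] in \<open>auto simp: has_field_derivative_def intro!: derivative_eq_intros\<close>)
      show ?thesis unfolding \<Phi>_def
        by (rule has_derivative_eq_rhs[OF has_derivative_mult[OF has_derivative_mult[OF r th] o]])
           (auto simp: \<Phi>x_def \<Phi>t_def algebra_simps)
    qed
    show "continuous_on UNIV (\<lambda>p. \<Phi>x y s (fst p) (snd p))"
      unfolding \<Phi>x_def by (intro continuous_intros cont_compose)
    show "continuous_on UNIV (\<lambda>p. \<Phi>t y s (fst p) (snd p))"
      unfolding \<Phi>t_def by (intro continuous_intros cont_compose)
  qed
qed

end

section \<open>Explicit C^1 kernels\<close>

text \<open>Squaring smooths the corner of the positive part, whose square has the continuous
  derivative \<open>2 * max 0 y\<close>. Both mollifiers are multiples of squared positive parts of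
  explicit functions, which keeps all constants elementary.\<close>

lemma DERIV_max0_square:
  assumes "(f has_real_derivative f') (at x)"
  shows "((\<lambda>x. (max 0 (f x))\<^sup>2) has_real_derivative 2 * max 0 (f x) * f') (at x)"
proof -
  have "((\<lambda>y::real. (max 0 y)\<^sup>2) has_real_derivative 2 * max 0 y) (at y)" for y
  proof -
    consider "y > 0" | "y < 0" | "y = 0" by linarith
    then show ?thesis
    proof cases
      case 1
      have "((\<lambda>y. y\<^sup>2) has_real_derivative 2 * y) (at y)" by (auto intro!: derivative_eq_intros)
      moreover have "\<forall>\<^sub>F z in nhds y. z\<^sup>2 = (max 0 z)\<^sup>2"
        using eventually_nhds_in_open[of "{0<..}" y] 1 by (auto elim!: eventually_mono)
      ultimately show ?thesis using 1 by (simp add: DERIV_cong_ev[OF refl _ refl])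
    next
      case 2
      have "((\<lambda>y::real. 0) has_real_derivative 0) (at y)" by simp
      moreover have "\<forall>\<^sub>F z in nhds y. 0 = (max 0 z)\<^sup>2"
        using eventually_nhds_in_open[of "{..<0}" y] 2 by (auto elim!: eventually_mono)
      ultimately show ?thesis using 2 DERIV_cong_ev[OF refl _ refl, of "\<lambda>_. 0" "\<lambda>z. (max 0 z)\<^sup>2" y 0] by simp
    next
      case 3
      have "((\<lambda>h::real. (max 0 h)\<^sup>2 / h) \<longlongrightarrow> 0) (at 0)"
      proof (rule Lim_null_comparison)
        show "\<forall>\<^sub>F h in at (0::real). norm ((max 0 h)\<^sup>2 / h) \<le> \<bar>h\<bar>"
          by (auto simp: max_def power2_eq_square)
        show "((\<lambda>h::real. \<bar>h\<bar>) \<longlongrightarrow> 0) (at 0)" by (auto intro!: tendsto_eq_intros)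
      qed
      then show ?thesis using 3 by (simp add: DERIV_def)
    qed
  qed
  from DERIV_chain2[OF this assms] show ?thesis .
qed

lemma integral_const_indicator_le:
  fixes g :: "real \<Rightarrow> real"
  assumes "continuous_on UNIV g" "\<And>z. 0 \<le> g z" "0 \<le> \<delta>" "\<delta> \<le> 1" "\<And>z. 0 \<le> z \<Longrightarrow> z \<le> \<delta> \<Longrightarrow> c \<le> g z" "\<And>z. g z \<le> C"
  shows "c * \<delta> \<le> (\<integral>z. g z \<partial>ivm 0 1)"
proof -
  have [measurable]: "g \<in> borel_measurable borel" using assms(1) by (rule borel_measurable_continuous_onI)
  have "c * \<delta> = (\<integral>z. c * indicator {0..\<delta>} z \<partial>ivm 0 1)"
    using assms(3,4) by (simp add: measure_def emeasure_ivm)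
  also have "\<dots> \<le> (\<integral>z. g z \<partial>ivm 0 1)"
    by (rule integral_ivm_mono[where C="\<bar>c\<bar>" and D=C]) (use assms(2,5,6) in \<open>auto simp: indicator_def\<close>)
  finally show ?thesis .
qed

text \<open>\<rho> is the normalised square of the positive part of cos (2 pi z) - cos (2 pi
  \<epsilon>). It is periodic by construction and lives within distance \<epsilon> of the integers,
  because the cosine decreases on [0, pi] and \<epsilon> < 1/2.\<close>

lemma ex_periodic_mollifier:
  fixes \<epsilon> :: real
  assumes \<epsilon>: "0 < \<epsilon>" "\<epsilon> < 1/2"
  obtains \<rho> \<rho>' :: "real \<Rightarrow> real" and C where
    "\<And>z. 0 \<le> \<rho> z" "\<And>z. \<rho> z \<le> C" "\<And>z. \<bar>\<rho>' z\<bar> \<le> C" "\<And>z. \<rho> (z + 1) = \<rho> z" "(\<integral>z. \<rho> z \<partial>ivm 0 1) = 1"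
    "\<And>z. (\<rho> has_real_derivative \<rho>' z) (at z)" "\<And>a b. \<bar>\<rho>' a - \<rho>' b\<bar> \<le> C * \<bar>a - b\<bar>"
    "\<And>z. 0 \<le> z \<Longrightarrow> z \<le> 1 \<Longrightarrow> \<rho> z \<noteq> 0 \<Longrightarrow> z < \<epsilon> \<or> 1 - \<epsilon> < z"
proof -
  define \<kappa> where "\<kappa> = cos (2 * pi * \<epsilon>)"
  define m where "m z = max 0 (cos (2 * pi * z) - \<kappa>)" for z :: real
  define I where "I = (\<integral>z. (m z)\<^sup>2 \<partial>ivm 0 1)"
  have mb: "0 \<le> m z" "m z \<le> 2" for z
  proof -
    have "cos (2 * pi * z) - cos (2 * pi * \<epsilon>) \<le> 2"
      using cos_le_one[of "2 * pi * z"] cos_ge_minus_one[of "2 * pi * \<epsilon>"] by linarith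
    then show "0 \<le> m z" "m z \<le> 2" by (auto simp: m_def \<kappa>_def)
  qed
  have m2: "(m z)\<^sup>2 \<le> 4" for z using power_mono[OF mb(2) mb(1), of z 2] by simp
  have m_deriv: "((\<lambda>z. (m z)\<^sup>2) has_real_derivative 2 * m z * (- (2 * pi * sin (2 * pi * z)))) (at z)" for z
    unfolding m_def by (rule DERIV_max0_square) (auto intro!: derivative_eq_intros)
  have mc: "continuous_on UNIV (\<lambda>z. (m z)\<^sup>2)"
    using m_deriv by (meson DERIV_isCont continuous_at_imp_continuous_on)
  have I: "I > 0"
  proof -
    \<comment> \<open>On [0, \<epsilon>/2] the positive part is at least its value at \<epsilon>/2,
      so the normalising integral is positive.\<close>
    let ?c = "cos (2 * pi * (\<epsilon> / 2)) - \<kappa>"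
    have c: "?c > 0"
      unfolding \<kappa>_def using \<epsilon> cos_monotone_0_pi[of "2 * pi * (\<epsilon> / 2)" "2 * pi * \<epsilon>"] by (auto simp: field_simps)
    have "?c\<^sup>2 * (\<epsilon> / 2) \<le> I" unfolding I_def
    proof (rule integral_const_indicator_le[OF mc])
      fix z assume z: "0 \<le> z" "z \<le> \<epsilon> / 2"
      have "cos (2 * pi * (\<epsilon> / 2)) \<le> cos (2 * pi * z)"
        using z \<epsilon> by (intro cos_monotone_0_pi_le) (auto simp: field_simps)
      then have "?c \<le> m z" by (simp add: m_def)
      then show "?c\<^sup>2 \<le> (m z)\<^sup>2" using c by (intro power_mono) auto
    qed (use \<epsilon> m2 in auto)
    moreover have "?c\<^sup>2 * (\<epsilon> / 2) > 0" using c \<epsilon> by simp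
    ultimately show ?thesis by linarith
  qed
  define \<rho> where "\<rho> z = (m z)\<^sup>2 / I" for z
  define \<rho>' where "\<rho>' z = 2 * m z * (- (2 * pi * sin (2 * pi * z))) / I" for z
  \<comment> \<open>The summands bound the Lipschitz constant of \<rho>' (24 pi^2, from 4 pi times 6
    pi), \<rho>' itself (8 pi) and \<rho> (4).\<close>
  define C where "C = (16 * pi\<^sup>2 + 8 * pi\<^sup>2 + 8 * pi + 4) / I"
  have sinl: "\<bar>sin a - sin b\<bar> \<le> \<bar>a - b\<bar>" for a b :: real
    using field_differentiable_bound[of UNIV sin cos 1 a b] by auto
  have cosl: "\<bar>cos a - cos b\<bar> \<le> \<bar>a - b\<bar>" for a b :: real
    using field_differentiable_bound[of UNIV cos "\<lambda>x. - sin x" 1 a b] by (auto intro!: derivative_eq_intros)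
  have ml: "\<bar>m a - m b\<bar> \<le> 2 * pi * \<bar>a - b\<bar>" for a b
  proof -
    have "\<bar>m a - m b\<bar> \<le> \<bar>cos (2 * pi * a) - cos (2 * pi * b)\<bar>" unfolding m_def by linarith
    also have "\<dots> \<le> \<bar>2 * pi * a - 2 * pi * b\<bar>" by (rule cosl)
    also have "\<dots> = 2 * pi * \<bar>a - b\<bar>" by (simp add: right_diff_distrib[symmetric] abs_mult)
    finally show ?thesis .
  qed
  have sl: "\<bar>sin (2 * pi * a) - sin (2 * pi * b)\<bar> \<le> 2 * pi * \<bar>a - b\<bar>" for a b
    using sinl[of "2 * pi * a" "2 * pi * b"] by (simp add: right_diff_distrib[symmetric] abs_mult)
  have C4: "4 / I \<le> C" unfolding C_def using I by (intro divide_right_mono) auto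
  show ?thesis
  proof (rule that[of \<rho> C \<rho>'])
    fix z a b :: real
    show "0 \<le> \<rho> z" using I by (simp add: \<rho>_def)
    have "\<rho> z \<le> 4 / I" unfolding \<rho>_def using m2 I by (intro divide_right_mono) auto
    then show "\<rho> z \<le> C" using C4 by linarith
    have "\<bar>m z * sin (2 * pi * z)\<bar> \<le> 2 * 1" unfolding abs_mult using mb[of z] by (intro mult_mono) auto
    then have "\<bar>2 * m z * (- (2 * pi * sin (2 * pi * z)))\<bar> \<le> 8 * pi"
      by (simp add: abs_mult)
    then have "\<bar>\<rho>' z\<bar> \<le> 8 * pi / I" unfolding \<rho>'_def abs_divide using I by (auto intro!: divide_right_mono)
    also have "\<dots> \<le> C" unfolding C_def using I by (intro divide_right_mono) auto
    finally show "\<bar>\<rho>' z\<bar> \<le> C" .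
    have "cos (2 * pi * (z + 1)) = cos (2 * pi * z)" by (simp add: distrib_left)
    then show "\<rho> (z + 1) = \<rho> z" by (simp add: \<rho>_def m_def)
    show "(\<integral>z. \<rho> z \<partial>ivm 0 1) = 1" using I by (simp add: \<rho>_def I_def)
    show "(\<rho> has_real_derivative \<rho>' z) (at z)"
      unfolding \<rho>_def \<rho>'_def by (rule DERIV_cdivide[OF m_deriv])
    show "\<bar>\<rho>' a - \<rho>' b\<bar> \<le> C * \<bar>a - b\<bar>"
    proof -
      have "m a * sin (2 * pi * a) - m b * sin (2 * pi * b) = (m a - m b) * sin (2 * pi * a) + m b * (sin (2 * pi * a) - sin (2 * pi * b))"
        by (simp add: algebra_simps)
      also have "\<bar>\<dots>\<bar> \<le> \<bar>m a - m b\<bar> * \<bar>sin (2 * pi * a)\<bar> + \<bar>m b\<bar> * \<bar>sin (2 * pi * a) - sin (2 * pi * b)\<bar>"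
        by (rule order_trans[OF abs_triangle_ineq]) (simp add: abs_mult)
      also have "\<dots> \<le> (2 * pi * \<bar>a - b\<bar>) * 1 + 2 * (2 * pi * \<bar>a - b\<bar>)"
        using mb[of b] by (intro add_mono mult_mono ml sl) auto
      finally have l: "\<bar>m a * sin (2 * pi * a) - m b * sin (2 * pi * b)\<bar> \<le> 6 * pi * \<bar>a - b\<bar>" by simp
      have "\<rho>' a - \<rho>' b = (- (4 * pi) * (m a * sin (2 * pi * a) - m b * sin (2 * pi * b))) / I"
        using I by (simp add: \<rho>'_def field_simps)
      then have "\<bar>\<rho>' a - \<rho>' b\<bar> = 4 * pi * \<bar>m a * sin (2 * pi * a) - m b * sin (2 * pi * b)\<bar> / I"
        using I by (simp add: abs_mult)
      also have "\<dots> \<le> 4 * pi * (6 * pi * \<bar>a - b\<bar>) / I"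
        using l I by (intro divide_right_mono mult_left_mono) auto
      also have "\<dots> = (24 * pi\<^sup>2) / I * \<bar>a - b\<bar>" by (simp add: power2_eq_square)
      also have "\<dots> \<le> C * \<bar>a - b\<bar>" unfolding C_def using I by (intro mult_right_mono divide_right_mono) auto
      finally show ?thesis .
    qed
    show "z < \<epsilon> \<or> 1 - \<epsilon> < z" if z: "0 \<le> z" "z \<le> 1" "\<rho> z \<noteq> 0"
    proof (rule ccontr)
      assume "\<not> ?thesis"
      then have n: "\<epsilon> \<le> z" "z \<le> 1 - \<epsilon>" by auto
      have "cos (2 * pi * z) \<le> \<kappa>"
      proof (cases "z \<le> 1/2")
        case True
        then show ?thesis unfolding \<kappa>_def using n \<epsilon> by (intro cos_monotone_0_pi_le) (auto simp: field_simps)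
      next
        case False
        \<comment> \<open>The cosine is monotone on [0, pi] only; the right half of the period is
          reflected onto the left.\<close>
        have "cos (2 * pi * z) = cos (2 * pi * (1 - z))" by (simp add: right_diff_distrib cos_diff)
        also have "\<dots> \<le> \<kappa>" unfolding \<kappa>_def
        proof (rule cos_monotone_0_pi_le)
          show "2 * pi * \<epsilon> \<le> 2 * pi * (1 - z)" using n by (intro mult_left_mono) auto
        qed (use \<epsilon> False in \<open>auto simp: field_simps\<close>)
        finally show ?thesis .
      qed
      then show False using z(3) by (simp add: \<rho>_def m_def)
    qed
  qed
qed

text \<open>\<omega> is a multiple of z^2 (z + \<epsilon>)^2 on [-\<epsilon>, 0], whose Beta
  integral is \<epsilon>^5 / 30; hence the factor N. The mass of s \<mapsto> \<omega> (t - s) lies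
  in [t, t + \<epsilon>], which is contained in [0, T] for 0 <= t <= T - \<epsilon>.\<close>

lemma ex_one_sided_mollifier:
  fixes \<epsilon> T :: real
  assumes \<epsilon>: "0 < \<epsilon>" and T: "T > 0"
  obtains \<omega> \<omega>' :: "real \<Rightarrow> real" and C where
    "\<And>z. 0 \<le> \<omega> z" "\<And>z. \<omega> z \<le> C" "\<And>z. \<bar>\<omega>' z\<bar> \<le> C" "\<And>z. (\<omega> has_real_derivative \<omega>' z) (at z)" "continuous_on UNIV \<omega>'"
    "\<And>z. 0 \<le> z \<Longrightarrow> \<omega> z = 0" "\<And>z. z \<le> - \<epsilon> \<Longrightarrow> \<omega> z = 0"
    "\<And>t. (\<integral>s. \<omega> (t - s) \<partial>ivm 0 T) \<le> 1" "\<And>t. 0 \<le> t \<Longrightarrow> t \<le> T - \<epsilon> \<Longrightarrow> (\<integral>s. \<omega> (t - s) \<partial>ivm 0 T) = 1"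
proof -
  define N where "N = 30 / \<epsilon>^5"
  have N: "N > 0" using \<epsilon> by (simp add: N_def)
  define m where "m z = max 0 (- z * (z + \<epsilon>))" for z
  have m_out: "m z = 0" if "z \<notin> {-\<epsilon>..0}" for z
  proof (cases "z > 0")
    case True
    then have "0 < z * (z + \<epsilon>)" using \<epsilon> by (intro mult_pos_pos) auto
    then show ?thesis by (simp add: m_def)
  next
    case False
    then have "z + \<epsilon> < 0" "z < 0" using that \<epsilon> by auto
    then have "0 < z * (z + \<epsilon>)" by (intro mult_neg_neg) auto
    then show ?thesis by (simp add: m_def)
  qed
  have mb: "0 \<le> m z" "m z \<le> \<epsilon>\<^sup>2" for z
  proof -
    show "0 \<le> m z" by (simp add: m_def)
    show "m z \<le> \<epsilon>\<^sup>2"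
    proof (cases "z \<in> {-\<epsilon>..0}")
      case True
      then have "- z * (z + \<epsilon>) \<le> \<epsilon> * \<epsilon>" using \<epsilon> by (intro mult_mono) auto
      then show ?thesis by (simp add: m_def power2_eq_square)
    qed (simp add: m_out)
  qed
  define \<omega> where "\<omega> z = N * (m z)\<^sup>2" for z
  define \<omega>' where "\<omega>' z = N * (2 * m z * (- 2 * z - \<epsilon>))" for z
  have deriv: "(\<omega> has_real_derivative \<omega>' z) (at z)" for z
    unfolding \<omega>_def \<omega>'_def m_def
    by (intro DERIV_cmult DERIV_max0_square) (auto intro!: derivative_eq_intros)
  have \<omega>_eq: "\<omega> z = (N * (z^4 + 2 * \<epsilon> * z^3 + \<epsilon>\<^sup>2 * z\<^sup>2)) * indicator {-\<epsilon>..0} z" for z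
  proof (cases "z \<in> {-\<epsilon>..0}")
    case True
    then have "0 \<le> - z * (z + \<epsilon>)" by (intro mult_nonneg_nonneg) auto
    then have m: "m z = - z * (z + \<epsilon>)" by (simp add: m_def)
    show ?thesis unfolding \<omega>_def m using True
      by (simp add: algebra_simps power2_eq_square power3_eq_cube power4_eq_xxxx)
  qed (simp add: m_out \<omega>_def)
  have cont: "continuous_on UNIV \<omega>" using deriv by (meson DERIV_isCont continuous_at_imp_continuous_on)
  have [measurable]: "\<omega> \<in> borel_measurable borel" using cont by (rule borel_measurable_continuous_onI)
  have total: "(\<integral>z. \<omega> z \<partial>lborel) = 1"
  proof -
    have "(\<integral>z. \<omega> z \<partial>lborel) = (\<integral>z. (N * (z^4 + 2 * \<epsilon> * z^3 + \<epsilon>\<^sup>2 * z\<^sup>2)) * indicator {-\<epsilon>..0} z \<partial>lborel)"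
      unfolding \<omega>_eq ..
    also have "\<dots> = N * (0^5 / 5 + \<epsilon> * 0^4 / 2 + \<epsilon>\<^sup>2 * 0^3 / 3) - N * ((-\<epsilon>)^5 / 5 + \<epsilon> * (-\<epsilon>)^4 / 2 + \<epsilon>\<^sup>2 * (-\<epsilon>)^3 / 3)"
      by (rule integral_FTC_Icc_real) (use \<epsilon> in \<open>auto intro!: derivative_eq_intros continuous_intros simp: field_simps\<close>)
    also have "\<dots> = N * (\<epsilon>^5 / 30)" by (simp add: field_simps power2_eq_square power3_eq_cube power4_eq_xxxx numeral_eq_Suc)
    also have "\<dots> = 1" using \<epsilon> by (simp add: N_def)
    finally show ?thesis .
  qed
  have int: "integrable lborel \<omega>"
    using total not_integrable_integral_eq by fastforce
  have conv: "(\<integral>s. \<omega> (t - s) \<partial>ivm 0 T) = (\<integral>z. indicator {t - T..t} z * \<omega> z \<partial>lborel)" for t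
  proof -
    have "(\<integral>z. indicator {t - T..t} z * \<omega> z \<partial>lborel) = (\<integral>s. indicator {t - T..t} (t - s) * \<omega> (t - s) \<partial>lborel)"
      using lborel_integral_real_affine[of "-1" "\<lambda>z. indicator {t - T..t} z * \<omega> z" t] by simp
    also have "\<dots> = (\<integral>s. indicator {0..T} s * \<omega> (t - s) \<partial>lborel)"
      by (intro Bochner_Integration.integral_cong) (auto simp: indicator_def)
    finally show ?thesis by (subst integral_ivm) (auto simp: set_lebesgue_integral_def)
  qed
  define C where "C = N * (\<epsilon>\<^sup>2)\<^sup>2 + N * (2 * \<epsilon>\<^sup>2 * \<epsilon>)"
  show ?thesis
  proof (rule that[of \<omega> C \<omega>'])
    fix z t :: real
    show nn: "0 \<le> \<omega> z" for z using N by (simp add: \<omega>_def)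
    have "(m z)\<^sup>2 \<le> (\<epsilon>\<^sup>2)\<^sup>2" by (rule power_mono[OF mb(2,1)])
    then have "\<omega> z \<le> N * (\<epsilon>\<^sup>2)\<^sup>2" unfolding \<omega>_def using N by (intro mult_left_mono) auto
    then show "\<omega> z \<le> C" using N \<epsilon> by (simp add: C_def add_increasing2)
    have "\<bar>m z * (- 2 * z - \<epsilon>)\<bar> \<le> \<epsilon>\<^sup>2 * \<epsilon>"
    proof (cases "z \<in> {-\<epsilon>..0}")
      case True
      then have "\<bar>- 2 * z - \<epsilon>\<bar> \<le> \<epsilon>" by auto
      then show ?thesis unfolding abs_mult using mb[of z] by (intro mult_mono) auto
    qed (use \<epsilon> in \<open>simp add: m_out\<close>)
    then have "\<bar>2 * m z * (- 2 * z - \<epsilon>)\<bar> \<le> 2 * \<epsilon>\<^sup>2 * \<epsilon>" by (simp add: abs_mult)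
    then have "\<bar>\<omega>' z\<bar> \<le> N * (2 * \<epsilon>\<^sup>2 * \<epsilon>)" unfolding \<omega>'_def abs_mult[of N] using N by (auto intro!: mult_left_mono)
    then show "\<bar>\<omega>' z\<bar> \<le> C" using N by (simp add: C_def add_increasing)
    show "(\<omega> has_real_derivative \<omega>' z) (at z)" by (rule deriv)
    show "continuous_on UNIV \<omega>'" unfolding \<omega>'_def m_def by (intro continuous_intros)
    show "\<omega> z = 0" if "0 \<le> z" using that \<epsilon> by (cases "z = 0") (auto simp: \<omega>_def m_out, simp add: m_def)
    show "\<omega> z = 0" if "z \<le> - \<epsilon>" using that \<epsilon> by (cases "z = - \<epsilon>") (auto simp: \<omega>_def m_out, simp add: m_def)
    have "(\<integral>z. indicator {t - T..t} z * \<omega> z \<partial>lborel) \<le> (\<integral>z. \<omega> z \<partial>lborel)"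
    proof (rule integral_mono)
      show "integrable lborel (\<lambda>z. indicator {t - T..t} z * \<omega> z)"
        by (rule Bochner_Integration.integrable_bound[OF int]) (auto simp: indicator_def)
    qed (use int nn in \<open>auto simp: indicator_def\<close>)
    then show "(\<integral>s. \<omega> (t - s) \<partial>ivm 0 T) \<le> 1" by (simp add: conv total)
    show "(\<integral>s. \<omega> (t - s) \<partial>ivm 0 T) = 1" if "0 \<le> t" "t \<le> T - \<epsilon>"
    proof -
      have "indicator {t - T..t} z * \<omega> z = \<omega> z" for z using that by (auto simp: indicator_def \<omega>_eq)
      then show ?thesis by (simp only: conv total)
    qed
  qed
qed

text \<open>\<theta> is the logistic function 1 / (1 + E) with E = exp (\<mu> t). A pure exponential
  would decay at the right rate but is unbounded towards minus infinity, whereas the kernel bounds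
  are required on the whole line. In \<theta>' = - \<mu> E / (1 + E) \<theta> the quotient is at
  least 1/2 for t >= 0, which accounts for the 2 in \<mu> = 2 (\<open>FW_B\<close> + 1); the lower
  bound k is \<theta> at T.\<close>

lemma ex_smooth_kernel:
  assumes T: "T > 0" and \<epsilon>: "0 < \<epsilon>" "\<epsilon> < 1/2"
  obtains D \<rho> \<rho>' \<omega> \<omega>' \<theta> \<theta>' where "smooth_kernel T D \<epsilon> (1 / (1 + exp (2 * (FW_B + 1) * T))) \<rho> \<rho>' \<omega> \<omega>' \<theta> \<theta>'"
proof -
  obtain \<rho> \<rho>' C1 where \<rho>: "\<And>z. 0 \<le> \<rho> z" "\<And>z. \<rho> z \<le> C1" "\<And>z. \<bar>\<rho>' z\<bar> \<le> C1" "\<And>z. \<rho> (z + 1) = \<rho> z" "(\<integral>z. \<rho> z \<partial>ivm 0 1) = 1"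
    "\<And>z. (\<rho> has_real_derivative \<rho>' z) (at z)" "\<And>a b. \<bar>\<rho>' a - \<rho>' b\<bar> \<le> C1 * \<bar>a - b\<bar>"
    "\<And>z. 0 \<le> z \<Longrightarrow> z \<le> 1 \<Longrightarrow> \<rho> z \<noteq> 0 \<Longrightarrow> z < \<epsilon> \<or> 1 - \<epsilon> < z"
    by (rule ex_periodic_mollifier[OF \<epsilon>]; rule that; assumption)
  obtain \<omega> \<omega>' C2 where \<omega>: "\<And>z. 0 \<le> \<omega> z" "\<And>z. \<omega> z \<le> C2" "\<And>z. \<bar>\<omega>' z\<bar> \<le> C2" "\<And>z. (\<omega> has_real_derivative \<omega>' z) (at z)" "continuous_on UNIV \<omega>'"
    "\<And>z. 0 \<le> z \<Longrightarrow> \<omega> z = 0" "\<And>z. z \<le> - \<epsilon> \<Longrightarrow> \<omega> z = 0"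
    "\<And>t. (\<integral>s. \<omega> (t - s) \<partial>ivm 0 T) \<le> 1" "\<And>t. 0 \<le> t \<Longrightarrow> t \<le> T - \<epsilon> \<Longrightarrow> (\<integral>s. \<omega> (t - s) \<partial>ivm 0 T) = 1"
    by (rule ex_one_sided_mollifier[OF \<epsilon>(1) T]; rule that; assumption)
  define \<mu> where "\<mu> = 2 * (FW_B + 1)"
  have \<mu>: "\<mu> > 0" using FW_B_nonneg by (simp add: \<mu>_def)
  define E where "E t = exp (\<mu> * t)" for t
  have E: "E t > 0" for t by (simp add: E_def)
  define \<theta> where "\<theta> t = 1 / (1 + E t)" for t
  define \<theta>' where "\<theta>' t = - (\<mu> * (E t / (1 + E t)) * \<theta> t)" for t
  have E1: "1 + E t \<noteq> 0" "1 + E t > 0" for t using E[of t] by linarith+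
  have \<theta>b: "0 \<le> \<theta> t" "\<theta> t \<le> 1" for t using E[of t] by (auto simp: \<theta>_def)
  have Eb: "0 \<le> E t / (1 + E t)" "E t / (1 + E t) \<le> 1" for t using E[of t] by auto
  have \<theta>_deriv: "(\<theta> has_real_derivative \<theta>' t) (at t)" for t
  proof -
    have "(E has_real_derivative \<mu> * E t) (at t)" unfolding E_def by (auto intro!: derivative_eq_intros)
    then show ?thesis unfolding \<theta>_def \<theta>'_def using E1[of t]
      by (auto intro!: derivative_eq_intros simp: field_simps power2_eq_square)
  qed
  have E_cont: "continuous_on UNIV E" unfolding E_def by (intro continuous_intros)
  have \<theta>'_cont: "continuous_on UNIV \<theta>'"
    unfolding \<theta>'_def \<theta>_def by (intro continuous_intros E_cont) (use E1 in auto)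
  define D where "D = \<bar>C1\<bar> + \<bar>C2\<bar> + \<mu>"
  have D: "C1 \<le> D" "C2 \<le> D" "\<mu> \<le> D" using \<mu> by (auto simp: D_def)
  have cont: "continuous_on UNIV \<rho>" "continuous_on UNIV \<omega>" "continuous_on UNIV \<theta>"
    using \<rho>(6) \<omega>(4) \<theta>_deriv by (meson DERIV_isCont continuous_at_imp_continuous_on)+
  have C1: "0 \<le> C1" using \<rho>(1,2)[of 0] by linarith
  have "continuous_on UNIV \<rho>'"
    by (rule continuous_on_subset[OF lipschitz_on_continuous_on[of C1 UNIV \<rho>']])
       (use \<rho>(7) C1 in \<open>auto simp: lipschitz_on_def dist_real_def\<close>)
  note bm = this[THEN borel_measurable_continuous_onI] cont[THEN borel_measurable_continuous_onI]
    \<omega>(5)[THEN borel_measurable_continuous_onI] \<theta>'_cont[THEN borel_measurable_continuous_onI]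
  have "smooth_kernel T D \<epsilon> (1 / (1 + exp (2 * (FW_B + 1) * T))) \<rho> \<rho>' \<omega> \<omega>' \<theta> \<theta>'"
  proof unfold_locales
    fix t :: real
    have "\<bar>\<theta>' t\<bar> = \<mu> * (E t / (1 + E t) * \<theta> t)" using \<mu> E[of t] \<theta>b[of t] by (simp add: \<theta>'_def abs_mult)
    also have "\<dots> \<le> \<mu> * 1" using \<mu> mult_mono[OF Eb(2) \<theta>b(2)] \<theta>b Eb by (intro mult_left_mono) auto
    finally show "\<bar>\<theta>' t\<bar> \<le> D" using D by linarith
  next
    fix t assume t: "0 \<le> t" "t \<le> T"
    then have "E t \<ge> 1" using \<mu> by (simp add: E_def)
    then have "1 / 2 \<le> E t / (1 + E t)" by (simp add: field_simps)
    then have "\<mu> * (1 / 2) * \<theta> t \<le> \<mu> * (E t / (1 + E t)) * \<theta> t" using \<mu> \<theta>b by (intro mult_right_mono mult_left_mono) auto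
    then show "\<theta>' t \<le> - (FW_B + 1) * \<theta> t" by (simp add: \<theta>'_def \<mu>_def algebra_simps)
    have "E t \<le> exp (2 * (FW_B + 1) * T)" using t \<mu> by (simp add: E_def \<mu>_def)
    then show "1 / (1 + exp (2 * (FW_B + 1) * T)) \<le> \<theta> t" unfolding \<theta>_def using E[of t] by (intro divide_left_mono) (auto intro!: mult_pos_pos add_pos_pos)
  next
    show "1 / (1 + exp (2 * (FW_B + 1) * T)) > 0" by (auto intro!: divide_pos_pos add_pos_pos)
  next
    fix z
    show "\<rho> z \<le> D" "\<bar>\<rho>' z\<bar> \<le> D" "\<omega> z \<le> D" "\<bar>\<omega>' z\<bar> \<le> D"
      using order_trans[OF \<rho>(2) D(1)] order_trans[OF \<rho>(3) D(1)] order_trans[OF \<omega>(2) D(2)] order_trans[OF \<omega>(3) D(2)] by auto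
  next
    fix a b
    show "\<bar>\<rho>' a - \<rho>' b\<bar> \<le> D * \<bar>a - b\<bar>" using order_trans[OF \<rho>(7) mult_right_mono[OF D(1)]] by simp
  qed (use T \<epsilon> \<rho> \<omega> \<theta>_deriv \<theta>'_cont D \<theta>b bm in auto)
  then show ?thesis by (rule that)
qed

section \<open>Lipschitz approximation of the data\<close>

text \<open>A measurable function is an almost everywhere limit of continuous ones; clamping these
  to [-M, M] supplies the domination.\<close>

lemma L1_continuous_approx:
  fixes w :: "real \<Rightarrow> real"
  assumes w[measurable]: "w \<in> borel_measurable borel" and b: "\<And>x. \<bar>w x\<bar> \<le> M" and e: "e > 0"
  obtains g where "continuous_on UNIV g" "(\<integral>x. \<bar>g x - w x\<bar> \<partial>ivm c d) < e"
proof -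
  have "w \<in> borel_measurable lebesgue" by (rule measurable_completion) simp
  then have "w measurable_on UNIV"
    by (rule lebesgue_measurable_imp_measurable_on) simp
  then obtain N f where N: "negligible N" and f: "\<And>n. continuous_on UNIV (f n)" and lim: "\<And>x. x \<notin> N \<Longrightarrow> (\<lambda>n. f n x) \<longlonglongrightarrow> w x"
    unfolding measurable_on_def by auto
  define g where "g n x = max (- M) (min M (f n x))" for n x
  have gc: "continuous_on UNIV (g n)" for n unfolding g_def by (intro continuous_intros f)
  have [measurable]: "g n \<in> borel_measurable borel" for n using gc by (rule borel_measurable_continuous_onI)
  have M: "M \<ge> 0" using b[of 0] by simp
  have gb: "\<bar>g n x\<bar> \<le> M" for n x using M by (auto simp: g_def)
  have "AE x in lebesgue. x \<notin> N" using N by (simp add: negligible_iff_null_sets AE_not_in)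
  then have ae: "AE x in lborel. x \<notin> N" by (simp add: AE_completion_iff)
  have "(\<lambda>n. \<integral>x. \<bar>g n x - w x\<bar> \<partial>ivm c d) \<longlonglongrightarrow> (\<integral>x. 0 \<partial>ivm c d)"
  proof (rule integral_dominated_convergence[where w="\<lambda>_. 2 * M"])
    show "AE x in ivm c d. (\<lambda>n. \<bar>g n x - w x\<bar>) \<longlonglongrightarrow> 0"
      unfolding AE_ivm_iff using ae
    proof eventually_elim
      case (elim x)
      have "(\<lambda>n. g n x) \<longlonglongrightarrow> max (- M) (min M (w x))" unfolding g_def by (intro tendsto_intros lim elim)
      moreover have "max (- M) (min M (w x)) = w x" using b[of x] by auto
      ultimately show ?case by (auto simp: tendsto_rabs_zero_iff LIM_zero_iff)
    qed
    show "AE x in ivm c d. norm \<bar>g n x - w x\<bar> \<le> 2 * M" for n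
    proof (rule AE_ivmI)
      show "norm \<bar>g n x - w x\<bar> \<le> 2 * M" for x using gb[of n x] b[of x] by (simp add: abs_le_iff)
    qed
  qed auto
  then have "\<forall>\<^sub>F n in sequentially. (\<integral>x. \<bar>g n x - w x\<bar> \<partial>ivm c d) < e" using e by (auto dest: order_tendstoD)
  then obtain n where "(\<integral>x. \<bar>g n x - w x\<bar> \<partial>ivm c d) < e" by (auto simp: eventually_sequentially)
  with gc show ?thesis by (rule that)
qed

text \<open>Approximate w by a continuous g on [0, 2], the range of x + y: two approximation errors
  and the uniform continuity of g contribute e/4 each.\<close>

lemma L1_translation_continuous:
  fixes w :: "real \<Rightarrow> real"
  assumes w[measurable]: "w \<in> borel_measurable borel" and b: "\<And>x. \<bar>w x\<bar> \<le> M" and e: "e > 0"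
  obtains \<delta> where "0 < \<delta>" "\<delta> \<le> 1" "\<And>y. 0 \<le> y \<Longrightarrow> y \<le> \<delta> \<Longrightarrow> (\<integral>x. \<bar>w (x + y) - w x\<bar> \<partial>ivm 0 1) \<le> e"
proof -
  obtain g where gc: "continuous_on UNIV g" and g: "(\<integral>x. \<bar>g x - w x\<bar> \<partial>ivm 0 2) < e / 4"
    using L1_continuous_approx[OF w b, of "e / 4" 0 2] e by auto
  have [measurable]: "g \<in> borel_measurable borel" using gc by (rule borel_measurable_continuous_onI)
  have uc: "uniformly_continuous_on {0..2} g"
    by (intro compact_uniformly_continuous continuous_on_subset[OF gc]) auto
  then obtain d where d: "d > 0" "\<And>x y. x \<in> {0..2} \<Longrightarrow> y \<in> {0..2} \<Longrightarrow> dist y x < d \<Longrightarrow> dist (g y) (g x) < e / 4"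
    unfolding uniformly_continuous_on_def using e by (metis zero_less_divide_iff zero_less_numeral)
  have "\<exists>C. \<forall>x\<in>{0..2}. \<bar>g x\<bar> \<le> C"
    using compact_imp_bounded[OF compact_continuous_image[OF continuous_on_subset[OF gc], of "{0..2}"]]
    by (auto simp: bounded_iff)
  then obtain C where C: "\<And>x. x \<in> {0..2} \<Longrightarrow> \<bar>g x\<bar> \<le> C" by blast
  have C2: "\<bar>\<bar>g x - w x\<bar>\<bar> \<le> C + M" if "x \<in> {0..2}" for x using C[OF that] b[of x] by linarith
  let ?f = "\<lambda>x. \<bar>g x - w x\<bar>"
  have i02: "integrable (ivm 0 2) ?f" by (rule integrable_ivm[where C="C + M"]) (use C2 in auto)
  have part: "(\<integral>x. ?f (x + y) \<partial>ivm 0 1) \<le> e / 4" if y: "0 \<le> y" "y \<le> 1" for y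
  proof -
    have "(\<integral>x. ?f (x + y) \<partial>ivm 0 1) = (\<integral>x. indicator {0..1} x * ?f (x + y) \<partial>lborel)"
      by (subst integral_ivm) (auto simp: set_lebesgue_integral_def)
    also have "\<dots> = (\<integral>x. indicator {y..1+y} x * ?f x \<partial>lborel)"
      by (subst lborel_integral_real_affine[of 1 "\<lambda>x. indicator {y..1+y} x * ?f x" y])
         (auto intro!: Bochner_Integration.integral_cong simp: add.commute split: split_indicator)
    also have "\<dots> \<le> (\<integral>x. indicator {0..2} x * ?f x \<partial>lborel)"
    proof (rule integral_mono)
      have int: "integrable lborel (\<lambda>x. indicator {p..q} x * ?f x)" if "0 \<le> p" "q \<le> 2" for p q
      proof (rule integrableI_bounded_set[where A="{p..q}" and B="C + M"])
        show "AE x in lborel. x \<in> {p..q} \<longrightarrow> norm (indicator {p..q} x * ?f x) \<le> C + M" using C2 that by auto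
      qed (auto simp: emeasure_lborel_Icc_eq)
      show "integrable lborel (\<lambda>x. indicator {y..1+y} x * ?f x)" "integrable lborel (\<lambda>x. indicator {0..2} x * ?f x)"
        using int[of y "1 + y"] int[of 0 2] y by auto
      show "indicator {y..1+y} x * ?f x \<le> indicator {0..2} x * ?f x" for x using y by (auto simp: indicator_def)
    qed
    also have "\<dots> = (\<integral>x. ?f x \<partial>ivm 0 2)" by (subst integral_ivm) (auto simp: set_lebesgue_integral_def)
    finally show ?thesis using g by simp
  qed
  show ?thesis
  proof (rule that[of "min 1 (d / 2)"])
    show "0 < min 1 (d / 2)" "min 1 (d / 2) \<le> 1" using d by auto
    fix y assume y: "0 \<le> y" "y \<le> min 1 (d / 2)"
    have i1: "integrable (ivm 0 1) (\<lambda>x. ?f (x + a))" if "0 \<le> a" "a \<le> 1" for a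
      by (rule integrable_ivm[where C="C + M"]) (use C2 that in auto)
    have "(\<integral>x. \<bar>w (x + y) - w x\<bar> \<partial>ivm 0 1) \<le> (\<integral>x. (?f (x + y) + ?f (x + 0)) + e / 4 \<partial>ivm 0 1)"
    proof (rule integral_mono_AE)
      show "integrable (ivm 0 1) (\<lambda>x. \<bar>w (x + y) - w x\<bar>)" by (rule integrable_abs_diff[where R=M]) (use b in auto)
      show "integrable (ivm 0 1) (\<lambda>x. (?f (x + y) + ?f (x + 0)) + e / 4)"
        using i1[of y] i1[of 0] y by (intro Bochner_Integration.integrable_add) auto
      show "AE x in ivm 0 1. \<bar>w (x + y) - w x\<bar> \<le> (?f (x + y) + ?f (x + 0)) + e / 4"
      proof (rule AE_ivmI)
        fix x :: real assume x: "0 \<le> x" "x \<le> 1"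
        have "dist (g (x + y)) (g x) < e / 4" by (rule d(2)) (use x y d(1) in \<open>auto simp: dist_real_def\<close>)
        then have "\<bar>g (x + y) - g x\<bar> < e / 4" by (simp only: dist_real_def)
        then show "\<bar>w (x + y) - w x\<bar> \<le> (?f (x + y) + ?f (x + 0)) + e / 4" unfolding add_0_right by linarith
      qed
    qed
    also have "\<dots> = (\<integral>x. ?f (x + y) \<partial>ivm 0 1) + (\<integral>x. ?f (x + 0) \<partial>ivm 0 1) + e / 4"
      using i1[of y] i1[of 0] y by (simp add: measure_ivm)
    also have "\<dots> \<le> e" using part[of y] part[of 0] y e by simp
    finally show "(\<integral>x. \<bar>w (x + y) - w x\<bar> \<partial>ivm 0 1) \<le> e" .
  qed
qed

text \<open>Steklov average over [x, x + \<delta>]. Sliding the window changes the integral only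
  near its two ends, which gives the Lipschitz constant 2 M / \<delta>. Bound and period are
  inherited, and by Fubini the L1 error is at most an average of translation errors.\<close>

lemma L1_lipschitz_approx:
  fixes w :: "real \<Rightarrow> real"
  assumes w[measurable]: "w \<in> borel_measurable borel" and b: "\<And>x. \<bar>w x\<bar> \<le> M" and per: "\<And>x. w (x + 1) = w x" and e: "e > 0"
  obtains v L where "v \<in> borel_measurable borel" "\<And>x. \<bar>v x\<bar> \<le> M" "\<And>x. v (x + 1) = v x" "L \<ge> 0"
    "\<And>x y. \<bar>v x - v y\<bar> \<le> L * \<bar>x - y\<bar>" "(\<integral>x. \<bar>w x - v x\<bar> \<partial>ivm 0 1) \<le> e"
proof -
  obtain \<delta> where \<delta>: "0 < \<delta>" "\<delta> \<le> 1" and tr: "\<And>y. 0 \<le> y \<Longrightarrow> y \<le> \<delta> \<Longrightarrow> (\<integral>x. \<bar>w (x + y) - w x\<bar> \<partial>ivm 0 1) \<le> e"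
    using L1_translation_continuous[OF w b e] by blast
  have M: "M \<ge> 0" using b[of 0] by simp
  define v where "v x = (\<integral>y. w (x + y) \<partial>ivm 0 \<delta>) / \<delta>" for x
  have [measurable]: "v \<in> borel_measurable borel" unfolding v_def[abs_def] by measurable
  have ind: "(\<integral>y. w (x + y) \<partial>ivm 0 \<delta>) = (\<integral>z. indicator {x..x+\<delta>} z * w z \<partial>lborel)" for x
  proof -
    have "(\<integral>z. indicator {x..x+\<delta>} z * w z \<partial>lborel) = (\<integral>y. indicator {x..x+\<delta>} (x + y) * w (x + y) \<partial>lborel)"
      using lborel_integral_real_affine[of 1 "\<lambda>z. indicator {x..x+\<delta>} z * w z" x] by simp
    also have "\<dots> = (\<integral>y. indicator {0..\<delta>} y * w (x + y) \<partial>lborel)"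
      by (intro Bochner_Integration.integral_cong) (auto simp: indicator_def)
    finally show ?thesis by (subst integral_ivm) (auto simp: set_lebesgue_integral_def)
  qed
  have int: "integrable lborel (\<lambda>z. indicator {p..q} z * w z)" for p q
  proof (rule integrableI_bounded_set[where A="{p..q}" and B=M])
    show "AE x in lborel. x \<in> {p..q} \<longrightarrow> norm (indicator {p..q} x * w x) \<le> M" using b by auto
  qed (auto simp: emeasure_lborel_Icc_eq)
  have lip: "\<bar>v x' - v x\<bar> \<le> 2 * M / \<delta> * (x' - x)" if "x \<le> x'" for x x'
  proof -
    have "\<bar>(\<integral>z. indicator {x'..x'+\<delta>} z * w z \<partial>lborel) - (\<integral>z. indicator {x..x+\<delta>} z * w z \<partial>lborel)\<bar>
       = \<bar>\<integral>z. indicator {x'..x'+\<delta>} z * w z - indicator {x..x+\<delta>} z * w z \<partial>lborel\<bar>"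
      using int by simp
    also have "\<dots> \<le> (\<integral>z. \<bar>indicator {x'..x'+\<delta>} z * w z - indicator {x..x+\<delta>} z * w z\<bar> \<partial>lborel)"
      by (rule integral_abs_bound)
    also have "\<dots> \<le> (\<integral>z. M * indicator {x..x'} z + M * indicator {x+\<delta>..x'+\<delta>} z \<partial>lborel)"
    proof (rule integral_mono)
      show "\<bar>indicator {x'..x'+\<delta>} z * w z - indicator {x..x+\<delta>} z * w z\<bar> \<le> M * indicator {x..x'} z + M * indicator {x+\<delta>..x'+\<delta>} z" for z
        using that M b[of z] by (auto simp: indicator_def)
    qed (use int in \<open>auto simp: emeasure_lborel_Icc_eq\<close>)
    also have "\<dots> = 2 * M * (x' - x)" using that by (simp add: emeasure_lborel_Icc_eq)
    finally have "\<bar>(\<integral>z. indicator {x'..x'+\<delta>} z * w z \<partial>lborel) - (\<integral>z. indicator {x..x+\<delta>} z * w z \<partial>lborel)\<bar> / \<delta> \<le> 2 * M * (x' - x) / \<delta>"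
      using \<delta> by (intro divide_right_mono) auto
    moreover have "v x' - v x = ((\<integral>z. indicator {x'..x'+\<delta>} z * w z \<partial>lborel) - (\<integral>z. indicator {x..x+\<delta>} z * w z \<partial>lborel)) / \<delta>"
      by (simp add: v_def ind diff_divide_distrib)
    ultimately show ?thesis using \<delta> by (simp add: abs_divide)
  qed
  show ?thesis
  proof (rule that[of v "2 * M / \<delta>"])
    show "\<bar>v x - v y\<bar> \<le> 2 * M / \<delta> * \<bar>x - y\<bar>" for x y
      using lip[of x y] lip[of y x] by (cases "x \<le> y") (auto simp: abs_minus_commute)
    show "\<bar>v x\<bar> \<le> M" for x
    proof -
      have "\<bar>\<integral>y. w (x + y) \<partial>ivm 0 \<delta>\<bar> \<le> (\<delta> - 0) * M" by (rule integral_ivm_bound) (use b \<delta> in auto)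
      then show ?thesis using \<delta> by (simp add: v_def abs_divide field_simps)
    qed
    show "v (x + 1) = v x" for x
    proof -
      have "w (x + 1 + y) = w (x + y)" for y using per[of "x + y"] by (simp add: algebra_simps)
      then show ?thesis by (simp add: v_def)
    qed
    show "(\<integral>x. \<bar>w x - v x\<bar> \<partial>ivm 0 1) \<le> e"
    proof -
      have d: "\<bar>\<bar>w (x + y) - w x\<bar>\<bar> \<le> 2 * M" for x y using b[of "x + y"] b[of x] by linarith
      have pt: "\<bar>w x - v x\<bar> \<le> (\<integral>y. \<bar>w (x + y) - w x\<bar> \<partial>ivm 0 \<delta>) / \<delta>" for x
      proof -
        have i: "integrable (ivm 0 \<delta>) (\<lambda>y. w (x + y))" by (rule integrable_ivm[where C=M]) (use b in auto)
        have "(\<integral>y. w (x + y) - w x \<partial>ivm 0 \<delta>) = \<delta> * v x - \<delta> * w x"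
          using i \<delta> by (simp add: v_def measure_ivm)
        then have "v x - w x = (\<integral>y. w (x + y) - w x \<partial>ivm 0 \<delta>) / \<delta>" using \<delta> by (simp add: field_simps)
        then have "\<bar>v x - w x\<bar> = \<bar>\<integral>y. w (x + y) - w x \<partial>ivm 0 \<delta>\<bar> / \<delta>" using \<delta> by (simp add: abs_divide)
        also have "\<dots> \<le> (\<integral>y. \<bar>w (x + y) - w x\<bar> \<partial>ivm 0 \<delta>) / \<delta>"
          using \<delta> by (intro divide_right_mono integral_abs_bound) auto
        finally show ?thesis by (simp add: abs_minus_commute)
      qed
      have ib: "\<bar>\<integral>y. \<bar>w (x + y) - w x\<bar> \<partial>ivm 0 \<delta>\<bar> \<le> (\<delta> - 0) * (2 * M)" for x
        by (rule integral_ivm_bound) (use d \<delta> in auto)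
      have ib2: "\<bar>(\<integral>y. \<bar>w (x + y) - w x\<bar> \<partial>ivm 0 \<delta>) / \<delta>\<bar> \<le> 2 * M" for x
        using ib[of x] \<delta> by (simp add: abs_divide field_simps)
      have "(\<integral>x. \<bar>w x - v x\<bar> \<partial>ivm 0 1) \<le> (\<integral>x. (\<integral>y. \<bar>w (x + y) - w x\<bar> \<partial>ivm 0 \<delta>) / \<delta> \<partial>ivm 0 1)"
      proof (rule integral_ivm_mono[OF _ _ _ ib2 pt])
        show "\<bar>\<bar>w x - v x\<bar>\<bar> \<le> 2 * M" for x using pt[of x] ib2[of x] by linarith
      qed measurable
      also have "\<dots> = (\<integral>y. (\<integral>x. \<bar>w (x + y) - w x\<bar> \<partial>ivm 0 1) \<partial>ivm 0 \<delta>) / \<delta>"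
        using Fubini_ivm[of "\<lambda>x y. \<bar>w (x + y) - w x\<bar>" 0 1 0 \<delta> "2 * M"] d by simp
      also have "\<dots> \<le> (\<integral>y. e \<partial>ivm 0 \<delta>) / \<delta>"
      proof (rule divide_right_mono, rule integral_ivm_mono)
        show "\<bar>\<integral>x. \<bar>w (x + y) - w x\<bar> \<partial>ivm 0 1\<bar> \<le> 2 * M" for y by (rule integral_ivm_bound1) (use d in auto)
      qed (use tr \<delta> in auto)
      also have "\<dots> = e" using \<delta> by (simp add: measure_ivm)
      finally show ?thesis .
    qed
  qed (use M \<delta> in auto)
qed

section \<open>Convergence of the scheme\<close>

text \<open>The data enter through the initial term only, and there |u0 - c| and |v0 - c| differ by
  at most |u0 - v0| at every level. A scheme started from nearby Lipschitz data thus nearly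
  satisfies the inequality with the given data.\<close>

lemma ent_fun_initial_change:
  assumes u0: "u0 \<in> borel_measurable borel" "\<And>x. \<bar>u0 x\<bar> \<le> R" and v0: "v0 \<in> borel_measurable borel" "\<And>x. \<bar>v0 x\<bar> \<le> R"
    and td: "test_data D \<phi> \<phi>x \<phi>t"
  shows "\<bar>ent_fun T u0 v c \<phi> \<phi>x \<phi>t - ent_fun T v0 v c \<phi> \<phi>x \<phi>t\<bar> \<le> D * (\<integral>x. \<bar>u0 x - v0 x\<bar> \<partial>ivm 0 1)"
proof -
  have [measurable]: "u0 \<in> borel_measurable borel" "v0 \<in> borel_measurable borel" by fact+
  have \<phi>: "0 \<le> \<phi> x t" "\<phi> x t \<le> D" for x t using td by (auto simp: test_data_def)
  have [measurable]: "(\<lambda>x. \<phi> x 0) \<in> borel_measurable borel"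
    by (rule measurable2_compose[of \<phi>]) (use td in \<open>auto simp: test_data_def\<close>)
  have i: "integrable (ivm 0 1) (\<lambda>x. \<bar>w x - c\<bar> * \<phi> x 0)" if [measurable]: "w \<in> borel_measurable borel" and b: "\<And>x. \<bar>w x\<bar> \<le> R" for w
  proof (rule integrable_ivm[where C="(R + \<bar>c\<bar>) * D"])
    show "\<bar>\<bar>w x - c\<bar> * \<phi> x 0\<bar> \<le> (R + \<bar>c\<bar>) * D" for x
      unfolding abs_mult using b[of x] \<phi>[of x 0] by (intro mult_mono) auto
  qed measurable
  have "ent_fun T u0 v c \<phi> \<phi>x \<phi>t - ent_fun T v0 v c \<phi> \<phi>x \<phi>t = (\<integral>x. \<bar>u0 x - c\<bar> * \<phi> x 0 - \<bar>v0 x - c\<bar> * \<phi> x 0 \<partial>ivm 0 1)"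
    using i[OF u0] i[OF v0] by (simp add: ent_fun_def)
  also have "\<bar>\<dots>\<bar> \<le> (\<integral>x. \<bar>\<bar>u0 x - c\<bar> * \<phi> x 0 - \<bar>v0 x - c\<bar> * \<phi> x 0\<bar> \<partial>ivm 0 1)"
    by (rule integral_abs_bound)
  also have "\<dots> \<le> (\<integral>x. D * \<bar>u0 x - v0 x\<bar> \<partial>ivm 0 1)"
  proof (rule integral_mono)
    fix x
    have "\<bar>\<bar>u0 x - c\<bar> - \<bar>v0 x - c\<bar>\<bar> * \<phi> x 0 \<le> \<bar>u0 x - v0 x\<bar> * D"
      using \<phi>[of x 0] by (intro mult_mono) auto
    moreover have "\<bar>\<bar>u0 x - c\<bar> * \<phi> x 0 - \<bar>v0 x - c\<bar> * \<phi> x 0\<bar> = \<bar>\<bar>u0 x - c\<bar> - \<bar>v0 x - c\<bar>\<bar> * \<phi> x 0"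
      using \<phi>(1)[of x 0] by (simp add: left_diff_distrib[symmetric] abs_mult)
    ultimately show "\<bar>\<bar>u0 x - c\<bar> * \<phi> x 0 - \<bar>v0 x - c\<bar> * \<phi> x 0\<bar> \<le> D * \<bar>u0 x - v0 x\<bar>" by (simp add: mult.commute)
  next
    show "integrable (ivm 0 1) (\<lambda>x. D * \<bar>u0 x - v0 x\<bar>)"
      by (intro integrable_mult_right integrable_abs_diff[where R=R]) (use u0 v0 in auto)
  qed (use i[OF u0] i[OF v0] in auto)
  finally show ?thesis by simp
qed

lemma ex_small_step:
  fixes T A e :: real
  assumes "T > 0" "A \<ge> 0" "e > 0"
  obtains N :: nat where "N > 0" "T / real N * A \<le> e"
proof -
  obtain N :: nat where N: "T * A / e < real N" using reals_Archimedean2 by blast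
  moreover have "0 \<le> T * A / e" using assms by simp
  ultimately have "0 < real N" by linarith
  then have "N > 0" "T / real N * A \<le> e" using N assms by (auto simp: field_simps)
  then show ?thesis by (rule that)
qed

text \<open>The interface between scheme and theorem: an approximation v together with kernels
  suited to it. By the first estimate, every u that nearly satisfies the inequality against these
  kernels, at the levels taken by v, is near v; by the second, v nearly satisfies the inequality for
  all test data of size up to n. For m large, the second estimate at index m feeds the first at
  index n. The cutoff R = M + n eventually admits any bounded u, while the modulus error 4 T r^2
  \<eta> is stated with a separate bound r so that it does not grow with n. The choices are made in
  the order v0, \<epsilon>, kernels, N, which is possible because \<Lambda> does not depend on
  N.\<close>

lemma ex_approximation:
  fixes T M0 :: real and n :: nat
  defines "M \<equiv> M0 * exp (2 * FW_B * T)" and "e \<equiv> 1 / (real n + 1)"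
    and "k \<equiv> 1 / (1 + exp (2 * (FW_B + 1) * T))"
  assumes T: "T > 0" and u0: "u0 \<in> borel_measurable borel" "\<And>x. \<bar>u0 x\<bar> \<le> M0" "\<And>x. u0 (x + 1) = u0 x"
  obtains v \<Phi> \<Phi>x \<Phi>t K where
    "measurable2 v" "\<And>x t. \<bar>v x t\<bar> \<le> M"
    "\<And>y s. test_data K (\<Phi> y s) (\<Phi>x y s) (\<Phi>t y s)" "\<And>y s. FW_test_fn (\<Phi> y s)"
    "\<And>y s a t a' t'. \<bar>\<Phi>x y s a t - \<Phi>x y s a' t'\<bar> \<le> K * (\<bar>a - a'\<bar> + 2 * \<bar>t - t'\<bar>)"
    "\<And>u. measurable2 u \<Longrightarrow> (\<And>x t. \<bar>u x t\<bar> \<le> M + real n) \<Longrightarrow>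
       (\<And>y s. 0 \<le> s \<Longrightarrow> s \<le> T \<Longrightarrow> - e \<le> ent_fun T u0 u (v y s) (\<Phi> y s) (\<Phi>x y s) (\<Phi>t y s)) \<Longrightarrow>
       (\<integral>t. (\<integral>x. \<bar>u x t - v x t\<bar> \<partial>ivm 0 1) \<partial>ivm 0 T) \<le> ((2 + 3 * T) / k + 2) * e"
    "\<And>c D \<phi> \<phi>x \<phi>t \<eta> r. \<bar>c\<bar> \<le> r \<Longrightarrow> M \<le> r \<Longrightarrow> r \<le> M + real n \<Longrightarrow> D \<le> real n \<Longrightarrow> test_data D \<phi> \<phi>x \<phi>t \<Longrightarrow>
       (\<And>x y s t. \<bar>x - y\<bar> \<le> e \<Longrightarrow> \<bar>s - t\<bar> \<le> e \<Longrightarrow> \<bar>\<phi>x x s - \<phi>x y t\<bar> \<le> \<eta>) \<Longrightarrow>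
       - (e + 4 * T * r\<^sup>2 * \<eta>) \<le> ent_fun T u0 v c \<phi> \<phi>x \<phi>t"
proof -
  have e: "e > 0" "e \<le> 1" by (auto simp: e_def)
  have M0: "M0 \<ge> 0" using u0(2)[of 0] by simp
  then have M: "M \<ge> 0" by (simp add: M_def)
  have B: "FW_B \<ge> 0" by (rule FW_B_nonneg)
  define R where "R = M + real n"
  have R: "R \<ge> 0" "M \<le> R" "M0 \<le> R"
  proof -
    have "M0 * 1 \<le> M" unfolding M_def using M0 B T by (intro mult_left_mono) auto
    then show "R \<ge> 0" "M \<le> R" "M0 \<le> R" using M by (auto simp: R_def)
  qed
  \<comment> \<open>Test data have size at most n, so this L1 error of the data costs at most e/2 in
    the inequality.\<close>
  have e': "e / (2 * (real n + 1)) > 0" using e by simp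
  obtain v0 L where v0: "v0 \<in> borel_measurable borel" "\<And>x. \<bar>v0 x\<bar> \<le> M0" "\<And>x. v0 (x + 1) = v0 x" and L: "L \<ge> 0"
    "\<And>x y. \<bar>v0 x - v0 y\<bar> \<le> L * \<bar>x - y\<bar>" and uv0: "(\<integral>x. \<bar>u0 x - v0 x\<bar> \<partial>ivm 0 1) \<le> e / (2 * (real n + 1))"
    by (rule L1_lipschitz_approx[OF u0(1,2,3) e']; rule that; assumption)
  define E where "E = exp (2 * FW_B * T)"
  define \<Lambda> where "\<Lambda> = E * (L * R + FW_B * R)"
  have E: "E > 0" by (simp add: E_def)
  have \<Lambda>: "\<Lambda> \<ge> 0" using E L R B by (simp add: \<Lambda>_def)
  \<comment> \<open>Three demands: \<epsilon> < 1/2 for the periodic mollifier, R \<epsilon> <= e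
    for the last time layer, and displacements of size \<epsilon> in x and t contribute at most e/2
    to the L1 modulus.\<close>
  define \<epsilon> where "\<epsilon> = min (1 / 4) (min (e / (R + 1)) (e / (2 * (\<Lambda> + E * L + 1))))"
  have pos: "\<Lambda> + E * L + 1 > 0" using \<Lambda> E L by (simp add: add_nonneg_pos)
  have \<epsilon>: "0 < \<epsilon>" "\<epsilon> < 1 / 2" using e R pos by (auto simp: \<epsilon>_def)
  have \<epsilon>R: "R * \<epsilon> \<le> e"
  proof -
    have "\<epsilon> \<le> e / (R + 1)" by (simp add: \<epsilon>_def)
    then have "(R + 1) * \<epsilon> \<le> e" using R by (simp add: field_simps)
    then show ?thesis using \<epsilon> by (simp add: algebra_simps)
  qed
  have \<epsilon>\<Lambda>: "(\<Lambda> + E * L) * \<epsilon> \<le> e / 2"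
  proof -
    have "\<epsilon> \<le> e / (2 * (\<Lambda> + E * L + 1))" by (simp add: \<epsilon>_def)
    then have "2 * (\<Lambda> + E * L + 1) * \<epsilon> \<le> e" using pos by (simp add: field_simps)
    then show ?thesis using \<epsilon> by (simp add: algebra_simps)
  qed
  obtain D \<rho> \<rho>' \<omega> \<omega>' \<theta> \<theta>' where "smooth_kernel T D \<epsilon> k \<rho> \<rho>' \<omega> \<omega>' \<theta> \<theta>'"
    unfolding k_def by (rule ex_smooth_kernel[OF T \<epsilon>])
  then interpret sk: smooth_kernel T D \<epsilon> k \<rho> \<rho>' \<omega> \<omega>' \<theta> \<theta>' .
  have K: "sk.K \<ge> 0" by (rule sk.K_bounds)
  \<comment> \<open>Errors of the scheme per unit of h: \<open>A1\<close> for test data of size n,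
    apart from the modulus term; \<open>A2\<close> for the kernels \<Psi>, of size
    \<open>sk.K\<close> and with an x-derivative that varies by at most \<open>sk.K\<close> (R + 1)
    h.\<close>
  define A1 where "A1 = T * ((2 * R + FW_B) * real n * \<Lambda> + FW_B * R * real n)"
  define A2 where "A2 = T * (4 * R\<^sup>2 * (sk.K * (R + 1)) + (2 * R + FW_B) * sk.K * \<Lambda> + FW_B * R * sk.K)"
  have A12: "A1 \<ge> 0" "A2 \<ge> 0"
    unfolding A1_def A2_def using T R B \<Lambda> K by (auto intro!: mult_nonneg_nonneg add_nonneg_nonneg)
  \<comment> \<open>The coefficients 4 and 2 produce bounds by e/2 where the other half is already
    spent, on the displacement \<epsilon> and on the data respectively.\<close>
  obtain N :: nat where N: "N > 0" "T / real N * ((R + 1) + 4 * \<Lambda> + 2 * A1 + A2) \<le> e"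
    using ex_small_step[OF T, of "(R + 1) + 4 * \<Lambda> + 2 * A1 + A2" e] A12 R \<Lambda> e by auto
  interpret ls: lipschitz_scheme T M0 R L v0 N
    by unfold_locales (use T N v0 L R in \<open>auto simp: M_def\<close>)
  have ls_eq: "ls.E = E" "ls.\<Lambda> = \<Lambda>" "M0 * E = M" by (auto simp: ls.E_def E_def ls.\<Lambda>_def \<Lambda>_def M_def)
  have h: "ls.h > 0" by (rule ls.h)
  have hA: "ls.h * (R + 1) + 4 * (ls.h * \<Lambda>) + 2 * (ls.h * A1) + ls.h * A2 \<le> e"
    using N(2) by (simp add: ls.h_def distrib_left mult.left_commute)
  have nn: "0 \<le> ls.h * (R + 1)" "0 \<le> ls.h * \<Lambda>" "0 \<le> ls.h * A1" "0 \<le> ls.h * A2" using h R \<Lambda> A12 by auto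
  have ha: "ls.h * R + ls.h \<le> e" and hb: "2 * (ls.h * \<Lambda>) \<le> e / 2" and hc: "ls.h * A1 \<le> e / 2" and hd: "ls.h * A2 \<le> e"
    using hA nn by (auto simp: algebra_simps)
  have hR: "0 \<le> ls.h * R" using h R by simp
  have Ub: "\<bar>ls.U x t\<bar> \<le> M" for x t using ls.U_bound[of x t] by (simp add: ls_eq)
  have close: "(\<integral>t. (\<integral>x. \<bar>u x t - ls.U x t\<bar> \<partial>ivm 0 1) \<partial>ivm 0 T) \<le> ((2 + 3 * T) / k + 2) * e"
    if u: "measurable2 u" "\<And>x t. \<bar>u x t\<bar> \<le> M + real n"
      and ent: "\<And>y s. 0 \<le> s \<Longrightarrow> s \<le> T \<Longrightarrow> - e \<le> ent_fun T u0 u (ls.U y s) (sk.\<Phi> y s) (sk.\<Phi>x y s) (sk.\<Phi>t y s)" for u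
  proof -
    have wrap: "(\<integral>x. \<bar>f x - ls.U (x - z) s\<bar> \<partial>ivm 0 1) = (\<integral>x. \<bar>f x - ls.U (x - (z - 1)) s\<bar> \<partial>ivm 0 1)" for f z s
      using ls.U_periodic[of "_ - z" s] by (simp add: algebra_simps)
    \<comment> \<open>By periodicity a displacement close to 1 acts as a small negative one.\<close>
    have near: "\<exists>z'. \<bar>z'\<bar> \<le> \<epsilon> \<and> (\<forall>f s. (\<integral>x. \<bar>f x - ls.U (x - z) s\<bar> \<partial>ivm 0 1) = (\<integral>x. \<bar>f x - ls.U (x - z') s\<bar> \<partial>ivm 0 1))"
      if "0 \<le> z" "z \<le> 1" "\<rho> z \<noteq> 0" for z
      using sk.\<rho>_support[OF that]
    proof
      assume "z < \<epsilon>" then show ?thesis using that by (intro exI[of _ z]) auto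
    next
      assume "1 - \<epsilon> < z" then show ?thesis using that wrap by (intro exI[of _ "z - 1"]) auto
    qed
    have time: "- \<epsilon> < \<tau> \<and> \<tau> < 0" if "\<omega> \<tau> \<noteq> 0" for \<tau>
      using sk.\<omega>_support[of \<tau>] sk.\<omega>_support'[of \<tau>] that by linarith
    have "(\<integral>t. (\<integral>x. \<bar>u x t - ls.U x t\<bar> \<partial>ivm 0 1) \<partial>ivm 0 T)
      \<le> ((\<integral>x. \<bar>u0 x - v0 x\<bar> \<partial>ivm 0 1) + (1 + T) * e + 2 * e * T) / k + 2 * R * \<epsilon>"
    proof (rule sk.doubling_contraction[OF u(1) _ ls.U_measurable _ ls.U_periodic u0(1) _ v0(1) _ ent])
      show "\<bar>u x t\<bar> \<le> R" "\<bar>ls.U x t\<bar> \<le> R" "\<bar>u0 x\<bar> \<le> R" "\<bar>v0 x\<bar> \<le> R" for x t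
        using u(2)[of x t] Ub[of x t] R u0(2)[of x] v0(2)[of x] by (auto simp: R_def)
      show "- e \<le> ent_fun T v0 ls.U (u x t) (sk.\<Psi> x t) (sk.\<Psi>x x t) (sk.\<Psi>t x t)" for x t
      proof -
        have "- T * (4 * R\<^sup>2 * (sk.K * (ls.h * R + ls.h)) + (2 * R + FW_B) * sk.K * (ls.\<Lambda> * ls.h) + FW_B * R * sk.K * ls.h)
          \<le> ent_fun T v0 ls.U (u x t) (sk.\<Psi> x t) (sk.\<Psi>x x t) (sk.\<Psi>t x t)"
        proof (rule ls.U_weak[OF _ _ order_refl sk.\<Psi>_test_data])
          show "\<bar>u x t\<bar> \<le> R" using u(2)[of x t] by (simp add: R_def)
          show "M0 * ls.E \<le> R" using R by (simp add: ls_eq)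
          show "\<bar>sk.\<Psi>x x t a s - sk.\<Psi>x x t a' s'\<bar> \<le> sk.K * (ls.h * R + ls.h)"
            if "\<bar>a - a'\<bar> \<le> ls.h * R" "\<bar>s - s'\<bar> \<le> ls.h" for a a' s s'
            using that K by (intro order_trans[OF sk.\<Psi>x_modulus] mult_left_mono) auto
        qed
        moreover have "T * (4 * R\<^sup>2 * (sk.K * (ls.h * R + ls.h)) + (2 * R + FW_B) * sk.K * (ls.\<Lambda> * ls.h) + FW_B * R * sk.K * ls.h) = ls.h * A2"
          by (simp add: A2_def ls_eq algebra_simps)
        ultimately show ?thesis using hd by simp
      qed
      show "(\<integral>x. \<bar>ls.U x t - ls.U (x - z) s\<bar> \<partial>ivm 0 1) \<le> e"
        if ts: "0 \<le> t" "t \<le> T" "0 \<le> s" "s \<le> T" and z: "0 \<le> z" "z \<le> 1" and w: "\<omega> (t - s) \<noteq> 0" "\<rho> z \<noteq> 0" for t s z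
      proof -
        obtain z' where z': "\<bar>z'\<bar> \<le> \<epsilon>" and all: "\<forall>f s. (\<integral>x. \<bar>f x - ls.U (x - z) s\<bar> \<partial>ivm 0 1) = (\<integral>x. \<bar>f x - ls.U (x - z') s\<bar> \<partial>ivm 0 1)"
          using near[OF z w(2)] by (elim exE conjE)
        have eq: "(\<integral>x. \<bar>ls.U x t - ls.U (x - z) s\<bar> \<partial>ivm 0 1) = (\<integral>x. \<bar>ls.U x t - ls.U (x - z') s\<bar> \<partial>ivm 0 1)"
          by (rule all[rule_format])
        have "(\<integral>x. \<bar>ls.U x t - ls.U (x - z) s\<bar> \<partial>ivm 0 1) \<le> \<Lambda> * (\<bar>t - s\<bar> + ls.h) + E * L * \<bar>z'\<bar>"
          using ls.U_modulus[OF ts(3,4,1,2), of z'] unfolding eq ls_eq .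
        also have "\<dots> \<le> \<Lambda> * (\<epsilon> + 2 * ls.h) + E * L * \<epsilon>"
          using time[OF w(1)] z' \<Lambda> E L h by (intro add_mono mult_left_mono) auto
        also have "\<dots> \<le> e" using \<epsilon>\<Lambda> hb by (simp add: algebra_simps)
        finally show ?thesis .
      qed
      show "(\<integral>x. \<bar>v0 x - ls.U (x - z) s\<bar> \<partial>ivm 0 1) \<le> e"
        if s: "0 \<le> s" "s \<le> T" and z: "0 \<le> z" "z \<le> 1" and w: "\<omega> (- s) \<noteq> 0" "\<rho> z \<noteq> 0" for s z
      proof -
        obtain z' where z': "\<bar>z'\<bar> \<le> \<epsilon>" and all: "\<forall>f s. (\<integral>x. \<bar>f x - ls.U (x - z) s\<bar> \<partial>ivm 0 1) = (\<integral>x. \<bar>f x - ls.U (x - z') s\<bar> \<partial>ivm 0 1)"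
          using near[OF z w(2)] by (elim exE conjE)
        have eq: "(\<integral>x. \<bar>v0 x - ls.U (x - z) s\<bar> \<partial>ivm 0 1) = (\<integral>x. \<bar>v0 x - ls.U (x - z') s\<bar> \<partial>ivm 0 1)"
          by (rule all[rule_format])
        have "(\<integral>x. \<bar>v0 x - ls.U (x - z) s\<bar> \<partial>ivm 0 1) \<le> \<Lambda> * (s + 2 * ls.h) + E * L * \<bar>z'\<bar>"
          using ls.U_initial[OF s, of z'] unfolding eq ls_eq .
        also have "\<dots> \<le> \<Lambda> * (\<epsilon> + 2 * ls.h) + E * L * \<epsilon>"
          using time[OF w(1)] z' \<Lambda> E L h by (intro add_mono mult_left_mono) auto
        also have "\<dots> \<le> e" using \<epsilon>\<Lambda> hb by (simp add: algebra_simps)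
        finally show ?thesis .
      qed
    qed (use e in auto)
    also have "\<dots> \<le> (e + (1 + T) * e + 2 * e * T) / k + 2 * e"
    proof -
      have "e / (2 * (real n + 1)) \<le> e / 1" using e by (intro divide_left_mono) auto
      then have "(\<integral>x. \<bar>u0 x - v0 x\<bar> \<partial>ivm 0 1) \<le> e" using uv0 by simp
      then show ?thesis using \<epsilon>R sk.k(1) by (intro add_mono divide_right_mono) auto
    qed
    also have "\<dots> = ((2 + 3 * T) / k + 2) * e" by (simp add: algebra_simps add_divide_distrib)
    finally show ?thesis .
  qed
  have weak: "- (e + 4 * T * r\<^sup>2 * \<eta>) \<le> ent_fun T u0 ls.U c \<phi> \<phi>x \<phi>t"
    if c: "\<bar>c\<bar> \<le> r" and r: "M \<le> r" "r \<le> M + real n" and Dn: "D' \<le> real n" and td: "test_data D' \<phi> \<phi>x \<phi>t"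
      and modulus: "\<And>x y s t. \<bar>x - y\<bar> \<le> e \<Longrightarrow> \<bar>s - t\<bar> \<le> e \<Longrightarrow> \<bar>\<phi>x x s - \<phi>x y t\<bar> \<le> \<eta>" for c D' \<phi> \<phi>x \<phi>t \<eta> r
  proof -
    have rR: "r \<le> R" "0 \<le> r" using r M by (auto simp: R_def)
    have D': "0 \<le> D'" using td order_trans[of 0 "\<phi> 0 0" D'] by (auto simp: test_data_def)
    have hr: "ls.h * r \<le> e" "ls.h \<le> e"
    proof -
      have "ls.h * r \<le> ls.h * R" using rR h by (intro mult_left_mono) auto
      then show "ls.h * r \<le> e" "ls.h \<le> e" using ha h hR by linarith+
    qed
    have "- T * (4 * r\<^sup>2 * \<eta> + (2 * r + FW_B) * D' * (ls.\<Lambda> * ls.h) + FW_B * r * D' * ls.h) \<le> ent_fun T v0 ls.U c \<phi> \<phi>x \<phi>t"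
      by (rule ls.U_weak[OF c _ rR(1) td modulus]) (use r hr in \<open>auto simp: ls_eq\<close>)
    moreover have "T * ((2 * r + FW_B) * D' * (ls.\<Lambda> * ls.h) + FW_B * r * D' * ls.h) \<le> T * ((2 * R + FW_B) * real n * (\<Lambda> * ls.h) + FW_B * R * real n * ls.h)"
      unfolding ls_eq using T rR D' Dn \<Lambda> h B by (intro mult_left_mono add_mono mult_mono mult_right_mono) auto
    moreover have "T * ((2 * R + FW_B) * real n * (\<Lambda> * ls.h) + FW_B * R * real n * ls.h) = ls.h * A1"
      by (simp add: A1_def algebra_simps)
    moreover have "ent_fun T v0 ls.U c \<phi> \<phi>x \<phi>t - ent_fun T u0 ls.U c \<phi> \<phi>x \<phi>t \<le> e / 2"
    proof -
      have "\<bar>ent_fun T u0 ls.U c \<phi> \<phi>x \<phi>t - ent_fun T v0 ls.U c \<phi> \<phi>x \<phi>t\<bar> \<le> D' * (\<integral>x. \<bar>u0 x - v0 x\<bar> \<partial>ivm 0 1)"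
        by (rule ent_fun_initial_change[OF u0(1,2) v0(1,2) td])
      also have "\<dots> \<le> real n * (e / (2 * (real n + 1)))" using D' Dn uv0 by (intro mult_mono) auto
      also have "\<dots> \<le> e / 2" using e by (simp add: field_simps)
      finally show ?thesis by linarith
    qed
    ultimately show ?thesis using hc by (simp add: algebra_simps)
  qed
  show ?thesis
    by (rule that[OF ls.U_measurable Ub sk.\<Phi>_test_data sk.\<Phi>_test_fn sk.\<Phi>x_modulus close weak])
qed

section \<open>Existence and uniqueness\<close>

definition ent_lhs :: "real \<Rightarrow> (real \<Rightarrow> real) \<Rightarrow> (real \<Rightarrow> real \<Rightarrow> real) \<Rightarrow> real \<Rightarrow> (real \<Rightarrow> real \<Rightarrow> real) \<Rightarrow> real" where
  "ent_lhs T u0 u c \<phi> = (LINT p:({0..1} \<times> {0..T})|(lborel :: (real \<times> real) measure).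
               (let x = fst p; t = snd p in
                  \<bar>u x t - c\<bar> * deriv (\<lambda>s. \<phi> x s) t
                  + sgn (u x t - c) * ((u x t)\<^sup>2 - c\<^sup>2) / 2 * deriv (\<lambda>y. \<phi> y t) x
                  - sgn (u x t - c) * FW_conv (\<lambda>y. u y t - c) x * \<phi> x t))
            + (LINT x:{0..1}|lborel. \<bar>u0 x - c\<bar> * \<phi> x 0)"

lemma FW_entropy_solution_iff:
  "FW_entropy_solution T u0 u \<longleftrightarrow> Linf_torus_time T u \<and> (\<forall>c \<phi>. FW_test_fn \<phi> \<longrightarrow> 0 \<le> ent_lhs T u0 u c \<phi>)"
  unfolding FW_entropy_solution_def ent_lhs_def ..

lemma measurable2_lborel: "(\<lambda>p. f (fst p) (snd p)) \<in> borel_measurable (lborel :: (real \<times> real) measure) \<longleftrightarrow> measurable2 f"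
  by (simp add: borel_prod)

lemma ent_lhs_integrand:
  assumes "test_data D \<phi> \<phi>x \<phi>t"
  shows "\<bar>u x t - c\<bar> * deriv (\<lambda>s. \<phi> x s) t + sgn (u x t - c) * ((u x t)\<^sup>2 - c\<^sup>2) / 2 * deriv (\<lambda>y. \<phi> y t) x
      - sgn (u x t - c) * FW_conv (\<lambda>y. u y t - c) x * \<phi> x t
    = \<bar>u x t - c\<bar> * \<phi>t x t + kflux (u x t) c * \<phi>x x t - sgn (u x t - c) * FW_conv (\<lambda>y. u y t - c) x * \<phi> x t"
proof -
  have "deriv (\<lambda>s. \<phi> x s) t = \<phi>t x t" "deriv (\<lambda>y. \<phi> y t) x = \<phi>x x t"
    using assms by (auto simp: test_data_def intro!: DERIV_imp_deriv)
  then show ?thesis by (simp add: kflux_def)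
qed

lemma ent_lhs_eq_ent_fun:
  assumes u: "measurable2 u" "\<And>x t. \<bar>u x t\<bar> \<le> R" and u0: "u0 \<in> borel_measurable borel" and td: "test_data D \<phi> \<phi>x \<phi>t"
  shows "ent_lhs T u0 u c \<phi> = ent_fun T u0 u c \<phi> \<phi>x \<phi>t"
proof -
  have "measurable2 \<phi>" using td by (simp add: test_data_def)
  then have "(\<lambda>x. \<phi> x 0) \<in> borel_measurable borel" by (rule measurable2_compose) auto
  then have init: "(\<lambda>x. \<bar>u0 x - c\<bar> * \<phi> x 0) \<in> borel_measurable borel" using u0 by measurable
  have us: "(\<lambda>y. u y t) \<in> borel_measurable borel" for t by (rule measurable2_compose[OF u(1)]) auto
  have "FW_conv (\<lambda>y. u y t - c) x = FW_conv (\<lambda>y. u y t) x" for x t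
    by (rule FW_conv_diff_const[OF us u(2)])
  then show ?thesis
    unfolding ent_lhs_def ent_fun_def Let_def ent_lhs_integrand[OF td] integral_ivm[OF init]
      integral_pair_ivm[OF ent_int_measurable[OF u(1) td]]
    by (simp only: ent_int_def)
qed

lemma periodic_compact_bounded:
  fixes g :: "real \<Rightarrow> real \<Rightarrow> real"
  assumes c: "continuous_on UNIV (\<lambda>p. g (fst p) (snd p))" and per: "\<And>x t. g (x + 1) t = g x t"
    and z: "\<And>x t. r < \<bar>t\<bar> \<Longrightarrow> g x t = 0"
  shows "\<exists>C\<ge>0. \<forall>x t. \<bar>g x t\<bar> \<le> C"
proof -
  have "bounded ((\<lambda>p. g (fst p) (snd p)) ` ({0..1} \<times> {-r..r}))"
    by (intro compact_imp_bounded compact_continuous_image continuous_on_subset[OF c] compact_Times) auto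
  then obtain C where C: "\<And>x t. x \<in> {0..1} \<Longrightarrow> t \<in> {-r..r} \<Longrightarrow> \<bar>g x t\<bar> \<le> C"
    by (fastforce simp: bounded_iff)
  have "\<bar>g x t\<bar> \<le> max C 0" for x t
  proof (cases "r < \<bar>t\<bar>")
    case False
    have "g x t = g (frac x) t"
      using periodic_int[of "\<lambda>x. g x t" "frac x" "\<lfloor>x\<rfloor>"] per by (simp add: frac_def)
    moreover have "frac x \<in> {0..1}" using frac_lt_1[of x] by (simp add: less_imp_le)
    ultimately show ?thesis using C[of "frac x" t] False by (force intro: max.coboundedI1)
  qed (simp add: z)
  then show ?thesis by (intro exI[of _ "max C 0"]) auto
qed

text \<open>A C^1 function that is periodic in x and supported in |t| <= r is governed by a compact
  box. For the uniform modulus of \<phi>x both points are shifted by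
  \<open>\<lfloor>x\<rfloor>\<close>, and the box is enlarged by one on each side so that the
  neighbouring point stays inside.\<close>

lemma FW_test_fn_data:
  assumes "FW_test_fn \<phi>"
  obtains D \<phi>x \<phi>t where "test_data D \<phi> \<phi>x \<phi>t"
    "\<And>\<eta>. \<eta> > 0 \<Longrightarrow> \<exists>d>0. \<forall>x y s t. \<bar>x - y\<bar> \<le> d \<longrightarrow> \<bar>s - t\<bar> \<le> d \<longrightarrow> \<bar>\<phi>x x s - \<phi>x y t\<bar> \<le> \<eta>"
proof -
  have nn: "\<And>x t. 0 \<le> \<phi> x t" and per: "\<And>x t. \<phi> (x + 1) t = \<phi> x t"
    using assms by (auto simp: FW_test_fn_def)
  obtain r0 where r0: "\<And>x t. r0 < \<bar>t\<bar> \<Longrightarrow> \<phi> x t = 0" using assms by (auto simp: FW_test_fn_def)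
  define r where "r = max r0 0"
  have r: "\<And>x t. r < \<bar>t\<bar> \<Longrightarrow> \<phi> x t = 0" "r \<ge> 0" using r0 by (auto simp: r_def)
  obtain \<phi>x \<phi>t where hd: "\<And>x t. ((\<lambda>p. \<phi> (fst p) (snd p)) has_derivative (\<lambda>h. \<phi>x x t * fst h + \<phi>t x t * snd h)) (at (x, t))"
    and cx: "continuous_on UNIV (\<lambda>p. \<phi>x (fst p) (snd p))" and ct: "continuous_on UNIV (\<lambda>p. \<phi>t (fst p) (snd p))"
    using assms unfolding FW_test_fn_def by blast
  have dx: "((\<lambda>x. \<phi> x t) has_real_derivative \<phi>x x t) (at x)" for x t
  proof -
    have "((\<lambda>x. (x, t)) has_derivative (\<lambda>h. (h, 0))) (at x)" by (auto intro!: derivative_eq_intros)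
    from has_derivative_compose[OF this hd] show ?thesis by (simp add: has_field_derivative_def)
  qed
  have dt: "((\<lambda>t. \<phi> x t) has_real_derivative \<phi>t x t) (at t)" for x t
  proof -
    have "((\<lambda>t. (x, t)) has_derivative (\<lambda>h. (0, h))) (at t)" by (auto intro!: derivative_eq_intros)
    from has_derivative_compose[OF this hd] show ?thesis by (simp add: has_field_derivative_def)
  qed
  have c: "continuous_on UNIV (\<lambda>p. \<phi> (fst p) (snd p))"
  proof (rule continuous_at_imp_continuous_on, rule ballI)
    fix p :: "real \<times> real"
    show "isCont (\<lambda>p. \<phi> (fst p) (snd p)) p" using has_derivative_continuous[OF hd[of "fst p" "snd p"]] by simp
  qed
  have perx: "\<phi>x (x + 1) t = \<phi>x x t" for x t
  proof -
    have "((\<lambda>y. \<phi> (y + 1) t) has_real_derivative \<phi>x (x + 1) t) (at x)"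
      using dx[of t "x + 1"] by (simp add: DERIV_shift)
    then show ?thesis unfolding per using dx DERIV_unique by blast
  qed
  have pert: "\<phi>t (x + 1) t = \<phi>t x t" for x t
    using dt[of "x + 1" t] dt[of x t] unfolding per by (rule DERIV_unique)
  have zx: "\<phi>x x t = 0" if "r < \<bar>t\<bar>" for x t
  proof -
    have "(\<lambda>x. \<phi> x t) = (\<lambda>_. 0)" using r that by auto
    then show ?thesis using dx[of t x] DERIV_unique DERIV_const by metis
  qed
  have zt: "\<phi>t x t = 0" if "r < \<bar>t\<bar>" for x t
  proof (rule DERIV_local_const[OF dt, of "\<bar>t\<bar> - r"])
    show "0 < \<bar>t\<bar> - r" using that by simp
    show "\<forall>y. \<bar>t - y\<bar> < \<bar>t\<bar> - r \<longrightarrow> \<phi> x t = \<phi> x y"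
    proof (intro allI impI)
      fix y assume "\<bar>t - y\<bar> < \<bar>t\<bar> - r"
      then have "r < \<bar>y\<bar>" by linarith
      then show "\<phi> x t = \<phi> x y" using r(1)[of y x] r(1)[of t x] that by simp
    qed
  qed
  obtain C1 C2 C3 where C: "\<And>x t. \<bar>\<phi> x t\<bar> \<le> C1" "\<And>x t. \<bar>\<phi>x x t\<bar> \<le> C2" "\<And>x t. \<bar>\<phi>t x t\<bar> \<le> C3" "0 \<le> C1" "0 \<le> C2" "0 \<le> C3"
    using periodic_compact_bounded[OF c per r(1)] periodic_compact_bounded[OF cx perx zx] periodic_compact_bounded[OF ct pert zt] by blast
  show ?thesis
  proof (rule that)
    show "test_data (C1 + C2 + C3) \<phi> \<phi>x \<phi>t"
      unfolding test_data_def
    proof (intro conjI allI)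
      show "measurable2 \<phi>" "measurable2 \<phi>x" "measurable2 \<phi>t"
        unfolding borel_prod using c cx ct by (auto intro!: borel_measurable_continuous_onI)
      show "continuous_on UNIV (\<phi>t x)" for x
        using continuous_on_compose2[OF ct, of UNIV "\<lambda>t. (x, t)"] by (simp add: continuous_on_Pair)
      fix x t
      show "\<phi> x t \<le> C1 + C2 + C3" "\<bar>\<phi>x x t\<bar> \<le> C1 + C2 + C3" "\<bar>\<phi>t x t\<bar> \<le> C1 + C2 + C3"
        using C(1)[of x t] C(2)[of x t] C(3)[of x t] C(4-6) by linarith+
    qed (use nn per dx dt in auto)
    fix \<eta> :: real assume \<eta>: "\<eta> > 0"
    let ?S = "{-1..2} \<times> {-r-1..r+1}"
    have "uniformly_continuous_on ?S (\<lambda>p. \<phi>x (fst p) (snd p))"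
      by (intro compact_uniformly_continuous continuous_on_subset[OF cx] compact_Times) auto
    then obtain d where d: "d > 0" "\<And>p q. p \<in> ?S \<Longrightarrow> q \<in> ?S \<Longrightarrow> dist q p < d \<Longrightarrow> dist (\<phi>x (fst q) (snd q)) (\<phi>x (fst p) (snd p)) < \<eta>"
      unfolding uniformly_continuous_on_def using \<eta> by metis
    show "\<exists>d>0. \<forall>x y s t. \<bar>x - y\<bar> \<le> d \<longrightarrow> \<bar>s - t\<bar> \<le> d \<longrightarrow> \<bar>\<phi>x x s - \<phi>x y t\<bar> \<le> \<eta>"
    proof (intro exI[of _ "min (1 / 2) (d / 3)"] conjI allI impI)
      show "0 < min (1 / 2) (d / 3)" using d by simp
      fix x y s t assume "\<bar>x - y\<bar> \<le> min (1 / 2) (d / 3)" and "\<bar>s - t\<bar> \<le> min (1 / 2) (d / 3)"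
      then have xy: "\<bar>x - y\<bar> \<le> 1 / 2" "\<bar>x - y\<bar> \<le> d / 3" and st: "\<bar>s - t\<bar> \<le> 1 / 2" "\<bar>s - t\<bar> \<le> d / 3" by auto
      show "\<bar>\<phi>x x s - \<phi>x y t\<bar> \<le> \<eta>"
      proof (cases "r < \<bar>s\<bar> \<and> r < \<bar>t\<bar>")
        case True then show ?thesis using zx \<eta> by simp
      next
        case False
        define k where "k = \<lfloor>x\<rfloor>"
        have "\<phi>x x s = \<phi>x (x - k) s" "\<phi>x y t = \<phi>x (y - k) t"
          using periodic_int[of "\<lambda>x. \<phi>x x s" "x - k" k] periodic_int[of "\<lambda>x. \<phi>x x t" "y - k" k] perx by auto
        moreover have "dist (\<phi>x (fst (x - k, s)) (snd (x - k, s))) (\<phi>x (fst (y - k, t)) (snd (y - k, t))) < \<eta>"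
        proof (rule d(2))
          have k: "0 \<le> x - k" "x - k < 1" unfolding k_def by linarith+
          have "\<bar>s\<bar> \<le> r + 1" "\<bar>t\<bar> \<le> r + 1" using False st by linarith+
          moreover have "- 1 \<le> y - k" "y - k \<le> 2" using k xy(1) by linarith+
          ultimately show "(y - k, t) \<in> ?S" "(x - k, s) \<in> ?S" using k by (auto simp: abs_le_iff)
          have "dist (x - real_of_int k, s) (y - real_of_int k, t) \<le> \<bar>x - y\<bar> + \<bar>s - t\<bar>"
            using sqrt_sum_squares_le_sum_abs[of "x - y" "s - t"] by (simp add: dist_Pair_Pair dist_real_def)
          then show "dist (x - real_of_int k, s) (y - real_of_int k, t) < d" using xy st d(1) by linarith
        qed
        ultimately show ?thesis by (simp add: dist_real_def)
      qed
    qed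
  qed
qed

section \<open>Bounded Borel representatives\<close>

lemma AE_snd_ivm:
  assumes "AE t in ivm c d. P t"
  shows "AE p in ivm a b \<Otimes>\<^sub>M ivm c d. P (snd p)"
proof -
  obtain N where N: "{t \<in> space (ivm c d). \<not> P t} \<subseteq> N" "emeasure (ivm c d) N = 0" "N \<in> sets (ivm c d)"
    using AE_E[OF assms] by metis
  show ?thesis
  proof (rule AE_I[of _ _ "UNIV \<times> N"])
    show "{p \<in> space (ivm a b \<Otimes>\<^sub>M ivm c d). \<not> P (snd p)} \<subseteq> UNIV \<times> N" using N(1) by auto
    have "emeasure (ivm a b \<Otimes>\<^sub>M ivm c d) (UNIV \<times> N) = emeasure (ivm a b) UNIV * emeasure (ivm c d) N"
      by (rule ivm.emeasure_pair_measure_Times) (use N(3) in auto)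
    then show "emeasure (ivm a b \<Otimes>\<^sub>M ivm c d) (UNIV \<times> N) = 0" using N(2) by simp
    show "UNIV \<times> N \<in> sets (ivm a b \<Otimes>\<^sub>M ivm c d)" using N(3) by (intro pair_measureI) auto
  qed
qed

text \<open>\<open>Linf_torus\<close> constrains u0 on [0, 1] only, with a bound up to null sets.
  The representative is Borel, bounded everywhere and periodic, as the scheme demands;
  \<open>frac\<close> overrides the value at 1, a null set.\<close>

lemma clean_initial:
  assumes "Linf_torus u0"
  obtains w M where "w \<in> borel_measurable borel" "\<And>x. \<bar>w x\<bar> \<le> M" "\<And>x. w (x + 1) = w x" "AE x in ivm 0 1. w x = u0 x"
proof -
  obtain M where M: "AE x in lborel. x \<in> {0..1} \<longrightarrow> \<bar>u0 x\<bar> \<le> M" and m: "(\<lambda>x. indicator {0..1} x *\<^sub>R u0 x) \<in> borel_measurable lborel"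
    using assms unfolding Linf_torus_def set_borel_measurable_def by blast
  define g where "g x = indicator {0..1} x *\<^sub>R u0 x" for x
  have [measurable]: "g \<in> borel_measurable borel" using m by (simp add: g_def[abs_def])
  define w where "w x = (if \<bar>g (frac x)\<bar> \<le> \<bar>M\<bar> then g (frac x) else 0)" for x
  have [measurable]: "(frac :: real \<Rightarrow> real) \<in> borel_measurable borel" unfolding frac_def[abs_def] by measurable
  have "AE x in lborel. x \<noteq> (1::real)" by (rule AE_lborel_singleton)
  with M have "AE x in lborel. x \<in> {0..1} \<longrightarrow> w x = u0 x"
  proof eventually_elim
    case (elim x)
    show ?case
    proof
      assume x: "x \<in> {0..1}"
      then have "frac x = x" using elim by (simp add: frac_eq)
      then show "w x = u0 x" using elim x by (auto simp: w_def g_def)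
    qed
  qed
  moreover have "w \<in> borel_measurable borel" unfolding w_def by measurable
  moreover have "\<bar>w x\<bar> \<le> \<bar>M\<bar>" "w (x + 1) = w x" for x by (auto simp: w_def frac_1_eq)
  ultimately show ?thesis by (intro that[of w "\<bar>M\<bar>"]) (auto simp: AE_ivm_iff)
qed

lemma initial_integral_cong:
  assumes "Linf_torus u0" and [measurable]: "w \<in> borel_measurable borel" and ae: "AE x in ivm 0 1. w x = u0 x"
    and [measurable]: "\<psi> \<in> borel_measurable borel"
  shows "(LINT x:{0..1}|lborel. \<bar>u0 x - c\<bar> * \<psi> x) = (LINT x:{0..1}|lborel. \<bar>w x - c\<bar> * \<psi> x)"
proof -
  have [measurable]: "(\<lambda>x. indicator {0..1} x *\<^sub>R u0 x) \<in> borel_measurable lborel"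
    using assms(1) unfolding Linf_torus_def set_borel_measurable_def by blast
  have "(LINT x:{0..1}|lborel. \<bar>u0 x - c\<bar> * \<psi> x) = (LINT x:{0..1}|lborel. \<bar>indicator {0..1} x *\<^sub>R u0 x - c\<bar> * \<psi> x)"
    by (rule set_lebesgue_integral_cong) auto
  also have "\<dots> = (LINT x:{0..1}|lborel. \<bar>w x - c\<bar> * \<psi> x)"
    unfolding set_lebesgue_integral_def
  proof (rule integral_cong_AE)
    show "AE x in lborel. indicat_real {0..1} x *\<^sub>R (\<bar>indicator {0..1} x *\<^sub>R u0 x - c\<bar> * \<psi> x) = indicat_real {0..1} x *\<^sub>R (\<bar>w x - c\<bar> * \<psi> x)"
      using ae unfolding AE_ivm_iff by eventually_elim (auto simp: indicator_def)
  qed measurable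
  finally show ?thesis .
qed

text \<open>The convolution reads a whole time slice, so a null set of the plane has to be sliced:
  for almost every time it is a null set in x and leaves the source unchanged. The intermediate g
  agrees with u at every point of the box, hence in every relevant slice; only the removal of values
  beyond the bound alters anything.\<close>

lemma clean_solution:
  assumes sol: "FW_entropy_solution T u0 u" and u0: "Linf_torus u0" and w: "w \<in> borel_measurable borel" "AE x in ivm 0 1. w x = u0 x"
  obtains u' R where "measurable2 u'" "\<And>x t. \<bar>u' x t\<bar> \<le> R" "AE p in ivm 0 1 \<Otimes>\<^sub>M ivm 0 T. u' (fst p) (snd p) = u (fst p) (snd p)"
    "\<And>c D \<phi> \<phi>x \<phi>t. FW_test_fn \<phi> \<Longrightarrow> test_data D \<phi> \<phi>x \<phi>t \<Longrightarrow> 0 \<le> ent_fun T w u' c \<phi> \<phi>x \<phi>t"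
proof -
  let ?\<Omega> = "{0..1} \<times> {0..T} :: (real \<times> real) set"
  obtain M where M: "AE p in (lborel :: (real \<times> real) measure). p \<in> ?\<Omega> \<longrightarrow> \<bar>u (fst p) (snd p)\<bar> \<le> M"
    and m: "(\<lambda>p. indicator ?\<Omega> p *\<^sub>R u (fst p) (snd p)) \<in> borel_measurable (lborel :: (real \<times> real) measure)"
    using sol unfolding FW_entropy_solution_def Linf_torus_time_def set_borel_measurable_def by blast
  define g where "g x t = indicator ?\<Omega> (x, t) *\<^sub>R u x t" for x t
  have gm[measurable]: "measurable2 g" using m measurable2_lborel[of g] by (simp add: g_def)
  define u' where "u' x t = (if \<bar>g x t\<bar> \<le> \<bar>M\<bar> then g x t else 0)" for x t
  have um[measurable]: "measurable2 u'" unfolding u'_def by measurable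
  have ub: "\<bar>u' x t\<bar> \<le> \<bar>M\<bar>" for x t by (auto simp: u'_def)
  have g_eq: "g x t = u x t" if "(x, t) \<in> ?\<Omega>" for x t using that by (simp add: g_def)
  have ae: "AE p in ivm 0 1 \<Otimes>\<^sub>M ivm 0 T. u' (fst p) (snd p) = g (fst p) (snd p)"
    unfolding AE_pair_ivm_iff using M by eventually_elim (auto simp: u'_def g_eq)
  have ae': "AE p in ivm 0 1 \<Otimes>\<^sub>M ivm 0 T. u' (fst p) (snd p) = u (fst p) (snd p)"
    using ae unfolding AE_pair_ivm_iff by eventually_elim (auto simp: g_eq)
  have "AE t in ivm 0 T. AE y in ivm 0 1. u' y t = g y t"
  proof -
    have "{x \<in> space (ivm 0 1 \<Otimes>\<^sub>M ivm 0 T). u' (fst x) (snd x) = g (fst x) (snd x)} \<in> sets (ivm 0 1 \<Otimes>\<^sub>M ivm 0 T)"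
      by measurable
    from ivm2.AE_commute[OF this] show ?thesis using ivm2.AE_pair[OF ae] by simp
  qed
  \<comment> \<open>The quantifiers stand inside, since the exceptional set of times must not depend
    on x.\<close>
  then have "AE t in ivm 0 T. \<forall>x c. FW_conv (\<lambda>y. g y t - c) x = FW_conv (\<lambda>y. u' y t - c) x"
  proof eventually_elim
    case (elim t)
    have [measurable]: "(\<lambda>y. g y t) \<in> borel_measurable borel" "(\<lambda>y. u' y t) \<in> borel_measurable borel"
      by (rule measurable2_compose[OF gm] measurable2_compose[OF um]; simp)+
    show ?case
    proof (intro allI)
      fix x c
      have "(\<integral>y. FW_Kp (x - y) * (g y t - c) \<partial>ivm 0 1) = (\<integral>y. FW_Kp (x - y) * (u' y t - c) \<partial>ivm 0 1)"
        by (rule integral_cong_AE) (use elim in auto)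
      then show "FW_conv (\<lambda>y. g y t - c) x = FW_conv (\<lambda>y. u' y t - c) x" by (simp add: FW_conv_eq)
    qed
  qed
  from AE_snd_ivm[OF this]
  have aec: "AE p in ivm 0 1 \<Otimes>\<^sub>M ivm 0 T. \<forall>x c. FW_conv (\<lambda>y. g y (snd p) - c) x = FW_conv (\<lambda>y. u' y (snd p) - c) x" .
  have "0 \<le> ent_fun T w u' c \<phi> \<phi>x \<phi>t" if tf: "FW_test_fn \<phi>" and td: "test_data D \<phi> \<phi>x \<phi>t" for c D \<phi> \<phi>x \<phi>t
  proof -
    have tm[measurable]: "measurable2 \<phi>" "measurable2 \<phi>x" "measurable2 \<phi>t" using td by (auto simp: test_data_def)
    let ?I = "\<lambda>u x t. \<bar>u x t - c\<bar> * \<phi>t x t + kflux (u x t) c * \<phi>x x t - sgn (u x t - c) * FW_conv (\<lambda>y. u y t - c) x * \<phi> x t"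
    have Im: "measurable2 (?I v)" if [measurable]: "measurable2 v" for v
    proof -
      have "measurable2 (\<lambda>x t. v x t - c)" by measurable
      from FW_conv_measurable2[OF this] show ?thesis by measurable
    qed
    have "(LINT p:?\<Omega>|lborel. ?I u (fst p) (snd p)) = (LINT p:?\<Omega>|lborel. ?I g (fst p) (snd p))"
    proof (rule set_lebesgue_integral_cong)
      show "\<forall>p. p \<in> ?\<Omega> \<longrightarrow> ?I u (fst p) (snd p) = ?I g (fst p) (snd p)"
      proof (intro allI impI)
        fix p assume p: "p \<in> ?\<Omega>"
        have "FW_conv (\<lambda>y. u y (snd p) - c) x = FW_conv (\<lambda>y. g y (snd p) - c) x" for x
          unfolding FW_conv_def by (rule set_lebesgue_integral_cong) (use p g_eq in auto)
        then show "?I u (fst p) (snd p) = ?I g (fst p) (snd p)" using g_eq[of "fst p" "snd p"] p by simp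
      qed
    qed simp
    also have "\<dots> = (\<integral>p. ?I g (fst p) (snd p) \<partial>(ivm 0 1 \<Otimes>\<^sub>M ivm 0 T))" by (rule integral_pair_ivm[OF Im[OF gm], symmetric])
    also have "\<dots> = (\<integral>p. ?I u' (fst p) (snd p) \<partial>(ivm 0 1 \<Otimes>\<^sub>M ivm 0 T))"
    proof (rule integral_cong_AE)
      show "AE p in ivm 0 1 \<Otimes>\<^sub>M ivm 0 T. ?I g (fst p) (snd p) = ?I u' (fst p) (snd p)"
        using ae aec by eventually_elim simp
    qed (use Im[OF gm] Im[OF um] in simp_all)
    also have "\<dots> = (LINT p:?\<Omega>|lborel. ?I u' (fst p) (snd p))" by (rule integral_pair_ivm[OF Im[OF um]])
    finally have "ent_lhs T u0 u c \<phi> = ent_lhs T w u' c \<phi>"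
      unfolding ent_lhs_def Let_def ent_lhs_integrand[OF td]
      using initial_integral_cong[OF u0 w, of "\<lambda>x. \<phi> x 0" c] measurable2_compose[OF tm(1), of "\<lambda>x. x" borel "\<lambda>_. 0"] by simp
    moreover have "0 \<le> ent_lhs T u0 u c \<phi>" using sol tf by (simp add: FW_entropy_solution_iff)
    ultimately show ?thesis using ent_lhs_eq_ent_fun[OF um ub w(1) td] by simp
  qed
  with um ub ae' show ?thesis by (rule that)
qed

section \<open>Passing to the limit in the entropy inequality\<close>

text \<open>Entropy, flux and source are Lipschitz in L1 with constants 1, 2 r and
  \<open>FW_B\<close>. The sign is not, and its variation is kept as a separate term: it tends to 0
  along an almost everywhere convergent sequence whose limit avoids the level c.\<close>

lemma ent_fun_diff:
  assumes u: "measurable2 u" "\<And>x t. \<bar>u x t\<bar> \<le> r" and v: "measurable2 v" "\<And>x t. \<bar>v x t\<bar> \<le> r" and c: "\<bar>c\<bar> \<le> r"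
    and td: "test_data D \<phi> \<phi>x \<phi>t"
  shows "\<bar>ent_fun T u0 v c \<phi> \<phi>x \<phi>t - ent_fun T u0 u c \<phi> \<phi>x \<phi>t\<bar>
    \<le> D * (1 + 2 * r + FW_B) * (\<integral>p. \<bar>v (fst p) (snd p) - u (fst p) (snd p)\<bar> \<partial>(ivm 0 1 \<Otimes>\<^sub>M ivm 0 T))
      + D * (FW_B * r) * (\<integral>p. \<bar>sgn (v (fst p) (snd p) - c) - sgn (u (fst p) (snd p) - c)\<bar> \<partial>(ivm 0 1 \<Otimes>\<^sub>M ivm 0 T))"
proof -
  let ?Q = "ivm 0 1 \<Otimes>\<^sub>M ivm 0 T"
  have r: "r \<ge> 0" using c by simp
  have \<phi>: "0 \<le> \<phi> x t" "\<phi> x t \<le> D" "\<bar>\<phi>x x t\<bar> \<le> D" "\<bar>\<phi>t x t\<bar> \<le> D" for x t using td by (auto simp: test_data_def)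
  have D: "D \<ge> 0" using \<phi>[of 0 0] by linarith
  note [measurable (raw)] = measurable2_compose[OF u(1)] measurable2_compose[OF v(1)]
  have us: "(\<lambda>y. u y t) \<in> borel_measurable borel" "(\<lambda>y. v y t) \<in> borel_measurable borel" for t by measurable
  define d where "d t = (\<integral>y. \<bar>v y t - u y t\<bar> \<partial>ivm 0 1)" for t
  have [measurable]: "d \<in> borel_measurable borel" unfolding d_def by measurable
  have vu: "\<bar>\<bar>v x t - u x t\<bar>\<bar> \<le> 2 * r" for x t using u(2)[of x t] v(2)[of x t] by linarith
  have db: "\<bar>d t\<bar> \<le> 2 * r" for t unfolding d_def by (rule integral_ivm_bound1[OF _ vu]) measurable
  let ?\<Delta> = "\<lambda>p. \<bar>v (fst p) (snd p) - u (fst p) (snd p)\<bar>"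
  let ?S = "\<lambda>p. \<bar>sgn (v (fst p) (snd p) - c) - sgn (u (fst p) (snd p) - c)\<bar>"
  have i\<Delta>: "integrable ?Q ?\<Delta>" by (rule integrable_pair_ivm[where C="2 * r"]) (use vu in auto)
  have iS: "integrable ?Q ?S" by (rule integrable_pair_ivm[where C=2]) (auto simp: sgn_real_def)
  have id: "integrable ?Q (\<lambda>p. d (snd p))" by (rule integrable_pair_ivm[where C="2 * r"]) (use db in auto)
  have int_d: "(\<integral>p. d (snd p) \<partial>?Q) = (\<integral>p. ?\<Delta> p \<partial>?Q)"
  proof -
    have "(\<integral>p. d (snd p) \<partial>?Q) = (\<integral>t. d t \<partial>ivm 0 T)"
      using integral_pair_ivm_iterated(2)[of "\<lambda>p. d (snd p)" 0 1 0 T "2 * r"] db by (simp add: measure_ivm)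
    also have "\<dots> = (\<integral>p. ?\<Delta> p \<partial>?Q)"
      unfolding d_def using integral_pair_ivm_iterated(2)[of ?\<Delta> 0 1 0 T "2 * r"] vu by simp
    finally show ?thesis .
  qed
  have iE: "integrable ?Q (\<lambda>p. ent_int w c \<phi> \<phi>x \<phi>t (fst p) (snd p))" if "measurable2 w" "\<And>x t. \<bar>w x t\<bar> \<le> r" for w
    by (rule integrable_pair_ivm[where C="(2 * r + 2 * r\<^sup>2 + FW_B * r) * D"])
       (use ent_int_measurable[OF that(1) td] ent_int_bound[OF that c td] in auto)
  have "ent_fun T u0 v c \<phi> \<phi>x \<phi>t - ent_fun T u0 u c \<phi> \<phi>x \<phi>t
     = (\<integral>p. ent_int v c \<phi> \<phi>x \<phi>t (fst p) (snd p) - ent_int u c \<phi> \<phi>x \<phi>t (fst p) (snd p) \<partial>?Q)"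
    unfolding ent_fun_def using iE[OF u] iE[OF v] by simp
  then have "\<bar>ent_fun T u0 v c \<phi> \<phi>x \<phi>t - ent_fun T u0 u c \<phi> \<phi>x \<phi>t\<bar>
     \<le> (\<integral>p. \<bar>ent_int v c \<phi> \<phi>x \<phi>t (fst p) (snd p) - ent_int u c \<phi> \<phi>x \<phi>t (fst p) (snd p)\<bar> \<partial>?Q)"
    by (simp only: integral_abs_bound)
  also have "\<dots> \<le> (\<integral>p. D * (1 + 2 * r) * ?\<Delta> p + D * FW_B * d (snd p) + D * (FW_B * r) * ?S p \<partial>?Q)"
  proof (rule integral_mono)
    fix p :: "real \<times> real"
    obtain x t where p: "p = (x, t)" by (cases p)
    let ?cv = "FW_conv (\<lambda>y. v y t) x" and ?cu = "FW_conv (\<lambda>y. u y t) x"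
    have mb: "\<bar>a * b\<bar> \<le> A * B" if "\<bar>a\<bar> \<le> A" "\<bar>b\<bar> \<le> B" for a b A B :: real
      using that unfolding abs_mult by (intro mult_mono) auto
    have 1: "\<bar>(\<bar>v x t - c\<bar> - \<bar>u x t - c\<bar>) * \<phi>t x t\<bar> \<le> \<bar>v x t - u x t\<bar> * D" by (rule mb[OF _ \<phi>(4)]) linarith
    have 2: "\<bar>(kflux (v x t) c - kflux (u x t) c) * \<phi>x x t\<bar> \<le> (2 * r * \<bar>v x t - u x t\<bar>) * D"
      by (rule mb[OF kflux_lipschitz[OF v(2) u(2) c] \<phi>(3)])
    have \<phi>a: "\<bar>\<phi> x t\<bar> \<le> D" using \<phi>[of x t] by simp
    have "\<bar>?cv - ?cu\<bar> \<le> FW_B * d t" unfolding d_def by (rule FW_conv_diff_bound[OF us(2,1) v(2) u(2)])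
    then have "\<bar>sgn (v x t - c) * (?cv - ?cu)\<bar> \<le> 1 * (FW_B * d t)" by (intro mb) (auto simp: sgn_real_def)
    from mb[OF this \<phi>a] have 3: "\<bar>sgn (v x t - c) * (?cv - ?cu) * \<phi> x t\<bar> \<le> FW_B * d t * D" by simp
    have 4: "\<bar>(sgn (v x t - c) - sgn (u x t - c)) * ?cu * \<phi> x t\<bar> \<le> \<bar>sgn (v x t - c) - sgn (u x t - c)\<bar> * (FW_B * r) * D"
      by (intro mb \<phi>a order_refl FW_conv_bound[OF us(1) u(2)])
    have "ent_int v c \<phi> \<phi>x \<phi>t x t - ent_int u c \<phi> \<phi>x \<phi>t x t = (\<bar>v x t - c\<bar> - \<bar>u x t - c\<bar>) * \<phi>t x t
       + (kflux (v x t) c - kflux (u x t) c) * \<phi>x x t - sgn (v x t - c) * (?cv - ?cu) * \<phi> x t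
       - (sgn (v x t - c) - sgn (u x t - c)) * ?cu * \<phi> x t"
      unfolding ent_int_def by (simp add: algebra_simps)
    then have "\<bar>ent_int v c \<phi> \<phi>x \<phi>t x t - ent_int u c \<phi> \<phi>x \<phi>t x t\<bar> \<le> \<bar>v x t - u x t\<bar> * D + (2 * r * \<bar>v x t - u x t\<bar>) * D
        + FW_B * d t * D + \<bar>sgn (v x t - c) - sgn (u x t - c)\<bar> * (FW_B * r) * D"
      using 1 2 3 4 by linarith
    then show "\<bar>ent_int v c \<phi> \<phi>x \<phi>t (fst p) (snd p) - ent_int u c \<phi> \<phi>x \<phi>t (fst p) (snd p)\<bar>
        \<le> D * (1 + 2 * r) * ?\<Delta> p + D * FW_B * d (snd p) + D * (FW_B * r) * ?S p"
      by (simp add: p algebra_simps)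
  qed (use i\<Delta> iS id iE[OF u] iE[OF v] in auto)
  also have "\<dots> = D * (1 + 2 * r) * (\<integral>p. ?\<Delta> p \<partial>?Q) + D * FW_B * (\<integral>p. d (snd p) \<partial>?Q) + D * (FW_B * r) * (\<integral>p. ?S p \<partial>?Q)"
    using i\<Delta> iS id by simp
  also have "\<dots> = D * (1 + 2 * r + FW_B) * (\<integral>p. ?\<Delta> p \<partial>?Q) + D * (FW_B * r) * (\<integral>p. ?S p \<partial>?Q)"
    unfolding int_d by (simp add: algebra_simps)
  finally show ?thesis .
qed

text \<open>For all but countably many \<open>c\<close> the level set \<open>u = c\<close> is null. Approaching an arbitrary
  \<open>c\<close> by such levels from both sides and averaging produces the convention \<open>sgn 0 = 0\<close>.\<close>

lemma ent_fun_nonneg_all_levels: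
  assumes u: "measurable2 u" "\<And>x t. \<bar>u x t\<bar> \<le> M" and u0: "u0 \<in> borel_measurable borel" "\<And>x. \<bar>u0 x\<bar> \<le> M"
    and td: "test_data D \<phi> \<phi>x \<phi>t"
    and null: "\<And>c. AE p in ivm 0 1 \<Otimes>\<^sub>M ivm 0 T. u (fst p) (snd p) \<noteq> c \<Longrightarrow> 0 \<le> ent_fun T u0 u c \<phi> \<phi>x \<phi>t"
  shows "0 \<le> ent_fun T u0 u c \<phi> \<phi>x \<phi>t"
proof -
  let ?Q = "ivm 0 1 \<Otimes>\<^sub>M ivm 0 T"
  note [measurable] = u(1) u0(1)
  have M: "M \<ge> 0" using u(2)[of 0 0] by simp
  let ?u = "\<lambda>p. u (fst p) (snd p)"
  have um: "?u \<in> measurable ?Q borel" by measurable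
  \<comment> \<open>The atoms of the image measure of u are the levels with non-null level set, and
    a finite measure has countably many.\<close>
  define A where "A = {c. measure (distr ?Q borel ?u) {c} \<noteq> 0}"
  have "finite_measure (distr ?Q borel ?u)" by (rule ivmp.finite_measure_distr[OF um])
  then have A: "countable A" unfolding A_def by (rule finite_measure.countable_support)
  have good: "0 \<le> ent_fun T u0 u a \<phi> \<phi>x \<phi>t" if "a \<notin> A" for a
  proof (rule null)
    have "measure ?Q (?u -` {a} \<inter> space ?Q) = 0" using that measure_distr[OF um, of "{a}"] by (simp add: A_def)
    then have "emeasure ?Q (?u -` {a} \<inter> space ?Q) = 0" by (simp add: ivmp.emeasure_eq_measure)
    then have "?u -` {a} \<inter> space ?Q \<in> null_sets ?Q" using measurable_sets[OF um, of "{a}"] by (simp add: null_sets_def)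
    from AE_not_in[OF this] show "AE p in ?Q. ?u p \<noteq> a" by (auto simp: space_pair_measure)
  qed
  have "\<exists>a. c < a \<and> a < c + 1 / real (Suc j) \<and> a \<notin> A" for j
    using open_minus_countable[OF A, of "{c<..<c + 1 / real (Suc j)}"] by auto
  then obtain a where a: "\<And>j. c < a j" "\<And>j. a j < c + 1 / real (Suc j)" "\<And>j. a j \<notin> A" by metis
  have "\<exists>b. c - 1 / real (Suc j) < b \<and> b < c \<and> b \<notin> A" for j
    using open_minus_countable[OF A, of "{c - 1 / real (Suc j)<..<c}"] by auto
  then obtain b where b: "\<And>j. c - 1 / real (Suc j) < b j" "\<And>j. b j < c" "\<And>j. b j \<notin> A" by metis
  have z: "(\<lambda>j. 1 / real (Suc j)) \<longlonglongrightarrow> 0" using LIMSEQ_inverse_real_of_nat by (simp add: inverse_eq_divide)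
  have "(\<lambda>j. c + 1 / real (Suc j)) \<longlonglongrightarrow> c + 0" "(\<lambda>j. c - 1 / real (Suc j)) \<longlonglongrightarrow> c - 0"
    by (intro tendsto_intros z)+
  then have la: "a \<longlonglongrightarrow> c" and lb: "b \<longlonglongrightarrow> c"
    using tendsto_sandwich[of "\<lambda>_. c" a sequentially "\<lambda>j. c + 1 / real (Suc j)" c]
      tendsto_sandwich[of "\<lambda>j. c - 1 / real (Suc j)" b sequentially "\<lambda>_. c" c] a(1,2) b(1,2)
    by (auto intro!: always_eventually simp: less_imp_le)
  define R where "R = M + \<bar>c\<bar> + 1"
  have Rb: "\<bar>u x t\<bar> \<le> R" "\<bar>u0 x\<bar> \<le> R" for x t using u(2)[of x t] u0(2)[of x] by (auto simp: R_def)
  have "1 / real (Suc j) \<le> 1" for j by simp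
  then have cb: "\<bar>c\<bar> \<le> R" "\<bar>a j\<bar> \<le> R" "\<bar>b j\<bar> \<le> R" for j
    using a(1,2)[of j] b(1,2)[of j] M order_less_le_trans[OF a(2)[of j], of "c + 1"] order_le_less_trans[OF _ b(1)[of j], of "c - 1"] unfolding R_def by (smt (verit))+
  let ?C = "(2 * R + 2 * R\<^sup>2 + FW_B * R) * D"
  note eb = ent_int_bound[OF u(1) Rb(1) _ td]
  note em[measurable] = ent_int_measurable[OF u(1) td]
  have iE: "integrable ?Q (\<lambda>p. ent_int u c' \<phi> \<phi>x \<phi>t (fst p) (snd p))" if "\<bar>c'\<bar> \<le> R" for c'
    by (rule integrable_pair_ivm[where C="?C"]) (use eb[OF that] in auto)
  have sgn_lim: "(\<lambda>j. sgn (y - a j) + sgn (y - b j)) \<longlonglongrightarrow> 2 * sgn (y - c)" for y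
  proof -
    have "\<forall>\<^sub>F j in sequentially. sgn (y - a j) + sgn (y - b j) = 2 * sgn (y - c)"
    proof -
      consider "y > c" | "y = c" | "y < c" by linarith
      then show ?thesis
      proof cases
        case 1
        then have "\<forall>\<^sub>F j in sequentially. a j < y" using la by (auto dest: order_tendstoD)
        then show ?thesis
        proof eventually_elim
          case (elim j)
          then show ?case using 1 b(2)[of j] by (auto simp: sgn_real_def)
        qed
      next
        case 2
        have "sgn (y - a j) + sgn (y - b j) = 2 * sgn (y - c)" for j
          using 2 a(1)[of j] b(2)[of j] by (simp add: sgn_real_def)
        then show ?thesis by simp
      next
        case 3
        then have "\<forall>\<^sub>F j in sequentially. y < b j" using lb by (auto dest: order_tendstoD)
        then show ?thesis
        proof eventually_elim
          case (elim j)
          then show ?case using 3 a(1)[of j] by (auto simp: sgn_real_def)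
        qed
      qed
    qed
    then show ?thesis by (rule tendsto_eventually)
  qed
  have "(\<lambda>j. \<integral>p. ent_int u (a j) \<phi> \<phi>x \<phi>t (fst p) (snd p) + ent_int u (b j) \<phi> \<phi>x \<phi>t (fst p) (snd p) \<partial>?Q)
      \<longlonglongrightarrow> (\<integral>p. 2 * ent_int u c \<phi> \<phi>x \<phi>t (fst p) (snd p) \<partial>?Q)"
  proof (rule integral_dominated_convergence[where w="\<lambda>_. 2 * ?C"])
    show "AE p in ?Q. (\<lambda>j. ent_int u (a j) \<phi> \<phi>x \<phi>t (fst p) (snd p) + ent_int u (b j) \<phi> \<phi>x \<phi>t (fst p) (snd p))
        \<longlonglongrightarrow> 2 * ent_int u c \<phi> \<phi>x \<phi>t (fst p) (snd p)"
    proof (rule AE_I2)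
      fix p :: "real \<times> real"
      obtain x t where p: "p = (x, t)" by (cases p)
      let ?y = "u x t" and ?k = "FW_conv (\<lambda>y. u y t) x"
      have "(\<lambda>j. (\<bar>?y - a j\<bar> + \<bar>?y - b j\<bar>) * \<phi>t x t + (\<bar>?y - a j\<bar> * (?y + a j) / 2 + \<bar>?y - b j\<bar> * (?y + b j) / 2) * \<phi>x x t
            - (sgn (?y - a j) + sgn (?y - b j)) * ?k * \<phi> x t)
         \<longlonglongrightarrow> (\<bar>?y - c\<bar> + \<bar>?y - c\<bar>) * \<phi>t x t + (\<bar>?y - c\<bar> * (?y + c) / 2 + \<bar>?y - c\<bar> * (?y + c) / 2) * \<phi>x x t - 2 * sgn (?y - c) * ?k * \<phi> x t"
        by (intro tendsto_intros la lb sgn_lim) auto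
      then show "(\<lambda>j. ent_int u (a j) \<phi> \<phi>x \<phi>t (fst p) (snd p) + ent_int u (b j) \<phi> \<phi>x \<phi>t (fst p) (snd p))
        \<longlonglongrightarrow> 2 * ent_int u c \<phi> \<phi>x \<phi>t (fst p) (snd p)"
        by (simp add: p ent_int_def kflux_eq algebra_simps add_divide_distrib)
    qed
    show "AE p in ?Q. norm (ent_int u (a j) \<phi> \<phi>x \<phi>t (fst p) (snd p) + ent_int u (b j) \<phi> \<phi>x \<phi>t (fst p) (snd p)) \<le> 2 * ?C" for j
    proof (rule AE_I2)
      fix p :: "real \<times> real"
      show "norm (ent_int u (a j) \<phi> \<phi>x \<phi>t (fst p) (snd p) + ent_int u (b j) \<phi> \<phi>x \<phi>t (fst p) (snd p)) \<le> 2 * ?C"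
        using eb[OF cb(2)[of j], of "fst p" "snd p"] eb[OF cb(3)[of j], of "fst p" "snd p"] unfolding real_norm_def by linarith
    qed
  qed auto
  then have l1: "(\<lambda>j. (\<integral>p. ent_int u (a j) \<phi> \<phi>x \<phi>t (fst p) (snd p) \<partial>?Q) + (\<integral>p. ent_int u (b j) \<phi> \<phi>x \<phi>t (fst p) (snd p) \<partial>?Q))
      \<longlonglongrightarrow> 2 * (\<integral>p. ent_int u c \<phi> \<phi>x \<phi>t (fst p) (snd p) \<partial>?Q)"
    using iE cb by simp
  have \<phi>: "0 \<le> \<phi> x t" "\<phi> x t \<le> D" for x t using td by (auto simp: test_data_def)
  have "measurable2 \<phi>" using td by (simp add: test_data_def)
  then have [measurable]: "(\<lambda>x. \<phi> x 0) \<in> borel_measurable borel" by (rule measurable2_compose) auto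
  have l2: "(\<lambda>j. \<integral>x. \<bar>u0 x - a' j\<bar> * \<phi> x 0 \<partial>ivm 0 1) \<longlonglongrightarrow> (\<integral>x. \<bar>u0 x - c\<bar> * \<phi> x 0 \<partial>ivm 0 1)"
    if "a' \<longlonglongrightarrow> c" "\<And>j. \<bar>a' j\<bar> \<le> R" for a'
  proof (rule integral_dominated_convergence[where w="\<lambda>_. 2 * R * D"])
    show "AE x in ivm 0 1. norm (\<bar>u0 x - a' j\<bar> * \<phi> x 0) \<le> 2 * R * D" for j
    proof (rule AE_I2)
      fix x
      have "\<bar>\<bar>u0 x - a' j\<bar>\<bar> \<le> 2 * R" using Rb(2)[of x] that(2)[of j] by linarith
      then show "norm (\<bar>u0 x - a' j\<bar> * \<phi> x 0) \<le> 2 * R * D"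
        unfolding real_norm_def abs_mult using \<phi>[of x 0] by (intro mult_mono) auto
    qed
  qed (auto intro!: tendsto_intros that AE_I2)
  have "(\<lambda>j. ent_fun T u0 u (a j) \<phi> \<phi>x \<phi>t + ent_fun T u0 u (b j) \<phi> \<phi>x \<phi>t) \<longlonglongrightarrow> 2 * ent_fun T u0 u c \<phi> \<phi>x \<phi>t"
    using tendsto_add[OF l1 tendsto_add[OF l2[OF la cb(2)] l2[OF lb cb(3)]]]
    by (simp add: ent_fun_def algebra_simps)
  then have "0 \<le> 2 * ent_fun T u0 u c \<phi> \<phi>x \<phi>t"
    by (rule LIMSEQ_le_const) (use good[OF a(3)] good[OF b(3)] in \<open>auto intro: add_nonneg_nonneg\<close>)
  then show ?thesis by simp
qed

text \<open>Completeness of L1 through an almost everywhere Cauchy subsequence. The pointwise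
  convergence is kept because the signs will need it, and clamping the limit to [-M, M] makes the
  bound hold at every point.\<close>

lemma ex_bounded_L1_limit:
  assumes v: "\<And>n. measurable2 (v n)" "\<And>n x t. \<bar>v n x t\<bar> \<le> M"
    and cauchy: "\<And>e. e > 0 \<Longrightarrow> \<exists>N. \<forall>i\<ge>N. \<forall>j\<ge>N. (\<integral>p. \<bar>v i (fst p) (snd p) - v j (fst p) (snd p)\<bar> \<partial>(ivm 0 1 \<Otimes>\<^sub>M ivm 0 T)) < e"
  obtains u r where "measurable2 u" "\<And>x t. \<bar>u x t\<bar> \<le> M" "strict_mono (r :: nat \<Rightarrow> nat)"
    "AE p in ivm 0 1 \<Otimes>\<^sub>M ivm 0 T. (\<lambda>i. v (r i) (fst p) (snd p)) \<longlonglongrightarrow> u (fst p) (snd p)"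
    "(\<lambda>i. \<integral>p. \<bar>v (r i) (fst p) (snd p) - u (fst p) (snd p)\<bar> \<partial>(ivm 0 1 \<Otimes>\<^sub>M ivm 0 T)) \<longlonglongrightarrow> 0"
proof -
  let ?Q = "ivm 0 1 \<Otimes>\<^sub>M ivm 0 T"
  have M: "M \<ge> 0" using v(2)[of 0 0 0] by simp
  note [measurable] = v(1)
  obtain r where r: "strict_mono r" and ae: "AE p in ?Q. Cauchy (\<lambda>i. v (r i) (fst p) (snd p))"
  proof (rule cauchy_L1_AE_cauchy_subseq[of ?Q "\<lambda>n p. v n (fst p) (snd p)"])
    show "integrable ?Q (\<lambda>p. v n (fst p) (snd p))" for n
      by (rule integrable_pair_ivm[where C=M]) (use v in auto)
    show "\<exists>N. \<forall>i\<ge>N. \<forall>j\<ge>N. (\<integral>p. norm (v i (fst p) (snd p) - v j (fst p) (snd p)) \<partial>?Q) < e" if "e > 0" for e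
      using cauchy[OF that] by simp
  qed
  define u where "u x t = max (- M) (min M (lim (\<lambda>i. v (r i) x t)))" for x t
  have um[measurable]: "measurable2 u" unfolding u_def by measurable
  have ub: "\<bar>u x t\<bar> \<le> M" for x t using M by (auto simp: u_def)
  have lim: "AE p in ?Q. (\<lambda>i. v (r i) (fst p) (snd p)) \<longlonglongrightarrow> u (fst p) (snd p)"
    using ae
  proof eventually_elim
    case (elim p)
    then have l: "(\<lambda>i. v (r i) (fst p) (snd p)) \<longlonglongrightarrow> lim (\<lambda>i. v (r i) (fst p) (snd p))"
      by (simp add: Cauchy_convergent_iff convergent_LIMSEQ_iff)
    have "v (r i) (fst p) (snd p) \<le> M \<and> - M \<le> v (r i) (fst p) (snd p)" for i
      using v(2)[of "r i" "fst p" "snd p"] by linarith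
    then have "lim (\<lambda>i. v (r i) (fst p) (snd p)) \<le> M" "- M \<le> lim (\<lambda>i. v (r i) (fst p) (snd p))"
      using LIMSEQ_le_const2[OF l, of M] LIMSEQ_le_const[OF l, of "- M"] by auto
    then show ?case using l by (simp add: u_def)
  qed
  have "(\<lambda>i. \<integral>p. \<bar>v (r i) (fst p) (snd p) - u (fst p) (snd p)\<bar> \<partial>?Q) \<longlonglongrightarrow> (\<integral>p. 0 \<partial>?Q)"
  proof (rule integral_dominated_convergence[where w="\<lambda>_. 2 * M"])
    show "AE p in ?Q. (\<lambda>i. \<bar>v (r i) (fst p) (snd p) - u (fst p) (snd p)\<bar>) \<longlonglongrightarrow> 0"
      using lim by eventually_elim (simp add: tendsto_rabs_zero_iff LIM_zero_iff)
    show "AE p in ?Q. norm \<bar>v (r i) (fst p) (snd p) - u (fst p) (snd p)\<bar> \<le> 2 * M" for i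
    proof (rule AE_I2)
      show "norm \<bar>v (r i) (fst p) (snd p) - u (fst p) (snd p)\<bar> \<le> 2 * M" for p
        using v(2)[of "r i" "fst p" "snd p"] ub[of "fst p" "snd p"] unfolding real_norm_def by linarith
    qed
  qed auto
  then have "(\<lambda>i. \<integral>p. \<bar>v (r i) (fst p) (snd p) - u (fst p) (snd p)\<bar> \<partial>?Q) \<longlonglongrightarrow> 0" by simp
  with um ub r lim show ?thesis by (rule that)
qed

lemma integral_abs_diff_iterated:
  assumes "measurable2 u" "\<And>x t. \<bar>u x t\<bar> \<le> R" "measurable2 v" "\<And>x t. \<bar>v x t\<bar> \<le> R"
  shows "(\<integral>p. \<bar>u (fst p) (snd p) - v (fst p) (snd p)\<bar> \<partial>(ivm 0 1 \<Otimes>\<^sub>M ivm 0 T)) = (\<integral>t. (\<integral>x. \<bar>u x t - v x t\<bar> \<partial>ivm 0 1) \<partial>ivm 0 T)"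
proof -
  note [measurable] = assms(1,3)
  have "\<bar>\<bar>u x t - v x t\<bar>\<bar> \<le> 2 * R" for x t using assms(2)[of x t] assms(4)[of x t] by linarith
  then show ?thesis
    using integral_pair_ivm_iterated(2)[of "\<lambda>p. \<bar>u (fst p) (snd p) - v (fst p) (snd p)\<bar>" 0 1 0 T "2 * R"] by simp
qed

lemma integrable_abs_diff_pair:
  assumes "measurable2 u" "\<And>x t. \<bar>u x t\<bar> \<le> R" "measurable2 v" "\<And>x t. \<bar>v x t\<bar> \<le> R"
  shows "integrable (ivm 0 1 \<Otimes>\<^sub>M ivm 0 T) (\<lambda>p. \<bar>u (fst p) (snd p) - v (fst p) (snd p)\<bar>)"
proof -
  note [measurable] = assms(1,3)
  have "\<bar>\<bar>u x t - v x t\<bar>\<bar> \<le> 2 * R" for x t using assms(2)[of x t] assms(4)[of x t] by linarith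
  then show ?thesis by (intro integrable_pair_ivm[where C="2 * R"]) auto
qed

lemma L1_triangle_pair:
  assumes u: "measurable2 u" "\<And>x t. \<bar>u x t\<bar> \<le> R" and v: "measurable2 v" "\<And>x t. \<bar>v x t\<bar> \<le> R" and w: "measurable2 w" "\<And>x t. \<bar>w x t\<bar> \<le> R"
  shows "(\<integral>p. \<bar>u (fst p) (snd p) - v (fst p) (snd p)\<bar> \<partial>(ivm 0 1 \<Otimes>\<^sub>M ivm 0 T))
    \<le> (\<integral>p. \<bar>u (fst p) (snd p) - w (fst p) (snd p)\<bar> \<partial>(ivm 0 1 \<Otimes>\<^sub>M ivm 0 T)) + (\<integral>p. \<bar>v (fst p) (snd p) - w (fst p) (snd p)\<bar> \<partial>(ivm 0 1 \<Otimes>\<^sub>M ivm 0 T))"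
proof -
  note i = integrable_abs_diff_pair[OF u v, of T] integrable_abs_diff_pair[OF u w, of T] integrable_abs_diff_pair[OF v w, of T]
  have "(\<integral>p. \<bar>u (fst p) (snd p) - v (fst p) (snd p)\<bar> \<partial>(ivm 0 1 \<Otimes>\<^sub>M ivm 0 T))
    \<le> (\<integral>p. \<bar>u (fst p) (snd p) - w (fst p) (snd p)\<bar> + \<bar>v (fst p) (snd p) - w (fst p) (snd p)\<bar> \<partial>(ivm 0 1 \<Otimes>\<^sub>M ivm 0 T))"
    by (rule integral_mono) (use i in auto)
  then show ?thesis using i by simp
qed

section \<open>Existence as an L1 limit, uniqueness by comparison with the approximations\<close>

theorem theorem2:
  fixes T :: real and u0 :: "real \<Rightarrow> real"
  assumes "T > 0" and "Linf_torus u0"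
  shows "\<exists>u. FW_entropy_solution T u0 u \<and>
           (\<forall>v. FW_entropy_solution T u0 v \<longrightarrow>
              (AE p in (lborel :: (real \<times> real) measure).
                 p \<in> {0..1} \<times> {0..T} \<longrightarrow> v (fst p) (snd p) = u (fst p) (snd p)))"
proof -
  let ?Q = "ivm 0 1 \<Otimes>\<^sub>M ivm 0 T"
  note T = \<open>T > 0\<close>
  obtain w M0 where w: "w \<in> borel_measurable borel" "\<And>x. \<bar>w x\<bar> \<le> M0" "\<And>x. w (x + 1) = w x" "AE x in ivm 0 1. w x = u0 x"
    by (rule clean_initial[OF assms(2)]; rule that; assumption)
  define M where "M = M0 * exp (2 * FW_B * T)"
  \<comment> \<open>The constant of \<open>ex_approximation\<close> with k written out.\<close>
  define C where "C = (2 + 3 * T) / (1 / (1 + exp (2 * (FW_B + 1) * T))) + 2"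
  define e where "e n = 1 / (real n + 1)" for n :: nat
  have M0: "M0 \<ge> 0" using w(2)[of 0] by simp
  have M: "M \<ge> 0" "M0 \<le> M"
  proof -
    show "M \<ge> 0" using M0 by (simp add: M_def)
    have "M0 * 1 \<le> M" unfolding M_def using M0 T FW_B_nonneg by (intro mult_left_mono) auto
    then show "M0 \<le> M" by simp
  qed
  have C: "C > 0" unfolding C_def using T by (intro add_nonneg_pos divide_nonneg_nonneg) (auto intro!: divide_nonneg_nonneg add_nonneg_nonneg)
  have e: "e n > 0" for n by (simp add: e_def)
  have e_lim: "e \<longlonglongrightarrow> 0" unfolding e_def using LIMSEQ_inverse_real_of_nat by (simp add: inverse_eq_divide add.commute)
  define P where "P n v \<Phi> \<Phi>x \<Phi>t K \<longleftrightarrow> (measurable2 v \<and> (\<forall>x t. \<bar>v x t\<bar> \<le> M)) \<and>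
    (\<forall>y s. test_data K (\<Phi> y s) (\<Phi>x y s) (\<Phi>t y s) \<and> FW_test_fn (\<Phi> y s)) \<and>
    (\<forall>y s a t a' t'. \<bar>\<Phi>x y s a t - \<Phi>x y s a' t'\<bar> \<le> K * (\<bar>a - a'\<bar> + 2 * \<bar>t - t'\<bar>)) \<and>
    (\<forall>u. measurable2 u \<longrightarrow> (\<forall>x t. \<bar>u x t\<bar> \<le> M + real n) \<longrightarrow>
       (\<forall>y s. 0 \<le> s \<longrightarrow> s \<le> T \<longrightarrow> - e n \<le> ent_fun T w u (v y s) (\<Phi> y s) (\<Phi>x y s) (\<Phi>t y s)) \<longrightarrow>
       (\<integral>t. (\<integral>x. \<bar>u x t - v x t\<bar> \<partial>ivm 0 1) \<partial>ivm 0 T) \<le> C * e n) \<and>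
    (\<forall>c D \<phi> \<phi>x \<phi>t \<eta> r. \<bar>c\<bar> \<le> r \<longrightarrow> M \<le> r \<longrightarrow> r \<le> M + real n \<longrightarrow> D \<le> real n \<longrightarrow> test_data D \<phi> \<phi>x \<phi>t \<longrightarrow>
       (\<forall>x y s t. \<bar>x - y\<bar> \<le> e n \<longrightarrow> \<bar>s - t\<bar> \<le> e n \<longrightarrow> \<bar>\<phi>x x s - \<phi>x y t\<bar> \<le> \<eta>) \<longrightarrow>
       - (e n + 4 * T * r\<^sup>2 * \<eta>) \<le> ent_fun T w v c \<phi> \<phi>x \<phi>t)"
    for n :: nat and v :: "real \<Rightarrow> real \<Rightarrow> real" and \<Phi> \<Phi>x \<Phi>t :: "real \<Rightarrow> real \<Rightarrow> real \<Rightarrow> real \<Rightarrow> real" and K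
  have "\<exists>v \<Phi> \<Phi>x \<Phi>t K. P n v \<Phi> \<Phi>x \<Phi>t K" for n
  proof (rule ex_approximation[OF T w(1,2,3), of n])
    fix v \<Phi> \<Phi>x \<Phi>t K
    assume a: "measurable2 v" "\<And>x t. \<bar>v x t\<bar> \<le> M0 * exp (2 * FW_B * T)"
      "\<And>y s. test_data K (\<Phi> y s) (\<Phi>x y s) (\<Phi>t y s)" "\<And>y s. FW_test_fn (\<Phi> y s)"
      "\<And>y s a t a' t'. \<bar>\<Phi>x y s a t - \<Phi>x y s a' t'\<bar> \<le> K * (\<bar>a - a'\<bar> + 2 * \<bar>t - t'\<bar>)"
      "\<And>u. measurable2 u \<Longrightarrow> (\<And>x t. \<bar>u x t\<bar> \<le> M0 * exp (2 * FW_B * T) + real n) \<Longrightarrow>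
        (\<And>y s. 0 \<le> s \<Longrightarrow> s \<le> T \<Longrightarrow> - (1 / (real n + 1)) \<le> ent_fun T w u (v y s) (\<Phi> y s) (\<Phi>x y s) (\<Phi>t y s)) \<Longrightarrow>
        (\<integral>t. (\<integral>x. \<bar>u x t - v x t\<bar> \<partial>ivm 0 1) \<partial>ivm 0 T) \<le> ((2 + 3 * T) / (1 / (1 + exp (2 * (FW_B + 1) * T))) + 2) * (1 / (real n + 1))"
      "\<And>c D \<phi> \<phi>x \<phi>t \<eta> r. \<bar>c\<bar> \<le> r \<Longrightarrow> M0 * exp (2 * FW_B * T) \<le> r \<Longrightarrow> r \<le> M0 * exp (2 * FW_B * T) + real n \<Longrightarrow> D \<le> real n \<Longrightarrow> test_data D \<phi> \<phi>x \<phi>t \<Longrightarrow>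
        (\<And>x y s t. \<bar>x - y\<bar> \<le> 1 / (real n + 1) \<Longrightarrow> \<bar>s - t\<bar> \<le> 1 / (real n + 1) \<Longrightarrow> \<bar>\<phi>x x s - \<phi>x y t\<bar> \<le> \<eta>) \<Longrightarrow>
        - (1 / (real n + 1) + 4 * T * r\<^sup>2 * \<eta>) \<le> ent_fun T w v c \<phi> \<phi>x \<phi>t"
    show "\<exists>v \<Phi> \<Phi>x \<Phi>t K. P n v \<Phi> \<Phi>x \<Phi>t K"
    proof (intro exI)
      show "P n v \<Phi> \<Phi>x \<Phi>t K"
        unfolding P_def M_def C_def e_def
        by (intro conjI allI impI; (rule a(1) a(2) a(3) a(4) a(5) a(6) a(7); blast))
    qed
  qed
  then obtain v \<Phi> \<Phi>x \<Phi>t K where P: "\<And>n. P n (v n) (\<Phi> n) (\<Phi>x n) (\<Phi>t n) (K n)" by metis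
  have vm: "measurable2 (v n)" and vb: "\<bar>v n x t\<bar> \<le> M" and td: "test_data (K n) (\<Phi> n y s) (\<Phi>x n y s) (\<Phi>t n y s)"
    and tf: "FW_test_fn (\<Phi> n y s)" and lip: "\<bar>\<Phi>x n y s a t - \<Phi>x n y s a' t'\<bar> \<le> K n * (\<bar>a - a'\<bar> + 2 * \<bar>t - t'\<bar>)"
    for n x t y s a a' t' using P[of n] unfolding P_def by blast+
  have close: "(\<integral>p. \<bar>u (fst p) (snd p) - v n (fst p) (snd p)\<bar> \<partial>?Q) \<le> C * e n"
    if u: "measurable2 u" "\<And>x t. \<bar>u x t\<bar> \<le> M + real n"
      and ent: "\<And>y s. 0 \<le> s \<Longrightarrow> s \<le> T \<Longrightarrow> - e n \<le> ent_fun T w u (v n y s) (\<Phi> n y s) (\<Phi>x n y s) (\<Phi>t n y s)" for u n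
  proof -
    have "(\<integral>t. (\<integral>x. \<bar>u x t - v n x t\<bar> \<partial>ivm 0 1) \<partial>ivm 0 T) \<le> C * e n"
      by (rule P[of n, unfolded P_def, THEN conjunct2, THEN conjunct2, THEN conjunct2, THEN conjunct1, rule_format, OF u ent])
    moreover have "\<bar>v n x t\<bar> \<le> M + real n" for x t using vb[of n x t] by linarith
    ultimately show ?thesis by (subst integral_abs_diff_iterated[OF u vm])
  qed
  have weak: "- (e n + 4 * T * r\<^sup>2 * \<eta>) \<le> ent_fun T w (v n) c \<phi> \<phi>x \<phi>t"
    if "\<bar>c\<bar> \<le> r" "M \<le> r" "r \<le> M + real n" "D \<le> real n" "test_data D \<phi> \<phi>x \<phi>t"
      "\<And>x y s t. \<bar>x - y\<bar> \<le> e n \<Longrightarrow> \<bar>s - t\<bar> \<le> e n \<Longrightarrow> \<bar>\<phi>x x s - \<phi>x y t\<bar> \<le> \<eta>" for n c D \<phi> \<phi>x \<phi>t \<eta> r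
    by (rule P[of n, unfolded P_def, THEN conjunct2, THEN conjunct2, THEN conjunct2, THEN conjunct2, rule_format]; rule that; assumption)
  have K: "K n \<ge> 0" for n
    using td[of n 0 0] order_trans[of 0 "\<Phi> n 0 0 0 0" "K n"] unfolding test_data_def by blast

  \<comment> \<open>Fix n and let m grow. Eventually \<open>K n \<le> real m\<close>, so the kernels
    belonging to \<open>v n\<close> are among the test data for which \<open>v m\<close> nearly
    satisfies the inequality. Their x-derivatives vary by at most \<open>3 * K n * e m\<close>, one
    part from x and two from t. Hence \<open>close\<close> applies to \<open>v m\<close> with the
    kernels of \<open>v n\<close>.\<close>
  have near: "\<forall>\<^sub>F m in sequentially. (\<integral>p. \<bar>v m (fst p) (snd p) - v n (fst p) (snd p)\<bar> \<partial>?Q) \<le> C * e n" for n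
  proof -
    let ?A = "1 + 4 * T * M\<^sup>2 * (3 * K n)"
    have "(\<lambda>m. e m * ?A) \<longlonglongrightarrow> 0 * ?A" by (intro tendsto_intros e_lim)
    then have ev1: "\<forall>\<^sub>F m in sequentially. e m * ?A < e n" using e[of n] by (auto dest: order_tendstoD)
    have ev2: "\<forall>\<^sub>F m in sequentially. K n \<le> real m"
      using filterlim_real_sequentially by (auto simp: filterlim_at_top)
    from ev1 ev2 show ?thesis
    proof eventually_elim
      case (elim m)
      show ?case
      proof (rule close[OF vm])
        show "\<bar>v m x t\<bar> \<le> M + real n" for x t using vb[of m x t] by linarith
        fix y s
        have "- (e m + 4 * T * M\<^sup>2 * (K n * (e m + 2 * e m))) \<le> ent_fun T w (v m) (v n y s) (\<Phi> n y s) (\<Phi>x n y s) (\<Phi>t n y s)"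
        proof (rule weak[OF vb order_refl _ elim(2) td])
          show "\<bar>\<Phi>x n y s x t - \<Phi>x n y s x' t'\<bar> \<le> K n * (e m + 2 * e m)" if "\<bar>x - x'\<bar> \<le> e m" "\<bar>t - t'\<bar> \<le> e m" for x x' t t'
            using that K[of n] by (intro order_trans[OF lip] mult_left_mono) auto
        qed simp
        moreover have "e m + 4 * T * M\<^sup>2 * (K n * (e m + 2 * e m)) = e m * ?A" by (simp add: algebra_simps)
        ultimately show "- e n \<le> ent_fun T w (v m) (v n y s) (\<Phi> n y s) (\<Phi>x n y s) (\<Phi>t n y s)" using elim(1) by linarith
      qed
    qed
  qed
  have cauchy: "\<exists>N. \<forall>i\<ge>N. \<forall>j\<ge>N. (\<integral>p. \<bar>v i (fst p) (snd p) - v j (fst p) (snd p)\<bar> \<partial>?Q) < a" if a: "a > 0" for a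
  proof -
    have "(\<lambda>n. 2 * (C * e n)) \<longlonglongrightarrow> 2 * (C * 0)" by (intro tendsto_intros e_lim)
    then have "\<forall>\<^sub>F n in sequentially. 2 * (C * e n) < a" by (rule order_tendstoD(2)) (use a in simp)
    then obtain n where n: "2 * (C * e n) < a" unfolding eventually_sequentially by blast
    obtain N where N: "\<And>m. m \<ge> N \<Longrightarrow> (\<integral>p. \<bar>v m (fst p) (snd p) - v n (fst p) (snd p)\<bar> \<partial>?Q) \<le> C * e n"
      using near[of n] unfolding eventually_sequentially by blast
    show ?thesis
    proof (intro exI[of _ N] allI impI)
      fix i j assume "N \<le> i" "N \<le> j"
      moreover have "(\<integral>p. \<bar>v i (fst p) (snd p) - v j (fst p) (snd p)\<bar> \<partial>?Q)
          \<le> (\<integral>p. \<bar>v i (fst p) (snd p) - v n (fst p) (snd p)\<bar> \<partial>?Q) + (\<integral>p. \<bar>v j (fst p) (snd p) - v n (fst p) (snd p)\<bar> \<partial>?Q)"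
        by (rule L1_triangle_pair[OF vm vb vm vb vm vb])
      ultimately show "(\<integral>p. \<bar>v i (fst p) (snd p) - v j (fst p) (snd p)\<bar> \<partial>?Q) < a"
        using N[of i] N[of j] n by linarith
    qed
  qed
  obtain u r where u: "measurable2 u" "\<And>x t. \<bar>u x t\<bar> \<le> M" and r: "strict_mono (r :: nat \<Rightarrow> nat)"
    and ae: "AE p in ?Q. (\<lambda>i. v (r i) (fst p) (snd p)) \<longlonglongrightarrow> u (fst p) (snd p)"
    and L1: "(\<lambda>i. \<integral>p. \<bar>v (r i) (fst p) (snd p) - u (fst p) (snd p)\<bar> \<partial>?Q) \<longlonglongrightarrow> 0"
    by (rule ex_bounded_L1_limit[where v=v and M=M, OF vm vb cauchy]; (assumption | (rule that; assumption)))
  have e_lim': "(\<lambda>i. e (r i)) \<longlonglongrightarrow> 0" using LIMSEQ_subseq_LIMSEQ[OF e_lim r] by (simp add: o_def)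
  have r_top: "\<forall>\<^sub>F i in sequentially. b \<le> real (r i)" for b
    using filterlim_compose[OF filterlim_real_sequentially filterlim_subseq[OF r]] by (auto simp: filterlim_at_top)

  \<comment> \<open>At levels that u avoids almost everywhere one passes to the limit in
    \<open>weak\<close>; \<open>ent_fun_nonneg_all_levels\<close> supplies the other levels.\<close>
  have u_ent: "0 \<le> ent_fun T w u c \<phi> \<phi>x \<phi>t"
    if td: "test_data D \<phi> \<phi>x \<phi>t" and uc: "\<And>\<eta>. \<eta> > 0 \<Longrightarrow> \<exists>d>0. \<forall>x y s t. \<bar>x - y\<bar> \<le> d \<longrightarrow> \<bar>s - t\<bar> \<le> d \<longrightarrow> \<bar>\<phi>x x s - \<phi>x y t\<bar> \<le> \<eta>"
    for c D \<phi> \<phi>x \<phi>t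
  proof (rule ent_fun_nonneg_all_levels[OF u w(1) _ td])
    show "\<bar>w x\<bar> \<le> M" for x using w(2)[of x] M by linarith
    fix c assume nc: "AE p in ?Q. u (fst p) (snd p) \<noteq> c"
    \<comment> \<open>Bounds u, all approximations and the level, independently of the index, so
      that the modulus error is governed by \<eta> alone.\<close>
    define \<rho> where "\<rho> = M + \<bar>c\<bar>"
    have \<rho>: "\<bar>c\<bar> \<le> \<rho>" "M \<le> \<rho>" "0 \<le> \<rho>" using M by (auto simp: \<rho>_def)
    have b\<rho>: "\<bar>u x t\<bar> \<le> \<rho>" "\<bar>v n x t\<bar> \<le> \<rho>" for x t n using u(2)[of x t] vb[of n x t] \<rho> by linarith+
    let ?S = "\<lambda>i. \<integral>p. \<bar>sgn (v (r i) (fst p) (snd p) - c) - sgn (u (fst p) (snd p) - c)\<bar> \<partial>?Q"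
    let ?L = "\<lambda>i. \<integral>p. \<bar>v (r i) (fst p) (snd p) - u (fst p) (snd p)\<bar> \<partial>?Q"
    note [measurable] = u(1) vm
    have "?S \<longlonglongrightarrow> (\<integral>p. 0 \<partial>?Q)"
    proof (rule integral_dominated_convergence[where w="\<lambda>_. 2"])
      show "AE p in ?Q. (\<lambda>i. \<bar>sgn (v (r i) (fst p) (snd p) - c) - sgn (u (fst p) (snd p) - c)\<bar>) \<longlonglongrightarrow> 0"
        using ae nc
      proof eventually_elim
        case (elim p)
        \<comment> \<open>Continuity of sgn away from 0, where u - c lies at almost every
          point.\<close>
        have "(\<lambda>i. sgn (v (r i) (fst p) (snd p) - c)) \<longlonglongrightarrow> sgn (u (fst p) (snd p) - c)"
          using elim by (intro tendsto_intros) auto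
        then show ?case by (simp add: tendsto_rabs_zero_iff LIM_zero_iff)
      qed
      show "AE p in ?Q. norm \<bar>sgn (v (r i) (fst p) (snd p) - c) - sgn (u (fst p) (snd p) - c)\<bar> \<le> 2" for i
        by (rule AE_I2) (auto simp: sgn_real_def)
    qed auto
    then have S: "?S \<longlonglongrightarrow> 0" by simp
    have lower: "- \<gamma> \<le> ent_fun T w u c \<phi> \<phi>x \<phi>t" if \<gamma>: "\<gamma> > 0" for \<gamma>
    proof -
      \<comment> \<open>Half of \<gamma> is allotted to the modulus error and half to the errors
        that vanish with i; the \<open>+ 1\<close> keeps the denominator positive when \<rho> =
        0.\<close>
      define \<eta> where "\<eta> = \<gamma> / (2 * (4 * T * \<rho>\<^sup>2 + 1))"
      have p1: "4 * T * \<rho>\<^sup>2 + 1 > 0" using T by (intro add_nonneg_pos) auto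
      have \<eta>: "\<eta> > 0" "4 * T * \<rho>\<^sup>2 * \<eta> \<le> \<gamma> / 2"
      proof -
        show "\<eta> > 0" using \<gamma> p1 by (simp add: \<eta>_def)
        have "(4 * T * \<rho>\<^sup>2 + 1) * \<eta> = \<gamma> / 2"
        proof -
          have "X * (\<gamma> / (2 * X)) = \<gamma> / 2" if "X > 0" for X using that by (simp add: field_simps)
          from this[OF p1] show ?thesis by (simp only: \<eta>_def)
        qed
        then show "4 * T * \<rho>\<^sup>2 * \<eta> \<le> \<gamma> / 2" using \<open>\<eta> > 0\<close> by (simp add: algebra_simps)
      qed
      obtain d where d: "d > 0" "\<And>x y s t. \<bar>x - y\<bar> \<le> d \<Longrightarrow> \<bar>s - t\<bar> \<le> d \<Longrightarrow> \<bar>\<phi>x x s - \<phi>x y t\<bar> \<le> \<eta>"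
        using uc[OF \<eta>(1)] by blast
      have "(\<lambda>i. e (r i) + (D * (1 + 2 * \<rho> + FW_B) * ?L i + D * (FW_B * \<rho>) * ?S i)) \<longlonglongrightarrow> 0 + (D * (1 + 2 * \<rho> + FW_B) * 0 + D * (FW_B * \<rho>) * 0)"
        by (intro tendsto_intros e_lim' L1 S)
      then have ev1: "\<forall>\<^sub>F i in sequentially. e (r i) + (D * (1 + 2 * \<rho> + FW_B) * ?L i + D * (FW_B * \<rho>) * ?S i) < \<gamma> / 2"
        by (rule order_tendstoD(2)) (use \<gamma> in simp)
      have ev2: "\<forall>\<^sub>F i in sequentially. e (r i) < d" using e_lim' d(1) by (auto dest: order_tendstoD)
      have "\<forall>\<^sub>F i in sequentially. - \<gamma> \<le> ent_fun T w u c \<phi> \<phi>x \<phi>t"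
        using ev1 ev2 r_top[of D] r_top[of "\<rho> - M"]
      proof eventually_elim
        case (elim i)
        have "- (e (r i) + 4 * T * \<rho>\<^sup>2 * \<eta>) \<le> ent_fun T w (v (r i)) c \<phi> \<phi>x \<phi>t"
          by (rule weak[OF \<rho>(1,2) _ elim(3) td]) (use elim d in auto)
        moreover have "\<bar>ent_fun T w (v (r i)) c \<phi> \<phi>x \<phi>t - ent_fun T w u c \<phi> \<phi>x \<phi>t\<bar>
            \<le> D * (1 + 2 * \<rho> + FW_B) * ?L i + D * (FW_B * \<rho>) * ?S i"
          by (rule ent_fun_diff[OF u(1) b\<rho>(1) vm b\<rho>(2) \<rho>(1) td])
        ultimately show ?case using elim(1) \<eta>(2) by linarith
      qed
      then show ?thesis by simp
    qed
    show "0 \<le> ent_fun T w u c \<phi> \<phi>x \<phi>t"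
      using lower[of "- ent_fun T w u c \<phi> \<phi>x \<phi>t / 2"] by (cases "0 \<le> ent_fun T w u c \<phi> \<phi>x \<phi>t") auto
  qed
  have "FW_entropy_solution T u0 u"
    unfolding FW_entropy_solution_iff
  proof (intro conjI allI impI)
    show "Linf_torus_time T u"
      unfolding Linf_torus_time_def set_borel_measurable_def
    proof
      have "(\<lambda>p. u (fst p) (snd p)) \<in> borel_measurable (lborel :: (real \<times> real) measure)" using u(1) measurable2_lborel by blast
      moreover have "indicator ({0..1} \<times> {0..T}) \<in> borel_measurable (lborel :: (real \<times> real) measure)"
        using box_borel by (intro borel_measurable_indicator) simp
      ultimately show "(\<lambda>p. indicat_real ({0..1} \<times> {0..T}) p *\<^sub>R u (fst p) (snd p)) \<in> borel_measurable (lborel :: (real \<times> real) measure)"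
        by (intro borel_measurable_scaleR)
      show "\<exists>M. AE p in (lborel :: (real \<times> real) measure). p \<in> {0..1} \<times> {0..T} \<longrightarrow> \<bar>u (fst p) (snd p)\<bar> \<le> M"
        using u(2) by (intro exI[of _ M]) simp
    qed
    fix c \<phi> assume \<phi>: "FW_test_fn \<phi>"
    obtain D \<phi>x \<phi>t where td: "test_data D \<phi> \<phi>x \<phi>t"
      and uc: "\<And>\<eta>. \<eta> > 0 \<Longrightarrow> \<exists>d>0. \<forall>x y s t. \<bar>x - y\<bar> \<le> d \<longrightarrow> \<bar>s - t\<bar> \<le> d \<longrightarrow> \<bar>\<phi>x x s - \<phi>x y t\<bar> \<le> \<eta>"
      by (rule FW_test_fn_data[OF \<phi>]; rule that; assumption)
    have "measurable2 \<phi>" using td by (simp add: test_data_def)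
    then have "(\<lambda>x. \<phi> x 0) \<in> borel_measurable borel" by (rule measurable2_compose) auto
    from initial_integral_cong[OF assms(2) w(1,4) this, of c]
    have "ent_lhs T u0 u c \<phi> = ent_lhs T w u c \<phi>" by (simp add: ent_lhs_def)
    also have "\<dots> = ent_fun T w u c \<phi> \<phi>x \<phi>t" by (rule ent_lhs_eq_ent_fun[OF u w(1) td])
    also have "0 \<le> \<dots>" by (rule u_ent[OF td uc])
    finally show "0 \<le> ent_lhs T u0 u c \<phi>" .
  qed
  moreover have "AE p in (lborel :: (real \<times> real) measure). p \<in> {0..1} \<times> {0..T} \<longrightarrow> z (fst p) (snd p) = u (fst p) (snd p)"
    if sol: "FW_entropy_solution T u0 z" for z
  proof -
    obtain z' R where z': "measurable2 z'" "\<And>x t. \<bar>z' x t\<bar> \<le> R" "AE p in ?Q. z' (fst p) (snd p) = z (fst p) (snd p)"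
      and ent: "\<And>c D \<phi> \<phi>x \<phi>t. FW_test_fn \<phi> \<Longrightarrow> test_data D \<phi> \<phi>x \<phi>t \<Longrightarrow> 0 \<le> ent_fun T w z' c \<phi> \<phi>x \<phi>t"
      by (rule clean_solution[OF sol assms(2) w(1,4)]; rule that; assumption)
    \<comment> \<open>A solution satisfies the inequality against the kernels of every approximation
      without any defect, so it is within \<open>C * e (r i)\<close> of \<open>v (r i)\<close> once
      the index exceeds its bound R. The second summand is the distance from that approximation to
      u.\<close>
    let ?B = "\<lambda>i. C * e (r i) + (\<integral>p. \<bar>v (r i) (fst p) (snd p) - u (fst p) (snd p)\<bar> \<partial>?Q)"
    define R' where "R' = max R M"
    have b: "\<bar>z' x t\<bar> \<le> R'" "\<bar>u x t\<bar> \<le> R'" "\<bar>v n x t\<bar> \<le> R'" for x t n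
      using z'(2)[of x t] u(2)[of x t] vb[of n x t] by (auto simp: R'_def)
    have "\<forall>\<^sub>F i in sequentially. (\<integral>p. \<bar>z' (fst p) (snd p) - u (fst p) (snd p)\<bar> \<partial>?Q) \<le> ?B i"
      using r_top[of R]
    proof eventually_elim
      case (elim i)
      have "(\<integral>p. \<bar>z' (fst p) (snd p) - v (r i) (fst p) (snd p)\<bar> \<partial>?Q) \<le> C * e (r i)"
      proof (rule close[OF z'(1)])
        show "\<bar>z' x t\<bar> \<le> M + real (r i)" for x t using z'(2)[of x t] elim M by linarith
        show "- e (r i) \<le> ent_fun T w z' (v (r i) y s) (\<Phi> (r i) y s) (\<Phi>x (r i) y s) (\<Phi>t (r i) y s)" for y s
          by (rule order_trans[OF _ ent[OF tf td]]) (use e[of "r i"] in simp)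
      qed
      moreover have "(\<integral>p. \<bar>u (fst p) (snd p) - v (r i) (fst p) (snd p)\<bar> \<partial>?Q) = (\<integral>p. \<bar>v (r i) (fst p) (snd p) - u (fst p) (snd p)\<bar> \<partial>?Q)"
        by (simp add: abs_minus_commute)
      moreover have "(\<integral>p. \<bar>z' (fst p) (snd p) - u (fst p) (snd p)\<bar> \<partial>?Q)
          \<le> (\<integral>p. \<bar>z' (fst p) (snd p) - v (r i) (fst p) (snd p)\<bar> \<partial>?Q) + (\<integral>p. \<bar>u (fst p) (snd p) - v (r i) (fst p) (snd p)\<bar> \<partial>?Q)"
        by (rule L1_triangle_pair[OF z'(1) b(1) u(1) b(2) vm b(3)])
      ultimately show ?case by linarith
    qed
    moreover have "?B \<longlonglongrightarrow> C * 0 + 0" by (intro tendsto_intros e_lim' L1)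
    ultimately have "(\<integral>p. \<bar>z' (fst p) (snd p) - u (fst p) (snd p)\<bar> \<partial>?Q) \<le> 0"
      using tendsto_lowerbound[of ?B "C * 0 + 0" sequentially] by simp
    moreover have "0 \<le> (\<integral>p. \<bar>z' (fst p) (snd p) - u (fst p) (snd p)\<bar> \<partial>?Q)" by (rule Bochner_Integration.integral_nonneg) auto
    ultimately have "(\<integral>p. \<bar>z' (fst p) (snd p) - u (fst p) (snd p)\<bar> \<partial>?Q) = 0" by linarith
    then have "AE p in ?Q. \<bar>z' (fst p) (snd p) - u (fst p) (snd p)\<bar> = 0"
      by (subst (asm) integral_nonneg_eq_0_iff_AE[OF integrable_abs_diff_pair[OF z'(1) b(1) u(1) b(2)]]) auto
    then have "AE p in ?Q. z (fst p) (snd p) = u (fst p) (snd p)" using z'(3) by eventually_elim auto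
    then show ?thesis by (simp only: AE_pair_ivm_iff)
  qed
  ultimately show ?thesis by blast
qed



end
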